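(* Let $Z$ be a Dedekind domain with field of fractions $Q$, let $K$ be a non-zero étale $Q$-algebra, and let $S$ be an order in $K$. Then the following hold. (1) Let $\mathfrak p$ be a prime of $S$ and $I$ a fractional $S$-ideal with $(I:I)=S$. If $\mathrm{type}_{\mathfrak p}(S)=2$, then either $I_{\mathfrak p}\simeq S_{\mathfrak p}$ or $I_{\mathfrak p}\simeq (S^t)_{\mathfrak p}$ as $S_{\mathfrak p}$-modules. (2) Assume that $\mathrm{type}(S)=2$. Let $N$ be the number of primes $\mathfrak p$ of $S$ such that $\mathrm{type}_{\mathfrak p}(S)=2$. Then $|\mathrm{ICM}_S(S)| = 2^N\cdot|\mathrm{Pic}(S)|$.
   Context: Rings are commutative with unity and non-zero; a Dedekind domain is not a field. An étale $Q$-algebra is one isomorphic to a finite product of finite separable field extensions of $Q$. A lattice in $K$ is a finitely generated sub-$Z$-module of $K$ containing a $Q$-basis of $K$; an order in $K$ is a subring of $K$ that is a lattice. A fractional $S$-ideal is a finitely generated sub-$S$-module of $K$ which is a lattice. A prime of $S$ is a fractional $S$-ideal which is also a prime ideal of $S$ (equivalently, a maximal ideal of $S$). For lattices $I,J$ in $K$, $(I:J)=\{x\in K : xJ\subseteq I\}$; $(I:I)$ is the multiplicator ring of $I$. A fractional $S$-ideal $I$ is invertible if $I(S:I)=S$. The trace dual of a lattice $L$ is $L^t=\{x\in K : \mathrm{Tr}_{K/Q}(xL)\subseteq Z\}$. The subscript $\mathfrak p$ denotes localization at $\mathfrak p$. For a prime $\mathfrak p$ of $S$, $\mathrm{type}_{\mathfrak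 p}(S)=\dim_{S/\mathfrak p}(S^t/\mathfrak p S^t)$, and $\mathrm{type}(S)=\max_{\mathfrak p}\mathrm{type}_{\mathfrak p}(S)$ over all primes of $S$. Two fractional $S$-ideals $I,J$ are isomorphic as $S$-modules if and only if $J=\alpha I$ for some $\alpha\in K^\times$. $\mathrm{Pic}(S)$ is the group of isomorphism classes of invertible fractional $S$-ideals, and $\mathrm{ICM}_S(S)$ is the set of isomorphism classes of fractional $S$-ideals with multiplicator ring $S$. *)

theory Defs
  imports
    "HOL-Algebra.Algebraic_Closure_Type"
    "HOL-Algebra.Ideal_Product"
    "HOL-Algebra.Ring_Divisibility"
    "HOL-Library.Equipollence"
    "Jordan_Normal_Form.Missing_VectorSpace"
    "Jordan_Normal_Form.Matrix"
begin

text \<open>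
  The rings \<open>Z\<close>, \<open>Q\<close>, \<open>K\<close> are types \<open>'z\<close>, \<open>'q\<close>, \<open>'k\<close>, linked by ring homomorphisms
  \<open>\<iota> :: 'z \<Rightarrow> 'q\<close> and \<open>\<phi> :: 'q \<Rightarrow> 'k\<close>. Orders, lattices and ideals are subsets of \<open>'k\<close>.
  The class \<open>comm_ring_1\<close> includes \<open>0 \<noteq> 1\<close>, so \<open>K\<close> is non-zero.
\<close>

section \<open>Dedekind domains\<close>

definition fraction_field :: "('z::idom \<Rightarrow> 'q::field) \<Rightarrow> bool" where
  "fraction_field \<iota> \<longleftrightarrow> comm_ring_hom \<iota> \<and> inj \<iota> \<and> (\<forall>q. \<exists>a b. b \<noteq> 0 \<and> q = \<iota> a / \<iota> b)"

definition dedekind_domain :: "('z::idom \<Rightarrow> 'q::field) \<Rightarrow> bool" where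
  "dedekind_domain \<iota> \<longleftrightarrow>
     noetherian_domain (ring_of_type_algebra :: 'z ring) \<and>
     \<not> Ring.field (ring_of_type_algebra :: 'z ring) \<and>
     (\<forall>P. primeideal P (ring_of_type_algebra :: 'z ring) \<and> P \<noteq> {0}
          \<longrightarrow> maximalideal P (ring_of_type_algebra :: 'z ring)) \<and>
     (\<forall>x. (\<exists>p. lead_coeff p = 1 \<and> poly (map_poly \<iota> p) x = 0) \<longrightarrow> x \<in> range \<iota>)"

section \<open>Etale algebras\<close>

text \<open>
  Every finite field extension of \<open>Q\<close> is isomorphic over \<open>Q\<close> to a subfield of the algebraic
  closure \<open>'q alg_closure\<close>; restricting to such subfields makes it possible to quantify over
  finite families of extensions. An irreducible \<open>f\<close> with root \<open>x\<close> is the minimal polynomial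
  of \<open>x\<close> up to a unit, and \<open>rsquarefree\<close> says that it has no repeated root.
\<close>

definition finite_separable_extension :: "('q::field) alg_closure set \<Rightarrow> bool" where
  "finite_separable_extension L \<longleftrightarrow>
     subfield L (ring_of_type_algebra :: 'q alg_closure ring) \<and> range to_ac \<subseteq> L \<and>
     (\<exists>B. finite B \<and> L = Modules.module.span (\<lambda>q x. to_ac q * x) B) \<and>
     (\<forall>x\<in>L. \<exists>f :: 'q poly. irreducible f \<and> poly (map_poly to_ac f) x = 0 \<and>
                            rsquarefree (map_poly to_ac f))"

definition etale_algebra :: "('q::field \<Rightarrow> 'k::comm_ring_1) \<Rightarrow> bool" where
  "etale_algebra \<phi> \<longleftrightarrow> comm_ring_hom \<phi> \<and>
     (\<exists>(n::nat) L (\<theta> :: 'k \<Rightarrow> nat \<Rightarrow> 'q alg_closure).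
        (\<forall>i<n. finite_separable_extension (L i)) \<and>
        bij_betw \<theta> UNIV (PiE {..<n} L) \<and>
        (\<forall>i<n. (\<forall>x y. \<theta> (x + y) i = \<theta> x i + \<theta> y i) \<and>
               (\<forall>x y. \<theta> (x * y) i = \<theta> x i * \<theta> y i) \<and>
               (\<forall>q. \<theta> (\<phi> q) i = to_ac q)))"

definition scale_by :: "('q::field \<Rightarrow> 'k::comm_ring_1) \<Rightarrow> 'q \<Rightarrow> 'k \<Rightarrow> 'k" where
  "scale_by \<phi> q x = \<phi> q * x"

definition is_basis :: "('q::field \<Rightarrow> 'k::comm_ring_1) \<Rightarrow> 'k set \<Rightarrow> bool" where
  "is_basis \<phi> B \<longleftrightarrow> \<not> Modules.module.dependent (scale_by \<phi>) B \<and>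
                   Modules.module.span (scale_by \<phi>) B = UNIV"

text \<open>The trace of multiplication by \<open>x\<close>, as the sum of the diagonal entries of its matrix.\<close>

definition algebra_trace :: "('q::field \<Rightarrow> 'k::comm_ring_1) \<Rightarrow> 'k \<Rightarrow> 'q" where
  "algebra_trace \<phi> x =
     (let B = (SOME B. is_basis \<phi> B)
      in \<Sum>b\<in>B. Modules.module.representation (scale_by \<phi>) B (x * b) b)"

section \<open>Lattices, orders and fractional ideals\<close>

definition fg_submodule :: "'k::comm_ring_1 set \<Rightarrow> 'k set \<Rightarrow> bool" where
  "fg_submodule R M \<longleftrightarrow> (\<exists>B. finite B \<and> M = {\<Sum>b\<in>B. c b * b |c. c \<in> B \<rightarrow> R})"

definition lattice_in :: "('z::idom \<Rightarrow> 'q::field) \<Rightarrow> ('q \<Rightarrow> 'k::comm_ring_1) \<Rightarrow> 'k set \<Rightarrow> bool" where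
  "lattice_in \<iota> \<phi> L \<longleftrightarrow> fg_submodule (range (\<phi> \<circ> \<iota>)) L \<and> (\<exists>B\<subseteq>L. is_basis \<phi> B)"

definition order_in :: "('z::idom \<Rightarrow> 'q::field) \<Rightarrow> ('q \<Rightarrow> 'k::comm_ring_1) \<Rightarrow> 'k set \<Rightarrow> bool" where
  "order_in \<iota> \<phi> S \<longleftrightarrow> subring S (ring_of_type_algebra :: 'k ring) \<and> lattice_in \<iota> \<phi> S"

definition fractional_ideal ::
  "('z::idom \<Rightarrow> 'q::field) \<Rightarrow> ('q \<Rightarrow> 'k::comm_ring_1) \<Rightarrow> 'k set \<Rightarrow> 'k set \<Rightarrow> bool" where
  "fractional_ideal \<iota> \<phi> S I \<longleftrightarrow> fg_submodule S I \<and> lattice_in \<iota> \<phi> I"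

definition ring_on :: "'k::comm_ring_1 set \<Rightarrow> 'k ring" where
  "ring_on S = (ring_of_type_algebra :: 'k ring)\<lparr>carrier := S\<rparr>"

definition primes_of ::
  "('z::idom \<Rightarrow> 'q::field) \<Rightarrow> ('q \<Rightarrow> 'k::comm_ring_1) \<Rightarrow> 'k set \<Rightarrow> 'k set set" where
  "primes_of \<iota> \<phi> S = {P. fractional_ideal \<iota> \<phi> S P \<and> primeideal P (ring_on S)}"

definition colon :: "'k::comm_ring_1 set \<Rightarrow> 'k set \<Rightarrow> 'k set" where
  "colon I J = {x. \<forall>y\<in>J. x * y \<in> I}"

text \<open>\<open>ideal_prod\<close> is the closure of the set of products under addition; it makes sense for
  arbitrary subsets of \<open>K\<close>, not only for ideals of \<open>K\<close>.\<close>

definition prod_mod :: "'k::comm_ring_1 set \<Rightarrow> 'k set \<Rightarrow> 'k set" where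
  "prod_mod I J = ideal_prod (ring_of_type_algebra :: 'k ring) I J"

definition trace_dual ::
  "('z::idom \<Rightarrow> 'q::field) \<Rightarrow> ('q \<Rightarrow> 'k::comm_ring_1) \<Rightarrow> 'k set \<Rightarrow> 'k set" where
  "trace_dual \<iota> \<phi> L = {x. \<forall>y\<in>L. algebra_trace \<phi> (x * y) \<in> range \<iota>}"

section \<open>Modules, quotients and the type of an order\<close>

text \<open>
  Module records inherit \<open>mult\<close> and \<open>one\<close> from ring records; these fields play no role for
  modules and are left \<open>undefined\<close>.
\<close>

definition module_on :: "'k::comm_ring_1 set \<Rightarrow> ('k, 'k) module" where
  "module_on M = \<lparr>carrier = M, monoid.mult = undefined, one = undefined,
     ring.zero = 0, add = (+), module.smult = (*)\<rparr>"

text \<open>\<open>M/N\<close> as a module over \<open>R/I\<close>; well-behaved if \<open>N\<close> is a submodule containing \<open>I M\<close>.\<close>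

definition quot_module :: "('a, 'm) module \<Rightarrow> 'm set \<Rightarrow> ('a set, 'm set) module" where
  "quot_module M N = \<lparr>carrier = a_rcosets\<^bsub>M\<^esub> N, monoid.mult = undefined, one = undefined,
     ring.zero = N, add = set_add M,
     module.smult = (\<lambda>A C. \<Union>a\<in>A. \<Union>x\<in>C. N +>\<^bsub>M\<^esub> (a \<odot>\<^bsub>M\<^esub> x))\<rparr>"

definition type_at ::
  "('z::idom \<Rightarrow> 'q::field) \<Rightarrow> ('q \<Rightarrow> 'k::comm_ring_1) \<Rightarrow> 'k set \<Rightarrow> 'k set \<Rightarrow> nat" where
  "type_at \<iota> \<phi> S P =
     vectorspace.dim (ring_on S Quot P)
       (quot_module (module_on (trace_dual \<iota> \<phi> S)) (prod_mod P (trace_dual \<iota> \<phi> S)))"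

text \<open>
  The trace dual of an order is finitely generated, so \<open>type_at\<close> is bounded and \<open>Max\<close> is
  taken over a finite set, even when there are infinitely many primes.
\<close>

definition order_type ::
  "('z::idom \<Rightarrow> 'q::field) \<Rightarrow> ('q \<Rightarrow> 'k::comm_ring_1) \<Rightarrow> 'k set \<Rightarrow> nat" where
  "order_type \<iota> \<phi> S = Max (type_at \<iota> \<phi> S ` primes_of \<iota> \<phi> S)"

definition module_iso ::
  "('a, 'r) ring_scheme \<Rightarrow> ('a, 'b, 'm) module_scheme \<Rightarrow> ('a, 'c, 'n) module_scheme \<Rightarrow> bool" where
  "module_iso R M N \<longleftrightarrow> (\<exists>f\<in>module_hom R M N. bij_betw f (carrier M) (carrier N))"

section \<open>Localization\<close>

text \<open>
  \<open>S - P\<close> may contain zero divisors of \<open>K\<close>, so localizations do not embed in \<open>K\<close> in general.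
  A fraction \<open>x/s\<close> is the equivalence class of the pair \<open>(x, s)\<close>.
\<close>

definition loc_rel :: "'k::comm_ring_1 set \<Rightarrow> 'k set \<Rightarrow> 'k set \<Rightarrow> (('k \<times> 'k) \<times> ('k \<times> 'k)) set" where
  "loc_rel S P M = {((x, s), (y, t)). x \<in> M \<and> y \<in> M \<and> s \<in> S - P \<and> t \<in> S - P \<and>
                                      (\<exists>u\<in>S - P. u * (t * x - s * y) = 0)}"

definition frac :: "'k::comm_ring_1 set \<Rightarrow> 'k set \<Rightarrow> 'k set \<Rightarrow> 'k \<Rightarrow> 'k \<Rightarrow> ('k \<times> 'k) set" where
  "frac S P M x s = loc_rel S P M `` {(x, s)}"

definition loc_ring :: "'k::comm_ring_1 set \<Rightarrow> 'k set \<Rightarrow> ('k \<times> 'k) set ring" where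
  "loc_ring S P = \<lparr>carrier = (S \<times> (S - P)) // loc_rel S P S,
     monoid.mult = (\<lambda>A B. \<Union>(x, s)\<in>A. \<Union>(y, t)\<in>B. frac S P S (x * y) (s * t)),
     one = frac S P S 1 1,
     ring.zero = frac S P S 0 1,
     add = (\<lambda>A B. \<Union>(x, s)\<in>A. \<Union>(y, t)\<in>B. frac S P S (t * x + s * y) (s * t))\<rparr>"

definition loc_module ::
  "'k::comm_ring_1 set \<Rightarrow> 'k set \<Rightarrow> 'k set \<Rightarrow> (('k \<times> 'k) set, ('k \<times> 'k) set) module" where
  "loc_module S P M = \<lparr>carrier = (M \<times> (S - P)) // loc_rel S P M,
     monoid.mult = undefined, one = undefined,
     ring.zero = frac S P M 0 1,
     add = (\<lambda>A B. \<Union>(x, s)\<in>A. \<Union>(y, t)\<in>B. frac S P M (t * x + s * y) (s * t)),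
     module.smult = (\<lambda>A B. \<Union>(a, s)\<in>A. \<Union>(x, t)\<in>B. frac S P M (a * x) (s * t))\<rparr>"

section \<open>Ideal classes\<close>

definition iso_classes :: "'k::comm_ring_1 set \<Rightarrow> 'k set set \<Rightarrow> 'k set set set" where
  "iso_classes S F =
     F // {(I, J). I \<in> F \<and> J \<in> F \<and> module_iso (ring_on S) (module_on I) (module_on J)}"

definition Pic ::
  "('z::idom \<Rightarrow> 'q::field) \<Rightarrow> ('q \<Rightarrow> 'k::comm_ring_1) \<Rightarrow> 'k set \<Rightarrow> 'k set set set" where
  "Pic \<iota> \<phi> S = iso_classes S {I. fractional_ideal \<iota> \<phi> S I \<and> prod_mod I (colon S I) = S}"

text \<open>The isomorphism classes of the fractional ideals whose multiplicator ring is exactly \<open>S\<close>.\<close>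

definition ICM ::
  "('z::idom \<Rightarrow> 'q::field) \<Rightarrow> ('q \<Rightarrow> 'k::comm_ring_1) \<Rightarrow> 'k set \<Rightarrow> 'k set set set" where
  "ICM \<iota> \<phi> S = iso_classes S {I. fractional_ideal \<iota> \<phi> S I \<and> colon I I = S}"

end

theory Submission
  imports Defs
begin

text \<open>
  The trace form is nondegenerate (over the algebraic closure the trace is the sum of all algebra
  homomorphisms) and lattices over \<open>Z\<close> are reflexive, so \<open>D = S\<^sup>t\<close> satisfies \<open>(D : (D : I)) = I\<close>
  for all fractional ideals \<open>I\<close>. If \<open>(I : I) = S\<close>, it follows that \<open>I J = D\<close> with \<open>J = (D : I)\<close>.
  When \<open>D/PD\<close> is spanned by two elements, the multiplication \<open>I \<times> J \<rightarrow> D/PD\<close> is surjective for a suitable fixed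
  \<open>x \<in> I\<close> or a suitable fixed \<open>y \<in> J\<close>. By Nakayama's lemma \<open>D\<^sub>P = x J\<^sub>P\<close> or \<open>D\<^sub>P = y I\<^sub>P\<close>, hence
  \<open>I\<^sub>P = x S\<^sub>P\<close> or \<open>I\<^sub>P = y\<^sup>-\<^sup>1 D\<^sub>P\<close>, which is (1).

  For (2), \<open>D\<close> is locally principal exactly at the primes of type at most 1, and the set \<open>T\<close> of the
  other primes is finite. The set of primes in \<open>T\<close> at which \<open>I\<close> is locally isomorphic to \<open>D\<close> can be
  prescribed arbitrarily, and two ideals with the same set are locally isomorphic everywhere, i.e.
  they differ by an invertible factor, which is unique because the multiplicator ring is \<open>S\<close>.
\<close>

section \<open>Submodules of commutative rings\<close>

text \<open>Two obstacles come from zero divisors of \<open>K\<close>: a generator found modulo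
  \<open>P\<close> need not be a unit of \<open>K\<close>, and localizations do not sit inside
  \<open>K\<close>. The first is met by shifting elements by multiples of a suitable element of Z
  until they are units; this works because Z is infinite while \<open>K\<close> has finitely many
  factors. The second is met by naming one denominator \<open>s \<in> S - P\<close>, so that only
  the conclusion of (1) passes to actual localizations. \<open>I J = D\<close> holds because
  \<open>(D : I J) = ((D : J) : I) = (I : I) = S\<close>, whence \<open>I J = (D : S) = D\<close>.
  From \<open>D = x J\<close> at \<open>P\<close> follows \<open>I = x S\<close> at
  \<open>P\<close>, since \<open>i/x\<close> maps \<open>D\<close> into itself for each
  \<open>i \<in> I\<close> and \<open>(D : D) = S\<close>. Lattices over Z need not be free, so
  reflexivity cannot be read off from a basis of the lattice; a functional separating a point from a
  lattice is built one coordinate at a time from inverses of fractional ideals. Pic may be infinite,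
  so the count in (2) is a bijection, which depends on choosing one ideal for each subset of
  \<open>T\<close>.\<close>

definition is_subring :: "'a::comm_ring_1 set \<Rightarrow> bool" where
  "is_subring R \<longleftrightarrow> 1 \<in> R \<and> (\<forall>x\<in>R. \<forall>y\<in>R. x - y \<in> R \<and> x * y \<in> R)"

text \<open>One notion serves for ideals, fractional ideals and lattices. Closure under negation
  follows from \<open>-1 \<in> R\<close> when \<open>R\<close> is a subring.\<close>

definition submod :: "'a::comm_ring_1 set \<Rightarrow> 'a set \<Rightarrow> bool" where
  "submod R M \<longleftrightarrow> 0 \<in> M \<and> (\<forall>x\<in>M. \<forall>y\<in>M. x + y \<in> M) \<and> (\<forall>r\<in>R. \<forall>x\<in>M. r * x \<in> M)"

text \<open>\<open>R\<close> need not be a ring: with a prime ideal \<open>P\<close> in its place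
  this is the module \<open>P B\<close> that occurs in Nakayama's lemma.\<close>

definition lin_span :: "'a::comm_ring_1 set \<Rightarrow> 'a set \<Rightarrow> 'a set" where
  "lin_span R B = {\<Sum>b\<in>B. c b * b |c. c \<in> B \<rightarrow> R}"

definition noeth_module :: "'a::comm_ring_1 set \<Rightarrow> 'a set \<Rightarrow> bool" where
  "noeth_module R M \<longleftrightarrow> (\<forall>N\<subseteq>M. submod R N \<longrightarrow> fg_submodule R N)"

lemma fg_submodule_alt: "fg_submodule R M \<longleftrightarrow> (\<exists>B. finite B \<and> M = lin_span R B)"
  by (simp add: fg_submodule_def lin_span_def)

lemma lin_spanI: "c \<in> B \<rightarrow> R \<Longrightarrow> (\<Sum>b\<in>B. c b * b) \<in> lin_span R B"
  by (auto simp: lin_span_def)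

lemma subringD:
  assumes "is_subring R"
  shows "1 \<in> R" "0 \<in> R" "x \<in> R \<Longrightarrow> y \<in> R \<Longrightarrow> x - y \<in> R" "x \<in> R \<Longrightarrow> y \<in> R \<Longrightarrow> x * y \<in> R"
    "x \<in> R \<Longrightarrow> - x \<in> R" "x \<in> R \<Longrightarrow> y \<in> R \<Longrightarrow> x + y \<in> R"
proof -
  show a: "1 \<in> R" "x \<in> R \<Longrightarrow> y \<in> R \<Longrightarrow> x - y \<in> R" "x \<in> R \<Longrightarrow> y \<in> R \<Longrightarrow> x * y \<in> R" for x y
    using assms by (auto simp: is_subring_def)
  show z: "0 \<in> R" using a(2)[OF a(1) a(1)] by simp
  show u: "x \<in> R \<Longrightarrow> - x \<in> R" for x using a(2)[OF z, of x] by simp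
  show "x \<in> R \<Longrightarrow> y \<in> R \<Longrightarrow> x + y \<in> R" using a(2)[of x "- y"] u by simp
qed

lemma submodD:
  assumes "submod R M"
  shows "0 \<in> M" "x \<in> M \<Longrightarrow> y \<in> M \<Longrightarrow> x + y \<in> M" "r \<in> R \<Longrightarrow> x \<in> M \<Longrightarrow> r * x \<in> M"
  using assms by (auto simp: submod_def)

lemma submod_neg: "submod R M \<Longrightarrow> is_subring R \<Longrightarrow> x \<in> M \<Longrightarrow> - x \<in> M"
  using submodD(3)[of R M "-1" x] subringD(1,5)[of R] by simp

lemma submod_diff: "submod R M \<Longrightarrow> is_subring R \<Longrightarrow> x \<in> M \<Longrightarrow> y \<in> M \<Longrightarrow> x - y \<in> M"
  using submodD(2)[of R M x "-y"] submod_neg[of R M y] by simp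

lemma submod_sum: "submod R M \<Longrightarrow> (\<And>i. i \<in> A \<Longrightarrow> f i \<in> M) \<Longrightarrow> sum f A \<in> M"
  by (induction A rule: infinite_finite_induct) (auto dest: submodD)

lemma submod_self: "is_subring R \<Longrightarrow> submod R R"
  by (auto simp: submod_def subringD)

lemma submod_mono: "submod R M \<Longrightarrow> R' \<subseteq> R \<Longrightarrow> submod R' M"
  by (auto simp: submod_def)

lemma submod_Int: "submod R M \<Longrightarrow> submod R N \<Longrightarrow> submod R (M \<inter> N)"
  by (auto simp: submod_def)

lemma submod_lin_span:
  assumes "is_subring R" shows "submod R (lin_span R B)"
  unfolding submod_def
proof (intro conjI ballI)
  show "0 \<in> lin_span R B" unfolding lin_span_def
    using subringD(2)[OF assms] by (force intro!: exI[of _ "\<lambda>_. 0"])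
next
  fix x y assume "x \<in> lin_span R B" "y \<in> lin_span R B"
  then obtain c d where c: "c \<in> B \<rightarrow> R" "x = (\<Sum>b\<in>B. c b * b)" and d: "d \<in> B \<rightarrow> R" "y = (\<Sum>b\<in>B. d b * b)"
    by (auto simp: lin_span_def)
  have "x + y = (\<Sum>b\<in>B. (c b + d b) * b)" by (simp add: c d sum.distrib distrib_right)
  moreover have "(\<lambda>b. c b + d b) \<in> B \<rightarrow> R" using c d subringD(6)[OF assms] by auto
  ultimately show "x + y \<in> lin_span R B" by (auto simp: lin_span_def)
next
  fix r x assume "r \<in> R" "x \<in> lin_span R B"
  then obtain c where c: "c \<in> B \<rightarrow> R" "x = (\<Sum>b\<in>B. c b * b)"
    by (auto simp: lin_span_def)
  have "r * x = (\<Sum>b\<in>B. (r * c b) * b)" by (simp add: c sum_distrib_left mult.assoc)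
  moreover have "(\<lambda>b. r * c b) \<in> B \<rightarrow> R" using c \<open>r \<in> R\<close> subringD(4)[OF assms] by auto
  ultimately show "r * x \<in> lin_span R B" by (auto simp: lin_span_def)
qed

lemma lin_span_least: "submod R M \<Longrightarrow> B \<subseteq> M \<Longrightarrow> lin_span R B \<subseteq> M"
  unfolding lin_span_def by (auto intro!: submod_sum submodD(3))

lemma lin_span_base:
  assumes "is_subring R" "finite B" "b \<in> B" shows "b \<in> lin_span R B"
proof -
  have "b = (\<Sum>x\<in>B. (if x = b then 1 else 0) * x)"
    using assms by (simp add: if_distrib[of "\<lambda>x. x * _"] cong: if_cong)
  moreover have "(\<lambda>x. if x = b then 1 else 0) \<in> B \<rightarrow> R" using subringD[OF assms(1)] by auto
  ultimately show ?thesis using lin_spanI by metis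
qed

lemma fg_submodule_submod: "fg_submodule R M \<Longrightarrow> is_subring R \<Longrightarrow> submod R M"
  by (auto simp: fg_submodule_alt submod_lin_span)

section \<open>Noetherian modules\<close>

lemma lin_span_insertE:
  assumes "finite B" "b \<notin> B" "x \<in> lin_span R (insert b B)"
  obtains r y where "r \<in> R" "y \<in> lin_span R B" "x = r * b + y"
proof -
  obtain c where c: "c \<in> insert b B \<rightarrow> R" "x = (\<Sum>b\<in>insert b B. c b * b)"
    using assms by (auto simp: lin_span_def)
  have "x = c b * b + (\<Sum>b\<in>B. c b * b)" using c assms by simp
  then show ?thesis using that[of "c b" "\<Sum>b\<in>B. c b * b"] c by (auto simp: lin_span_def)
qed

text \<open>Induction on the number of generators. The coefficients of \<open>b\<close> in elements
  of \<open>M\<close> form an ideal \<open>a\<close>, which is finitely generated; lifts of its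
  generators to \<open>M\<close>, together with generators of
  \<open>M \<inter> lin_span R B\<close>, generate \<open>M\<close>.\<close>

lemma noeth_module_lin_span:
  assumes R: "is_subring R" and N: "noeth_module R R" and B: "finite B"
  shows "noeth_module R (lin_span R B)"
  using B
proof induction
  case empty
  have "M = lin_span R {}" if "M \<subseteq> lin_span R {}" "submod R M" for M
    using that submodD(1) by (auto simp: lin_span_def)
  then show ?case unfolding noeth_module_def fg_submodule_alt by blast
next
  case (insert b B)
  show ?case unfolding noeth_module_def
  proof (intro allI impI)
    fix M assume M: "M \<subseteq> lin_span R (insert b B)" "submod R M"
    note sp = submod_lin_span[OF R, of B]
    define a where "a = {r \<in> R. \<exists>y\<in>lin_span R B. r * b + y \<in> M}"
    have "submod R a" unfolding submod_def
    proof (intro conjI ballI)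
      show "0 \<in> a" using submodD(1)[OF sp] submodD(1)[OF M(2)] subringD(2)[OF R] by (auto simp: a_def)
    next
      fix x y assume "x \<in> a" "y \<in> a"
      then obtain u v where u: "x \<in> R" "u \<in> lin_span R B" "x * b + u \<in> M"
        and v: "y \<in> R" "v \<in> lin_span R B" "y * b + v \<in> M" by (auto simp: a_def)
      have "(x + y) * b + (u + v) \<in> M" using submodD(2)[OF M(2) u(3) v(3)] by (simp add: algebra_simps)
      then show "x + y \<in> a" using u v submodD(2)[OF sp u(2) v(2)] subringD(6)[OF R] by (auto simp: a_def)
    next
      fix r x assume "r \<in> R" "x \<in> a"
      then obtain u where u: "x \<in> R" "u \<in> lin_span R B" "x * b + u \<in> M" by (auto simp: a_def)
      have "(r * x) * b + (r * u) \<in> M" using submodD(3)[OF M(2) \<open>r \<in> R\<close> u(3)] by (simp add: algebra_simps)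
      then show "r * x \<in> a" using u \<open>r \<in> R\<close> submodD(3)[OF sp] subringD(4)[OF R] by (auto simp: a_def)
    qed
    then have "fg_submodule R a" using N by (auto simp: noeth_module_def a_def)
    then obtain C where C: "finite C" "a = lin_span R C" by (auto simp: fg_submodule_alt)
    have "\<forall>c\<in>C. \<exists>y\<in>lin_span R B. c * b + y \<in> M"
      using lin_span_base[OF R C(1)] C(2) by (auto simp: a_def)
    then obtain y where y: "\<And>c. c \<in> C \<Longrightarrow> y c \<in> lin_span R B" "\<And>c. c \<in> C \<Longrightarrow> c * b + y c \<in> M" by metis
    have "fg_submodule R (M \<inter> lin_span R B)"
      using insert.IH submod_Int[OF M(2) sp] by (auto simp: noeth_module_def)
    then obtain C' where C': "finite C'" "M \<inter> lin_span R B = lin_span R C'" by (auto simp: fg_submodule_alt)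
    define G where "G = C' \<union> (\<lambda>c. c * b + y c) ` C"
    have fG: "finite G" using C C' by (simp add: G_def)
    have G: "C' \<subseteq> lin_span R G" "\<And>c. c \<in> C \<Longrightarrow> c * b + y c \<in> lin_span R G"
      using lin_span_base[OF R fG] by (auto simp: G_def)
    note sG = submod_lin_span[OF R, of G]
    have "G \<subseteq> M" using y(2) C' lin_span_base[OF R C'(1)] by (auto simp: G_def)
    then have "lin_span R G \<subseteq> M" by (rule lin_span_least[OF M(2)])
    moreover have "M \<subseteq> lin_span R G"
    proof
      fix x assume x: "x \<in> M"
      obtain r v where rv: "r \<in> R" "v \<in> lin_span R B" "x = r * b + v"
        using lin_span_insertE[OF insert.hyps, of x R] M(1) x by blast
      then have "r \<in> lin_span R C" using x C(2) by (auto simp: a_def)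
      then obtain s where s: "s \<in> C \<rightarrow> R" "r = (\<Sum>c\<in>C. s c * c)" by (auto simp: lin_span_def)
      \<comment> \<open>\<open>w\<close> combines the lifted generators so that it has the same
        coefficient at \<open>b\<close> as \<open>x\<close>; hence \<open>x - w\<close> falls into
        \<open>M \<inter> lin_span R B\<close>.\<close>
      define w where "w = (\<Sum>c\<in>C. s c * (c * b + y c))"
      have w: "w \<in> lin_span R G" unfolding w_def
        by (rule submod_sum[OF sG]) (use s G in \<open>auto intro!: submodD(3)[OF sG]\<close>)
      have w': "w = r * b + (\<Sum>c\<in>C. s c * y c)"
        by (simp add: w_def s(2) sum_distrib_right distrib_left sum.distrib mult.assoc)
      have "(\<Sum>c\<in>C. s c * y c) \<in> lin_span R B"
        by (rule submod_sum[OF sp]) (use s y in \<open>auto intro!: submodD(3)[OF sp]\<close>)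
      then have "x - w \<in> lin_span R B" unfolding w' rv(3)
        using submod_diff[OF sp R rv(2)] by (simp add: algebra_simps)
      moreover have "x - w \<in> M" using submod_diff[OF M(2) R x] w \<open>lin_span R G \<subseteq> M\<close> by blast
      ultimately have "x - w \<in> lin_span R C'" using C'(2) by blast
      then have "x - w \<in> lin_span R G" using lin_span_least[OF sG G(1)] by blast
      then show "x \<in> lin_span R G" using submodD(2)[OF sG _ w, of "x - w"] by simp
    qed
    ultimately show "fg_submodule R M" using fG by (auto simp: fg_submodule_alt)
  qed
qed

lemma noeth_module_fg:
  "is_subring R \<Longrightarrow> noeth_module R R \<Longrightarrow> fg_submodule R M \<Longrightarrow> noeth_module R M"
  using noeth_module_lin_span by (auto simp: fg_submodule_alt)

lemma fg_submodule_mono: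
  assumes "is_subring R" "is_subring R'" "R \<subseteq> R'" "fg_submodule R M" "submod R' M"
  shows "fg_submodule R' M"
proof -
  obtain B where B: "finite B" "M = lin_span R B" using assms by (auto simp: fg_submodule_alt)
  have "B \<subseteq> M" using lin_span_base[OF assms(1) B(1)] B(2) by auto
  then have "lin_span R' B \<subseteq> M" using lin_span_least assms(5) by blast
  moreover have "M \<subseteq> lin_span R' B" using B(2) assms(3) by (auto simp: lin_span_def)
  ultimately show ?thesis using B(1) by (auto simp: fg_submodule_alt)
qed

lemma submod_scale:
  assumes "submod S I" shows "submod S ((*) x ` I)"
  unfolding submod_def
proof (intro conjI ballI)
  show "0 \<in> (*) x ` I" using submodD(1)[OF assms] by (intro image_eqI[of _ _ 0]) auto
  show "a + b \<in> (*) x ` I" if "a \<in> (*) x ` I" "b \<in> (*) x ` I" for a b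
    using that submodD(2)[OF assms] by (auto simp flip: distrib_left)
  show "r * a \<in> (*) x ` I" if "r \<in> S" "a \<in> (*) x ` I" for r a
    using that submodD(3)[OF assms] by (auto simp: mult.left_commute[of r x])
qed

lemma fg_submodule_scale:
  assumes "fg_submodule R M" "is_subring R" shows "fg_submodule R ((*) e ` M)"
proof -
  obtain B where B: "finite B" "M = lin_span R B" using assms by (auto simp: fg_submodule_alt)
  have sub: "submod R (lin_span R ((*) e ` B))" by (rule submod_lin_span[OF assms(2)])
  have "(*) e ` M = lin_span R ((*) e ` B)"
  proof
    have "(*) e ` B \<subseteq> (*) e ` M" using lin_span_base[OF assms(2) B(1)] B(2) by blast
    then show "lin_span R ((*) e ` B) \<subseteq> (*) e ` M"
      by (intro lin_span_least submod_scale fg_submodule_submod assms)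
    show "(*) e ` M \<subseteq> lin_span R ((*) e ` B)"
    proof (rule image_subsetI)
      fix x assume "x \<in> M"
      then obtain c where c: "c \<in> B \<rightarrow> R" "x = (\<Sum>b\<in>B. c b * b)" using B(2) by (auto simp: lin_span_def)
      have "e * x = (\<Sum>b\<in>B. c b * (e * b))" by (simp add: c(2) sum_distrib_left mult.left_commute)
      also have "\<dots> \<in> lin_span R ((*) e ` B)"
      proof (rule submod_sum[OF sub])
        fix b assume "b \<in> B"
        then show "c b * (e * b) \<in> lin_span R ((*) e ` B)"
          using c(1) B(1) by (intro submodD(3)[OF sub] lin_span_base[OF assms(2)]) auto
      qed
      finally show "e * x \<in> lin_span R ((*) e ` B)" .
    qed
  qed
  then show ?thesis using B(1) by (auto simp: fg_submodule_alt)
qed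

lemma noeth_module_mono:
  assumes "is_subring R" "is_subring R'" "R \<subseteq> R'" "noeth_module R M"
  shows "noeth_module R' M"
  using assms fg_submodule_mono submod_mono unfolding noeth_module_def by metis

lemma finite_subset_chain_Union:
  assumes "finite A" "A \<subseteq> \<Union>C" "C \<noteq> {}" "\<And>U' V'. U' \<in> C \<Longrightarrow> V' \<in> C \<Longrightarrow> U' \<subseteq> V' \<or> V' \<subseteq> U'"
  shows "\<exists>U'\<in>C. A \<subseteq> U'"
  using assms(1,2)
proof induction
  case empty
  then show ?case using assms(3) by auto
next
  case (insert a A)
  then obtain U' V' where "U' \<in> C" "A \<subseteq> U'" "V' \<in> C" "a \<in> V'" by auto
  then show ?case using assms(4)[of U' V'] by blast
qed

lemma submod_chain_Union:
  assumes "C \<noteq> {}" "\<And>U' V'. U' \<in> C \<Longrightarrow> V' \<in> C \<Longrightarrow> U' \<subseteq> V' \<or> V' \<subseteq> U'" "\<And>U'. U' \<in> C \<Longrightarrow> submod R U'"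
  shows "submod R (\<Union>C)"
  unfolding submod_def
proof (intro conjI ballI)
  show "0 \<in> \<Union>C" using assms submodD(1) by blast
next
  fix x y assume "x \<in> \<Union>C" "y \<in> \<Union>C"
  then obtain U' where "U' \<in> C" "{x, y} \<subseteq> U'"
    using finite_subset_chain_Union[of "{x, y}" C] assms by auto
  then show "x + y \<in> \<Union>C" using assms(3) submodD(2) by blast
next
  fix r x assume "r \<in> R" "x \<in> \<Union>C"
  then show "r * x \<in> \<Union>C" using assms(3) submodD(3) by blast
qed

text \<open>The union is finitely generated, and a finite set of generators already lies in one
  member of the chain.\<close>

lemma noeth_chain_Union:
  assumes R: "is_subring R" and M: "noeth_module R M" and C: "C \<noteq> {}"
    "\<And>U V. U \<in> C \<Longrightarrow> V \<in> C \<Longrightarrow> U \<subseteq> V \<or> V \<subseteq> U"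
    and sub: "\<And>U. U \<in> C \<Longrightarrow> submod R U" "\<And>U. U \<in> C \<Longrightarrow> U \<subseteq> M"
  shows "\<Union>C \<in> C"
proof -
  have "submod R (\<Union>C)" by (rule submod_chain_Union[OF C sub(1)])
  moreover have "\<Union>C \<subseteq> M" using sub(2) by blast
  ultimately have "fg_submodule R (\<Union>C)" using M by (simp add: noeth_module_def)
  then obtain B where B: "finite B" "\<Union>C = lin_span R B" by (auto simp: fg_submodule_alt)
  have "B \<subseteq> \<Union>C" using lin_span_base[OF R B(1)] B(2) by auto
  from finite_subset_chain_Union[OF B(1) this C] obtain U where U: "U \<in> C" "B \<subseteq> U" by blast
  have "lin_span R B \<subseteq> U" by (rule lin_span_least[OF sub(1)[OF U(1)] U(2)])
  then have "\<Union>C = U" using U(1) B(2) by blast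
  then show ?thesis using U(1) by simp
qed

text \<open>Zorn's lemma applies because every nonempty chain contains its own union.\<close>

lemma noeth_max:
  assumes "is_subring R" "noeth_module R M" "F \<noteq> {}" "\<And>N. N \<in> F \<Longrightarrow> submod R N \<and> N \<subseteq> M"
  obtains N where "N \<in> F" "\<And>N'. N' \<in> F \<Longrightarrow> N \<subseteq> N' \<Longrightarrow> N' = N"
proof -
  have "\<exists>U\<in>F. \<forall>U'\<in>C. U' \<subseteq> U" if C: "subset.chain F C" for C
  proof (cases "C = {}")
    case False
    have CF: "C \<subseteq> F" "\<And>U V. U \<in> C \<Longrightarrow> V \<in> C \<Longrightarrow> U \<subseteq> V \<or> V \<subseteq> U"
      using C unfolding subset_chain_def by blast+
    have "\<Union>C \<in> C"
    proof (rule noeth_chain_Union[OF assms(1,2) False CF(2)])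
      show "submod R U" "U \<subseteq> M" if "U \<in> C" for U using CF(1) assms(4) that by auto
    qed
    then show ?thesis using CF(1) by (intro bexI[of _ "\<Union>C"]) auto
  qed (use assms in auto)
  then have "\<exists>N\<in>F. \<forall>U'\<in>F. N \<subseteq> U' \<longrightarrow> U' = N"
    by (rule subset_Zorn)
  then show ?thesis using that by blast
qed

text \<open>The factor \<open>c\<close> is a common denominator of the powers of \<open>x\<close>.\<close>

lemma noeth_power_relation:
  assumes R: "is_subring R" and M: "noeth_module R M" "submod R M" and x: "\<And>n. x ^ n * c \<in> M"
  obtains n z where "\<And>i. z i \<in> R" "x ^ n * c = (\<Sum>i<n. z i * x ^ i) * c"
proof -
  \<comment> \<open>The ascending submodules generated by \<open>c, x c, ..., x^(n-1) c\<close>.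
    Their union equals some \<open>W N\<close>; as it contains \<open>x ^ N * c\<close>, this is the
    desired relation.\<close>
  define W where "W n = {(\<Sum>i<n. z i * x ^ i) * c |z. \<forall>i. z i \<in> R}" for n
  have WI: "(\<Sum>i<n. z i * x ^ i) * c \<in> W n" if "\<forall>i. z i \<in> R" for n z
    using that by (auto simp: W_def)
  have sub: "submod R (W n)" for n
    unfolding submod_def
  proof (intro conjI ballI)
    show "0 \<in> W n" using WI[of "\<lambda>_. 0" n] subringD(2)[OF R] by simp
  next
    fix a b assume "a \<in> W n" "b \<in> W n"
    then obtain z w where "a = (\<Sum>i<n. z i * x ^ i) * c" "\<forall>i. z i \<in> R"
      "b = (\<Sum>i<n. w i * x ^ i) * c" "\<forall>i. w i \<in> R" by (auto simp: W_def)
    then show "a + b \<in> W n" using WI[of "\<lambda>i. z i + w i" n] subringD(6)[OF R]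
      by (simp add: algebra_simps sum.distrib)
  next
    fix r a assume "r \<in> R" "a \<in> W n"
    then obtain z where "a = (\<Sum>i<n. z i * x ^ i) * c" "\<forall>i. z i \<in> R" by (auto simp: W_def)
    moreover from this have "r * a = (\<Sum>i<n. (r * z i) * x ^ i) * c"
      by (simp add: sum_distrib_left sum_distrib_right mult.assoc)
    ultimately show "r * a \<in> W n" using WI[of "\<lambda>i. r * z i" n] subringD(4)[OF R] \<open>r \<in> R\<close>
      by simp
  qed
  have mono: "W n \<subseteq> W m" if "n \<le> m" for n m
  proof
    fix a assume "a \<in> W n"
    then obtain z where z: "a = (\<Sum>i<n. z i * x ^ i) * c" "\<forall>i. z i \<in> R" by (auto simp: W_def)
    have "(\<Sum>i<m. (if i < n then z i else 0) * x ^ i) = (\<Sum>i<n. z i * x ^ i)"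
      using that by (intro sum.mono_neutral_cong_right) auto
    then show "a \<in> W m" using WI[of "\<lambda>i. if i < n then z i else 0" m] z subringD(2)[OF R] by simp
  qed
  have "W n \<subseteq> M" for n
  proof
    fix a assume "a \<in> W n"
    then obtain z where z: "a = (\<Sum>i<n. z i * x ^ i) * c" "\<forall>i. z i \<in> R" by (auto simp: W_def)
    have "a = (\<Sum>i<n. z i * (x ^ i * c))" by (simp add: z sum_distrib_right mult.assoc)
    then show "a \<in> M" using submod_sum[OF M(2), of "{..<n}"] submodD(3)[OF M(2)] z(2) x by simp
  qed
  then have "\<Union>(range W) \<in> range W"
  proof (intro noeth_chain_Union[OF R M(1)])
    fix U V assume "U \<in> range W" "V \<in> range W"
    then obtain i j where "U = W i" "V = W j" by blast
    then show "U \<subseteq> V \<or> V \<subseteq> U" using mono[of i j] mono[of j i] nat_le_linear[of i j] by blast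
  qed (use sub \<open>\<And>n. W n \<subseteq> M\<close> in auto)
  then obtain N where N: "\<Union>(range W) = W N" by auto
  have "(\<Sum>i<Suc N. (if i = N then 1 else 0) * x ^ i) * c \<in> W (Suc N)"
    by (intro WI) (simp add: subringD(1,2)[OF R])
  moreover have "(\<Sum>i<Suc N. (if i = N then 1 else 0) * x ^ i) * c = x ^ N * c"
    by (simp add: if_distrib[of "\<lambda>y. y * _"] cong: if_cong)
  ultimately have "x ^ N * c \<in> \<Union>(range W)" by (metis UN_I UNIV_I)
  then have "x ^ N * c \<in> W N" by (simp only: N)
  then obtain z where "x ^ N * c = (\<Sum>i<N. z i * x ^ i) * c" "\<forall>i. z i \<in> R"
    unfolding W_def by blast
  then show ?thesis using that[of z N] by blast
qed

section \<open>Prime ideals\<close>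

definition adjoin :: "'a::comm_ring_1 set \<Rightarrow> 'a set \<Rightarrow> 'a \<Rightarrow> 'a set" where
  "adjoin R M x = {m + r * x |m r. m \<in> M \<and> r \<in> R}"

definition prime_in :: "'a::comm_ring_1 set \<Rightarrow> 'a set \<Rightarrow> bool" where
  "prime_in R P \<longleftrightarrow> submod R P \<and> P \<subseteq> R \<and> 1 \<notin> P \<and> (\<forall>x\<in>R. \<forall>y\<in>R. x * y \<in> P \<longrightarrow> x \<in> P \<or> y \<in> P)"

lemma prime_inD:
  assumes "prime_in R P"
  shows "submod R P" "P \<subseteq> R" "1 \<notin> P" "x \<in> R \<Longrightarrow> y \<in> R \<Longrightarrow> x * y \<in> P \<Longrightarrow> x \<in> P \<or> y \<in> P"
  using assms by (auto simp: prime_in_def)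

lemma submod_adjoin:
  assumes R: "is_subring R" and M: "submod R M"
  shows "submod R (adjoin R M x)" "M \<subseteq> adjoin R M x" "x \<in> adjoin R M x"
proof -
  show "M \<subseteq> adjoin R M x" using subringD(2)[OF R] by (force simp: adjoin_def)
  show "x \<in> adjoin R M x" using subringD(1)[OF R] submodD(1)[OF M] by (force simp: adjoin_def)
  show "submod R (adjoin R M x)" unfolding submod_def
  proof (intro conjI ballI)
    show "0 \<in> adjoin R M x" using subringD(2)[OF R] submodD(1)[OF M] by (force simp: adjoin_def)
  next
    fix a b assume "a \<in> adjoin R M x" "b \<in> adjoin R M x"
    then obtain m r n s where "m \<in> M" "r \<in> R" "a = m + r * x" "n \<in> M" "s \<in> R" "b = n + s * x"
      by (auto simp: adjoin_def)
    moreover from this have "a + b = (m + n) + (r + s) * x" by (simp add: algebra_simps)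
    ultimately show "a + b \<in> adjoin R M x" using submodD(2)[OF M] subringD(6)[OF R]
      unfolding adjoin_def by blast
  next
    fix t a assume "t \<in> R" "a \<in> adjoin R M x"
    then obtain m r where "m \<in> M" "r \<in> R" "a = m + r * x" by (auto simp: adjoin_def)
    moreover from this have "t * a = t * m + (t * r) * x" by (simp add: algebra_simps)
    ultimately show "t * a \<in> adjoin R M x" using \<open>t \<in> R\<close> submodD(3)[OF M] subringD(4)[OF R]
      unfolding adjoin_def by blast
  qed
qed

lemma adjoin_subset: "submod R N \<Longrightarrow> M \<subseteq> N \<Longrightarrow> x \<in> N \<Longrightarrow> adjoin R M x \<subseteq> N"
  by (auto simp: adjoin_def intro!: submodD)

text \<open>Take \<open>P\<close> maximal among the proper ideals over \<open>I\<close>. For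
  \<open>x\<close>, \<open>y\<close> outside \<open>P\<close> there are relations
  \<open>1 = p + r x\<close> and \<open>1 = q + s y\<close>; multiplying them out would put 1 into
  \<open>P\<close> if \<open>x y\<close> were in \<open>P\<close>.\<close>

lemma prime_above:
  assumes R: "is_subring R" "noeth_module R R" and I: "submod R I" "I \<subseteq> R" "1 \<notin> I"
  obtains P where "prime_in R P" "I \<subseteq> P"
proof -
  define F where "F = {J. submod R J \<and> J \<subseteq> R \<and> 1 \<notin> J \<and> I \<subseteq> J}"
  obtain P where P: "P \<in> F" "\<And>N'. N' \<in> F \<Longrightarrow> P \<subseteq> N' \<Longrightarrow> N' = P"
    by (rule noeth_max[OF R, of F]) (use I in \<open>auto simp: F_def\<close>)
  have P': "submod R P" "P \<subseteq> R" "1 \<notin> P" "I \<subseteq> P" using P(1) by (auto simp: F_def)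
  have one: "\<exists>p r. p \<in> P \<and> r \<in> R \<and> 1 = p + r * x" if "x \<in> R" "x \<notin> P" for x
  proof -
    note ad = submod_adjoin[OF R(1) P'(1), of x]
    have "adjoin R P x \<notin> F" using P(2)[of "adjoin R P x"] ad that by blast
    then have "1 \<in> adjoin R P x"
      using ad P' adjoin_subset[OF submod_self[OF R(1)] P'(2) that(1)] unfolding F_def by blast
    then show ?thesis by (auto simp: adjoin_def)
  qed
  have "x \<in> P \<or> y \<in> P" if xy: "x \<in> R" "y \<in> R" "x * y \<in> P" for x y
  proof (rule ccontr)
    assume "\<not> (x \<in> P \<or> y \<in> P)"
    then obtain p r q s where pr: "p \<in> P" "r \<in> R" "1 = p + r * x" "q \<in> P" "s \<in> R" "1 = q + s * y"
      using one xy by metis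
    have "1 = (p + r * x) * (q + s * y)" using pr by (metis mult_1)
    also have "\<dots> = q * p + (r * x) * q + (s * y) * p + (r * s) * (x * y)" by (simp add: algebra_simps)
    also have "\<dots> \<in> P"
      using submodD(3)[OF P'(1), of q p] submodD(3)[OF P'(1), of "r * x" q]
        submodD(3)[OF P'(1), of "s * y" p] submodD(3)[OF P'(1), of "r * s" "x * y"]
        pr xy P'(2) subringD(4)[OF R(1)]
      by (intro submodD(2)[OF P'(1)]) auto
    finally show False using P' by simp
  qed
  then have "prime_in R P" using P' by (simp add: prime_in_def)
  then show ?thesis using that P'(4) by blast
qed

section \<open>Invertibility of ideals in Dedekind domains\<close>

text \<open>The condition \<open>1 \<in> I (R : I)\<close> with the finite sum spelled out as a list
  of pairs. These pairs later serve as a dual basis which splits off a direct summand of a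
  lattice.\<close>

definition inv_ideal :: "'q::field set \<Rightarrow> 'q set \<Rightarrow> bool" where
  "inv_ideal R I \<longleftrightarrow> (\<exists>ps. (\<forall>(u, l)\<in>set ps. l \<in> I \<and> (\<forall>x\<in>I. u * x \<in> R)) \<and> (\<Sum>(u, l)\<leftarrow>ps. u * l) = 1)"

text \<open>Z is viewed as a subring \<open>R\<close> of Q, so that its ideals and fractional ideals
  are subsets of one field. Maximality is phrased as invertibility modulo \<open>P\<close>, and
  integrality by a family of coefficients, which keeps polynomials out of the arguments.\<close>

locale dedekind_subring =
  fixes R :: "'q::field set"
  assumes subring: "is_subring R" and noeth: "noeth_module R R"
    and maximal: "prime_in R P \<Longrightarrow> P \<noteq> {0} \<Longrightarrow> x \<in> R \<Longrightarrow> x \<notin> P \<Longrightarrow> \<exists>y\<in>R. 1 - y * x \<in> P"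
    and int_closed: "(\<And>i. z i \<in> R) \<Longrightarrow> x ^ n = (\<Sum>i<n. z i * x ^ i) \<Longrightarrow> x \<in> R"
begin

lemmas R = subringD[OF subring]

text \<open>A minimal prime \<open>P\<close> over \<open>aR\<close> is associated to \<open>aR\<close>: a maximal ideal among those
  \<open>(aR : c)\<close> contained in \<open>P\<close> is prime, hence equal to \<open>P\<close>; then \<open>c/a\<close> is the required element.\<close>

lemma prime_inverse_element:
  assumes P: "prime_in R P" "P \<noteq> {0}"
  obtains u where "u \<notin> R" "\<And>x. x \<in> P \<Longrightarrow> u * x \<in> R"
proof -
  note Pm = prime_inD[OF P(1)]
  obtain a where a: "a \<in> P" "a \<noteq> 0" using P submodD(1)[OF Pm(1)] by blast
  have aR: "a \<in> R" using a Pm by blast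
  \<comment> \<open>\<open>Q c\<close> is the ideal quotient \<open>(a R : c)\<close>.\<close>
  define Q where "Q c = {x \<in> R. \<exists>y\<in>R. x * c = y * a}" for c
  define F where "F = {Q c |c. c \<in> R \<and> Q c \<subseteq> P}"
  have subQ: "submod R (Q c)" for c
    unfolding submod_def
  proof (intro conjI ballI)
    show "0 \<in> Q c" using R(2) by (auto simp: Q_def)
  next
    fix x y assume "x \<in> Q c" "y \<in> Q c"
    then obtain s t where "x \<in> R" "s \<in> R" "x * c = s * a" "y \<in> R" "t \<in> R" "y * c = t * a" by (auto simp: Q_def)
    moreover from this have "(x + y) * c = (s + t) * a" by (simp add: distrib_right)
    ultimately show "x + y \<in> Q c" using R(6) unfolding Q_def by blast
  next
    fix r x assume "r \<in> R" "x \<in> Q c"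
    moreover from this obtain s where "x \<in> R" "s \<in> R" "x * c = s * a" by (auto simp: Q_def)
    moreover from this have "(r * x) * c = (r * s) * a" by (simp add: mult.assoc)
    ultimately show "r * x \<in> Q c" using R(4) unfolding Q_def by blast
  qed
  have "Q 1 \<subseteq> P" using submodD(3)[OF Pm(1) _ a(1)] by (auto simp: Q_def)
  then have "Q 1 \<in> F" using R(1) unfolding F_def by blast
  then have ne: "F \<noteq> {}" by blast
  have Fs: "submod R N \<and> N \<subseteq> R" if "N \<in> F" for N using that subQ by (auto simp: F_def Q_def)
  obtain q where q: "q \<in> F" "\<And>N'. N' \<in> F \<Longrightarrow> q \<subseteq> N' \<Longrightarrow> N' = q"
    by (rule noeth_max[OF subring noeth ne Fs]) blast+
  obtain c where c: "c \<in> R" "Q c \<subseteq> P" "q = Q c" using q(1) by (auto simp: F_def)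
  \<comment> \<open>If \<open>y\<close> witnesses that \<open>Q (c * z)\<close> is strictly larger
    than \<open>Q c\<close>, then by maximality of \<open>Q c\<close> in \<open>F\<close> the ideal
    \<open>Q (c * z)\<close> is not contained in \<open>P\<close>; \<open>w\<close> is an element of
    it outside \<open>P\<close>.\<close>
  have step: "\<exists>w\<in>R. w \<notin> P \<and> w * z \<in> Q c" if z: "z \<in> R" "y \<in> R" "y \<notin> Q c" "y * z \<in> Q c" for y z
  proof -
    have "Q c \<subseteq> Q (c * z)"
    proof
      fix x assume "x \<in> Q c"
      then obtain s where "x \<in> R" "s \<in> R" "x * c = s * a" by (auto simp: Q_def)
      moreover from this have "x * (c * z) = (s * z) * a" by (metis mult.assoc mult.commute)
      ultimately show "x \<in> Q (c * z)" using R(4)[of s z] z(1) unfolding Q_def by blast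
    qed
    moreover have "y \<in> Q (c * z)" using z by (auto simp: Q_def mult_ac)
    ultimately have "Q (c * z) \<notin> F" using q(2)[of "Q (c * z)"] c(3) z(3) by blast
    then have "\<not> Q (c * z) \<subseteq> P" using R(4)[OF c(1) z(1)] unfolding F_def by blast
    then obtain w where "w \<in> Q (c * z)" "w \<notin> P" by blast
    then show ?thesis using R(4) z by (intro bexI[of _ w]) (auto simp: Q_def mult_ac)
  qed
  have "prime_in R q"
    unfolding prime_in_def
  proof (intro conjI ballI impI)
    show "submod R q" "q \<subseteq> R" using Fs[OF q(1)] by auto
    show "1 \<notin> q" using c Pm by blast
    fix y z assume yz: "y \<in> R" "z \<in> R" "y * z \<in> q"
    show "y \<in> q \<or> z \<in> q"
    proof (rule ccontr)
      assume "\<not> (y \<in> q \<or> z \<in> q)"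
      then have n: "y \<notin> Q c" "z \<notin> Q c" using c by auto
      obtain w where w: "w \<in> R" "w \<notin> P" "w * z \<in> Q c" using step[of z y] yz n c by blast
      obtain w' where w': "w' \<in> R" "w' \<notin> P" "w' * w \<in> Q c"
        using step[of w z] yz n w by (auto simp: mult.commute)
      then show False using w c Pm(4)[of w' w] by blast
    qed
  qed
  moreover have "a \<in> Q c" using aR c by (auto simp: Q_def mult.commute)
  ultimately have qmax: "\<exists>y\<in>R. 1 - y * x \<in> q" if "x \<in> R" "x \<notin> q" for x
    using maximal[of q x] a c that by auto
  \<comment> \<open>\<open>Q c\<close> is a nonzero prime inside \<open>P\<close>, hence maximal, so
    an element of \<open>P\<close> outside \<open>Q c\<close> would put 1 into
    \<open>P\<close>.\<close>
  have Pq: "P \<subseteq> Q c"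
  proof (rule ccontr)
    assume "\<not> P \<subseteq> Q c"
    then obtain x where x: "x \<in> P" "x \<notin> q" using c by blast
    then obtain y where y: "y \<in> R" "1 - y * x \<in> q" using qmax Pm by blast
    have "1 - y * x + y * x \<in> P" using y x c
      by (intro submodD(2)[OF Pm(1)] submodD(3)[OF Pm(1)]) auto
    then show False using Pm by simp
  qed
  have "c / a \<notin> R"
  proof
    assume "c / a \<in> R"
    then have "1 \<in> Q c" using a R(1) by (auto simp: Q_def intro!: bexI[of _ "c / a"])
    then show False using c Pm by blast
  qed
  moreover have "(c / a) * x \<in> R" if "x \<in> P" for x
  proof -
    have "x \<in> Q c" using that Pq by blast
    then obtain y where "y \<in> R" "x * c = y * a" by (auto simp: Q_def)
    then have "(c / a) * x = y" using a by (simp add: field_simps)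
    then show ?thesis using \<open>y \<in> R\<close> by simp
  qed
  ultimately show ?thesis using that by blast
qed

text \<open>For nonzero \<open>c \<in> I\<close> all \<open>u ^ n * c\<close> stay in
  \<open>R\<close>, a noetherian module. The resulting relation between these multiples, with
  \<open>c\<close> cancelled, shows that \<open>u\<close> is integral.\<close>

lemma ideal_mult_closed_imp_mem:
  assumes I: "submod R I" "I \<subseteq> R" "I \<noteq> {0}" and u: "\<And>x. x \<in> I \<Longrightarrow> u * x \<in> I"
  shows "u \<in> R"
proof -
  obtain c where c: "c \<in> I" "c \<noteq> 0" using I submodD(1)[OF I(1)] by blast
  have "u ^ n * c \<in> I" for n
    by (induction n) (use c u in \<open>auto simp: mult.assoc\<close>)
  then have "u ^ n * c \<in> R" for n using I by blast
  from noeth_power_relation[OF subring noeth submod_self[OF subring] this]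
  obtain n z where z: "\<And>i. z i \<in> R" "u ^ n * c = (\<Sum>i<n. z i * u ^ i) * c" by metis
  then have "u ^ n = (\<Sum>i<n. z i * u ^ i)" using c by simp
  then show ?thesis by (rule int_closed[OF z(1)])
qed

text \<open>A maximal counterexample \<open>J\<close> lies in a prime \<open>P\<close>. With
  \<open>u\<close> outside \<open>R\<close> and \<open>u P \<subseteq> R\<close>, the ideal
  \<open>J2 = J + u J\<close> is strictly larger, since otherwise \<open>u\<close> would be
  integral; so \<open>J2\<close> is invertible. A term \<open>v (x + u y)\<close> of its relation
  for 1 is also \<open>v x + (v u) y\<close>, and
  \<open>v u J \<subseteq> v J2 \<subseteq> R\<close>, so \<open>J\<close> would be invertible as
  well.\<close>

theorem integral_ideal_invertible:
  assumes "submod R I" "I \<subseteq> R" "I \<noteq> {0}"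
  shows "inv_ideal R I"
proof (rule ccontr)
  assume non: "\<not> inv_ideal R I"
  define F where "F = {J. submod R J \<and> J \<subseteq> R \<and> J \<noteq> {0} \<and> \<not> inv_ideal R J}"
  have "F \<noteq> {}" using assms non by (auto simp: F_def)
  moreover have "submod R N \<and> N \<subseteq> R" if "N \<in> F" for N using that by (auto simp: F_def)
  ultimately obtain J where J: "J \<in> F" "\<And>N'. N' \<in> F \<Longrightarrow> J \<subseteq> N' \<Longrightarrow> N' = J"
    by (rule noeth_max[OF subring noeth, of F]) blast+
  have J': "submod R J" "J \<subseteq> R" "J \<noteq> {0}" "\<not> inv_ideal R J" using J(1) by (auto simp: F_def)
  have "1 \<notin> J"
  proof
    assume "1 \<in> J"
    then have "inv_ideal R J" unfolding inv_ideal_def using J'(2)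
      by (intro exI[of _ "[(1, 1)]"]) auto
    then show False using J' by simp
  qed
  then obtain P where P: "prime_in R P" "J \<subseteq> P" using prime_above[OF subring noeth J'(1,2)] by blast
  have "P \<noteq> {0}" using P J' submodD(1)[OF J'(1)] by blast
  then obtain u where u: "u \<notin> R" "\<And>x. x \<in> P \<Longrightarrow> u * x \<in> R"
    using prime_inverse_element[OF P(1)] by blast
  define J2 where "J2 = {x + u * y |x y. x \<in> J \<and> y \<in> J}"
  have sub2: "J \<subseteq> J2" using submodD(1)[OF J'(1)] by (force simp: J2_def)
  have uJ: "u * x \<in> J2" if "x \<in> J" for x using that submodD(1)[OF J'(1)] by (force simp: J2_def)
  have "J2 \<noteq> J" using ideal_mult_closed_imp_mem[OF J'(1-3), of u] uJ u by blast
  have "submod R J2" unfolding submod_def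
  proof (intro conjI ballI)
    show "0 \<in> J2" using sub2 submodD(1)[OF J'(1)] by blast
  next
    fix a b assume "a \<in> J2" "b \<in> J2"
    then obtain x y x' y' where "x \<in> J" "y \<in> J" "a = x + u * y" "x' \<in> J" "y' \<in> J" "b = x' + u * y'"
      by (auto simp: J2_def)
    moreover from this have "a + b = (x + x') + u * (y + y')" by (simp add: algebra_simps)
    ultimately show "a + b \<in> J2" using submodD(2)[OF J'(1)] unfolding J2_def by blast
  next
    fix r a assume "r \<in> R" "a \<in> J2"
    then obtain x y where "x \<in> J" "y \<in> J" "a = x + u * y" by (auto simp: J2_def)
    moreover from this have "r * a = r * x + u * (r * y)" by (simp add: algebra_simps)
    ultimately show "r * a \<in> J2" using submodD(3)[OF J'(1)] \<open>r \<in> R\<close> unfolding J2_def by blast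
  qed
  moreover have "J2 \<subseteq> R" using J'(2) P(2) u(2) by (auto simp: J2_def intro!: R(6))
  ultimately have "inv_ideal R J2"
    using J(2)[of J2] \<open>J2 \<noteq> J\<close> sub2 J'(3) submodD(1)[OF J'(1)] by (auto simp: F_def)
  then obtain ps where ps: "\<forall>(v, l)\<in>set ps. l \<in> J2 \<and> (\<forall>x\<in>J2. v * x \<in> R)" "(\<Sum>(v, l)\<leftarrow>ps. v * l) = 1"
    by (auto simp: inv_ideal_def)
  have "\<exists>qs. (\<forall>(v, l)\<in>set qs. l \<in> J \<and> (\<forall>x\<in>J. v * x \<in> R)) \<and> (\<Sum>(v, l)\<leftarrow>qs. v * l) = (\<Sum>(v, l)\<leftarrow>ps. v * l)"
    using ps(1)
  proof (induction ps)
    case Nil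
    then show ?case by (auto intro!: exI[of _ "[]"])
  next
    case (Cons vl ps)
    obtain v l where vl: "vl = (v, l)" by force
    then have v: "l \<in> J2" "\<And>x. x \<in> J2 \<Longrightarrow> v * x \<in> R" using Cons.prems by auto
    obtain x y where xy: "x \<in> J" "y \<in> J" "l = x + u * y" using v(1) by (auto simp: J2_def)
    obtain qs where qs: "\<forall>(v, l)\<in>set qs. l \<in> J \<and> (\<forall>x\<in>J. v * x \<in> R)"
      "(\<Sum>(v, l)\<leftarrow>qs. v * l) = (\<Sum>(v, l)\<leftarrow>ps. v * l)"
      using Cons.IH Cons.prems by auto
    have "\<forall>z\<in>J. v * z \<in> R \<and> v * u * z \<in> R" using v(2) sub2 uJ by (auto simp: mult.assoc)
    then show ?case using qs xy
      by (intro exI[of _ "(v, x) # (v * u, y) # qs"]) (auto simp: vl algebra_simps)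
  qed
  then show False using J'(4) ps(2) by (auto simp: inv_ideal_def)
qed

corollary fractional_ideal_invertible:
  assumes I: "submod R I" "I \<noteq> {0}" and d: "d \<noteq> 0" "\<And>x. x \<in> I \<Longrightarrow> d * x \<in> R"
  shows "inv_ideal R I"
proof -
  have "submod R ((*) d ` I)" unfolding submod_def
  proof (intro conjI ballI)
    show "0 \<in> (*) d ` I" using submodD(1)[OF I(1)] by force
  next
    fix a b assume "a \<in> (*) d ` I" "b \<in> (*) d ` I"
    then show "a + b \<in> (*) d ` I" using submodD(2)[OF I(1)] by (force simp flip: distrib_left)
  next
    fix r a assume "r \<in> R" "a \<in> (*) d ` I"
    then show "r * a \<in> (*) d ` I" using submodD(3)[OF I(1)] by (force simp: mult.left_commute)
  qed
  moreover obtain c where c: "c \<in> I" "c \<noteq> 0" using I submodD(1)[OF I(1)] by blast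
  have "d * c \<in> (*) d ` I" "d * c \<noteq> 0" using c d(1) by auto
  then have "(*) d ` I \<noteq> {0}" by blast
  moreover have "(*) d ` I \<subseteq> R" using d(2) by blast
  ultimately have "inv_ideal R ((*) d ` I)" by (intro integral_ideal_invertible)
  then obtain ps where ps: "\<forall>(v, l)\<in>set ps. l \<in> (*) d ` I \<and> (\<forall>x\<in>(*) d ` I. v * x \<in> R)"
    "(\<Sum>(v, l)\<leftarrow>ps. v * l) = 1" by (auto simp: inv_ideal_def)
  define qs where "qs = map (\<lambda>(v, l). (v * d, l / d)) ps"
  have "(\<Sum>(v, l)\<leftarrow>qs. v * l) = (\<Sum>(v, l)\<leftarrow>ps. v * l)"
    unfolding qs_def split_def using d(1) by (simp add: comp_def)
  moreover have "\<forall>(v, l)\<in>set qs. l \<in> I \<and> (\<forall>x\<in>I. v * x \<in> R)"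
  proof (clarsimp simp: qs_def)
    fix v l assume "(v, l) \<in> set ps"
    with ps(1) have "l \<in> (*) d ` I" "\<forall>x\<in>I. v * (d * x) \<in> R" by auto
    then show "l / d \<in> I \<and> (\<forall>x\<in>I. v * d * x \<in> R)" using d(1) by (auto simp: mult.assoc)
  qed
  ultimately show ?thesis using ps(2) unfolding inv_ideal_def by (intro exI[of _ qs] conjI) simp_all
qed

end

section \<open>Linear functionals and algebra homomorphisms\<close>

locale q_algebra = hom: comm_ring_hom \<phi> for \<phi> :: "'q::field \<Rightarrow> 'k::comm_ring_1"
begin

sublocale vs: vector_space "scale_by \<phi>"
  by unfold_locales (simp_all add: scale_by_def algebra_simps hom.hom_add hom.hom_mult)

definition qlin :: "('k \<Rightarrow> 'q alg_closure) \<Rightarrow> bool" where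
  "qlin \<psi> \<longleftrightarrow> (\<forall>x y. \<psi> (x + y) = \<psi> x + \<psi> y) \<and> (\<forall>q x. \<psi> (\<phi> q * x) = to_ac q * \<psi> x)"

definition alghom :: "('k \<Rightarrow> 'q alg_closure) \<Rightarrow> bool" where
  "alghom \<sigma> \<longleftrightarrow> qlin \<sigma> \<and> (\<forall>x y. \<sigma> (x * y) = \<sigma> x * \<sigma> y) \<and> \<sigma> 1 = 1"

lemma qlinD: "qlin \<psi> \<Longrightarrow> \<psi> (x + y) = \<psi> x + \<psi> y" "qlin \<psi> \<Longrightarrow> \<psi> (\<phi> q * x) = to_ac q * \<psi> x"
  by (auto simp: qlin_def)

lemma qlin_0: "qlin \<psi> \<Longrightarrow> \<psi> 0 = 0"
  using qlinD(2)[of \<psi> 0 0] by simp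

lemma qlin_sum: "qlin \<psi> \<Longrightarrow> \<psi> (sum f A) = (\<Sum>i\<in>A. \<psi> (f i))"
  by (induction A rule: infinite_finite_induct) (simp_all add: qlin_0 qlinD)

text \<open>\<open>kill b cs \<psi>\<close> says that the product of the operators \<open>b - c\<close>, \<open>c \<in> set cs\<close>, annihilates \<open>\<psi>\<close>,
  where \<open>b\<close> acts by \<open>(b \<psi>)(y) = \<psi> (b y)\<close>.\<close>

fun kill :: "'k \<Rightarrow> 'q alg_closure list \<Rightarrow> ('k \<Rightarrow> 'q alg_closure) \<Rightarrow> bool" where
  "kill b [] \<psi> \<longleftrightarrow> (\<forall>y. \<psi> y = 0)"
| "kill b (c # cs) \<psi> \<longleftrightarrow> kill b cs (\<lambda>y. \<psi> (b * y) - c * \<psi> y)"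

text \<open>Apply the induction hypothesis to \<open>(b - c) \<psi>\<close>, a sum of eigenvectors
  for eigenvalues \<open>d \<noteq> c\<close>. Dividing each by \<open>d - c\<close> and subtracting
  the sum from \<open>\<psi>\<close> leaves an eigenvector for \<open>c\<close>. The invariant space
  \<open>U\<close> is carried along so that properties already achieved for other elements
  survive.\<close>

lemma kill_eigen_decomposition:
  assumes "distinct cs" "kill b cs \<psi>" "\<psi> \<in> U"
    and U: "\<And>f g. f \<in> U \<Longrightarrow> g \<in> U \<Longrightarrow> (\<lambda>y. f y + g y) \<in> U"
      "\<And>f c. f \<in> U \<Longrightarrow> (\<lambda>y. c * f y) \<in> U" "\<And>f. f \<in> U \<Longrightarrow> (\<lambda>y. f (b * y)) \<in> U"
  shows "\<exists>ps. (\<forall>(f, c)\<in>set ps. f \<in> U \<and> c \<in> set cs \<and> (\<forall>y. f (b * y) = c * f y)) \<and>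
              (\<forall>y. \<psi> y = (\<Sum>(f, c)\<leftarrow>ps. f y))"
  using assms(1-3)
proof (induction cs arbitrary: \<psi>)
  case Nil
  then show ?case by (intro exI[of _ "[]"]) auto
next
  case (Cons c cs)
  define \<chi> where "\<chi> y = \<psi> (b * y) - c * \<psi> y" for y
  have "\<chi> \<in> U" using U(1)[OF U(3) U(2)[of \<psi> "-c"], of \<psi>] Cons.prems(3) by (simp add: \<chi>_def[abs_def])
  moreover have "kill b cs \<chi>" using Cons.prems by (simp add: \<chi>_def[abs_def])
  ultimately obtain ps where ps: "\<And>f d. (f, d) \<in> set ps \<Longrightarrow> f \<in> U \<and> d \<in> set cs \<and> (\<forall>y. f (b * y) = d * f y)"
    "\<And>y. \<chi> y = (\<Sum>(f, d)\<leftarrow>ps. f y)" using Cons.IH[of \<chi>] Cons.prems(1) by fastforce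
  define qs where "qs = map (\<lambda>(f, d). (\<lambda>y. (1 / (d - c)) * f y, d)) ps"
  have qs: "f \<in> U \<and> d \<in> set cs \<and> (\<forall>y. f (b * y) = d * f y)" if "(f, d) \<in> set qs" for f d
    using that ps(1) U(2)[of _ "1 / (d - c)"] by (auto simp: qs_def)
  have chi: "\<chi> y = (\<Sum>(f, d)\<leftarrow>qs. (d - c) * f y)" for y
  proof -
    have "d \<noteq> c" if "(f, d) \<in> set ps" for f d using ps(1)[OF that] Cons.prems(1) by auto
    then have "map (\<lambda>(f, d). f y) ps = map (\<lambda>(f, d). (d - c) * f y) qs"
      unfolding qs_def by auto
    then show ?thesis using ps(2)[of y] by simp
  qed
  define \<eta> where "\<eta> y = \<psi> y - (\<Sum>(f, d)\<leftarrow>qs. f y)" for y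
  have sumU: "(\<lambda>y. - (\<Sum>(f, d)\<leftarrow>rs. f y)) \<in> U" if "\<forall>(f, d)\<in>set rs. f \<in> U" for rs :: "(_ \<times> 'q alg_closure) list"
    using that
  proof (induction rs)
    case Nil
    then show ?case using U(2)[OF Cons.prems(3), of 0] by simp
  next
    case (Cons fd rs)
    obtain f d where fd: "fd = (f, d)" by force
    show ?case using U(1)[OF U(2)[of f "-1"] Cons.IH] Cons.prems by (simp add: fd)
  qed
  have "\<eta> \<in> U" using U(1)[OF Cons.prems(3) sumU[of qs]] qs by (auto simp: \<eta>_def[abs_def])
  moreover have "\<eta> (b * y) = c * \<eta> y" for y
  proof -
    have "(\<Sum>(f, d)\<leftarrow>qs. f (b * y)) = (\<Sum>(f, d)\<leftarrow>qs. d * f y)"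
      using qs by (intro arg_cong[where f = sum_list] map_cong) auto
    moreover have "(\<Sum>(f, d)\<leftarrow>qs. (d - c) * f y) = (\<Sum>(f, d)\<leftarrow>qs. d * f y) - c * (\<Sum>(f, d)\<leftarrow>qs. f y)"
      by (induction qs) (auto simp: algebra_simps)
    ultimately show ?thesis using chi[of y] by (simp add: \<eta>_def \<chi>_def algebra_simps)
  qed
  moreover have "\<psi> y = (\<Sum>(f, d)\<leftarrow>(\<eta>, c) # qs. f y)" for y by (simp add: \<eta>_def)
  ultimately show ?case using qs by (intro exI[of _ "(\<eta>, c) # qs"]) auto
qed

text \<open>For \<open>p\<close> over Q this is \<open>y \<mapsto> \<psi> (p(b) y)\<close>. The
  formula extends it to polynomials over the algebraic closure, which act on functionals although
  they cannot be evaluated in \<open>K\<close>; there \<open>p\<close> splits into linear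
  factors.\<close>

definition pact :: "'k \<Rightarrow> 'q alg_closure poly \<Rightarrow> ('k \<Rightarrow> 'q alg_closure) \<Rightarrow> 'k \<Rightarrow> 'q alg_closure" where
  "pact b p \<psi> y = (\<Sum>i\<le>degree p. coeff p i * \<psi> (b ^ i * y))"

lemma pact_bound: "degree p \<le> n \<Longrightarrow> pact b p \<psi> y = (\<Sum>i\<le>n. coeff p i * \<psi> (b ^ i * y))"
  unfolding pact_def by (intro sum.mono_neutral_left) (auto simp: coeff_eq_0)

lemma pact_linear_factor:
  "pact b ([:- c, 1:] * p) \<psi> y = pact b p (\<lambda>y. \<psi> (b * y) - c * \<psi> y) y"
proof -
  define n where "n = degree p"
  have e: "[:- c, 1:] * p = pCons 0 p - smult c p" by simp
  have d: "degree ([:- c, 1:] * p) \<le> Suc n" unfolding n_def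
    by (rule order_trans[OF degree_mult_le]) simp
  have "pact b ([:- c, 1:] * p) \<psi> y = (\<Sum>i\<le>Suc n. coeff (pCons 0 p) i * \<psi> (b ^ i * y))
      - (\<Sum>i\<le>Suc n. c * coeff p i * \<psi> (b ^ i * y))"
    by (subst pact_bound[OF d], unfold e) (simp add: left_diff_distrib sum_subtractf del: sum.atMost_Suc)
  also have "(\<Sum>i\<le>Suc n. coeff (pCons 0 p) i * \<psi> (b ^ i * y)) = (\<Sum>i\<le>n. coeff p i * \<psi> (b * (b ^ i * y)))"
    by (simp only: sum.atMost_Suc_shift coeff_pCons_0 coeff_pCons_Suc power_Suc mult.assoc) simp
  also have "(\<Sum>i\<le>Suc n. c * coeff p i * \<psi> (b ^ i * y)) = (\<Sum>i\<le>n. c * coeff p i * \<psi> (b ^ i * y))"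
    by (simp add: n_def coeff_eq_0)
  finally show ?thesis unfolding pact_def n_def
    by (simp add: right_diff_distrib sum_subtractf mult.left_commute mult.assoc)
qed

lemma pact_prod_imp_kill:
  assumes "\<And>y. pact b (\<Prod>c\<leftarrow>cs. [:- c, 1:]) \<psi> y = 0" shows "kill b cs \<psi>"
  using assms
proof (induction cs arbitrary: \<psi>)
  case Nil
  then show ?case by (simp add: pact_def)
next
  case (Cons c cs)
  then show ?case by (simp add: pact_linear_factor del: mult_pCons_left)
qed

lemma pact_map_poly:
  assumes "qlin \<psi>"
  shows "pact b (map_poly to_ac f) \<psi> y = \<psi> (poly (map_poly \<phi> f) b * y)"
proof -
  have "pact b (map_poly to_ac f) \<psi> y = (\<Sum>i\<le>degree f. to_ac (coeff f i) * \<psi> (b ^ i * y))"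
    using pact_bound[of "map_poly to_ac f" "degree f" b \<psi> y]
    by (simp add: map_poly_degree_leq coeff_map_poly)
  also have "\<dots> = \<psi> (\<Sum>i\<le>degree f. \<phi> (coeff f i) * (b ^ i * y))"
    using assms by (simp add: qlin_sum qlinD)
  also have "(\<Sum>i\<le>degree f. \<phi> (coeff f i) * (b ^ i * y)) = poly (map_poly \<phi> f) b * y"
  proof -
    have "poly (map_poly \<phi> f) b = (\<Sum>i\<le>degree f. coeff (map_poly \<phi> f) i * b ^ i)"
      unfolding poly_altdef by (intro sum.mono_neutral_left) (auto simp: coeff_eq_0 map_poly_degree_leq)
    then show ?thesis by (simp add: coeff_map_poly sum_distrib_right mult.assoc)
  qed
  finally show ?thesis .
qed

definition separable_elt :: "'k \<Rightarrow> bool" where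
  "separable_elt b \<longleftrightarrow> (\<exists>f. rsquarefree (map_poly to_ac f) \<and> poly (map_poly \<phi> f) b = 0)"

text \<open>Over the algebraic closure the squarefree annihilating polynomial is a product of
  distinct linear factors; \<open>cs\<close> lists its roots. Multiplication by \<open>b\<close>
  thus acts diagonalizably on functionals.\<close>

lemma separable_elt_kill:
  assumes "separable_elt b"
  obtains cs where "distinct cs" "\<And>\<psi>. qlin \<psi> \<Longrightarrow> kill b cs \<psi>"
proof -
  obtain f where f: "rsquarefree (map_poly to_ac f)" "poly (map_poly \<phi> f) b = 0"
    using assms by (auto simp: separable_elt_def)
  define F where "F = map_poly to_ac f"
  have F0: "F \<noteq> 0" using f(1) by (auto simp: F_def rsquarefree_def)
  obtain A where A: "F = smult (lead_coeff F) (\<Prod>x\<in>#A. [:- x, 1:])"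
    using alg_closed_imp_factorization[OF F0] by blast
  obtain cs where cs: "mset cs = A" using ex_mset by blast
  have Fcs: "F = smult (lead_coeff F) (\<Prod>x\<leftarrow>cs. [:- x, 1:])"
    using A by (simp flip: cs prod_mset_prod_list mset_map)
  have "distinct cs"
  proof (rule ccontr)
    assume "\<not> distinct cs"
    then obtain xs ys zs c where "cs = xs @ [c] @ ys @ [c] @ zs" using not_distinct_decomp by blast
    then have "[:- c, 1:] ^ 2 dvd (\<Prod>x\<leftarrow>cs. [:- x, 1:])"
      by (simp add: power2_eq_square del: mult_pCons_left mult_pCons_right)
    then have "[:- c, 1:] ^ 2 dvd F" using Fcs dvd_smult by metis
    then have "2 \<le> order c F" using F0 order_divides by blast
    then show False using f(1) by (auto simp: F_def rsquarefree_def dest: spec[of _ c])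
  qed
  moreover have "kill b cs \<psi>" if "qlin \<psi>" for \<psi>
  proof (rule pact_prod_imp_kill)
    fix y
    have lin: "pact b (smult a p) \<psi> y = a * pact b p \<psi> y" for a p
      using pact_bound[of "smult a p" "degree p" b \<psi> y]
      by (simp add: pact_def sum_distrib_left mult.assoc degree_smult_le)
    have "pact b F \<psi> y = 0" using pact_map_poly[OF that, of b f y] f(2) qlin_0[OF that] by (simp add: F_def)
    moreover have "pact b F \<psi> y = lead_coeff F * pact b (\<Prod>x\<leftarrow>cs. [:- x, 1:]) \<psi> y"
      by (subst Fcs) (rule lin)
    ultimately show "pact b (\<Prod>x\<leftarrow>cs. [:- x, 1:]) \<psi> y = 0" using F0 by simp
  qed
  ultimately show ?thesis using that by blast
qed

text \<open>Multiplications commute, so the functionals with prescribed eigenvalues for the elements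
  already treated form a space stable under the next one, which can be decomposed further within
  that space.\<close>

lemma simultaneous_eigen_decomposition:
  assumes "\<forall>g\<in>set gs. separable_elt g" "qlin \<psi>"
  shows "\<exists>fs. (\<forall>f\<in>set fs. qlin f \<and> (\<forall>g\<in>set gs. \<exists>c. \<forall>y. f (g * y) = c * f y)) \<and>
              (\<forall>y. \<psi> y = (\<Sum>f\<leftarrow>fs. f y))"
  using assms(1)
proof (induction gs)
  case Nil
  then show ?case using assms(2) by (intro exI[of _ "[\<psi>]"]) auto
next
  case (Cons g gs)
  then obtain fs where fs: "\<forall>f\<in>set fs. qlin f \<and> (\<forall>g\<in>set gs. \<exists>c. \<forall>y. f (g * y) = c * f y)"
    "\<forall>y. \<psi> y = (\<Sum>f\<leftarrow>fs. f y)" by auto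
  obtain cs where cs: "distinct cs" "\<And>\<psi>. qlin \<psi> \<Longrightarrow> kill g cs \<psi>"
    using separable_elt_kill[of g] Cons.prems by auto
  let ?P = "\<lambda>h. qlin h \<and> (\<forall>g\<in>set (g # gs). \<exists>c. \<forall>y. h (g * y) = c * h y)"
  have one: "\<exists>hs. (\<forall>h\<in>set hs. ?P h) \<and> (\<forall>y. f y = (\<Sum>h\<leftarrow>hs. h y))" if f: "f \<in> set fs" for f
  proof -
    have "\<forall>g\<in>set gs. \<exists>c. \<forall>y. f (g * y) = c * f y" using fs f by auto
    then obtain \<kappa> where \<kappa>: "\<And>g y. g \<in> set gs \<Longrightarrow> f (g * y) = \<kappa> g * f y" by metis
    define U where "U = {h. qlin h \<and> (\<forall>g\<in>set gs. \<forall>y. h (g * y) = \<kappa> g * h y)}"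
    have "\<exists>ps. (\<forall>(h, c)\<in>set ps. h \<in> U \<and> c \<in> set cs \<and> (\<forall>y. h (g * y) = c * h y)) \<and>
              (\<forall>y. f y = (\<Sum>(h, c)\<leftarrow>ps. h y))"
    proof (rule kill_eigen_decomposition[OF cs(1)])
      show "kill g cs f" using cs(2) fs f by blast
      show "f \<in> U" using fs f \<kappa> by (auto simp: U_def)
      show "(\<lambda>y. a y + b y) \<in> U" if "a \<in> U" "b \<in> U" for a b
        using that by (auto simp: U_def qlin_def algebra_simps)
      show "(\<lambda>y. c * a y) \<in> U" if "a \<in> U" for a c
        using that by (auto simp: U_def qlin_def algebra_simps)
      show "(\<lambda>y. a (g * y)) \<in> U" if "a \<in> U" for a
        using that by (auto simp: U_def qlin_def distrib_left mult.left_commute[of g])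
    qed
    then obtain ps where ps: "\<forall>(h, c)\<in>set ps. h \<in> U \<and> c \<in> set cs \<and> (\<forall>y. h (g * y) = c * h y)"
       "\<forall>y. f y = (\<Sum>(h, c)\<leftarrow>ps. h y)" by blast
    then show ?thesis
      by (intro exI[of _ "map fst ps"]) (auto simp: U_def comp_def split_def)
  qed
  have "\<exists>hs. (\<forall>h\<in>set hs. ?P h) \<and> (\<forall>y. (\<Sum>f\<leftarrow>es. f y) = (\<Sum>h\<leftarrow>hs. h y))" if "set es \<subseteq> set fs" for es
    using that
  proof (induction es)
    case Nil
    then show ?case by (intro exI[of _ "[]"]) auto
  next
    case (Cons f es)
    then obtain hs1 hs2 where "(\<forall>h\<in>set hs1. ?P h) \<and> (\<forall>y. (\<Sum>f\<leftarrow>es. f y) = (\<Sum>h\<leftarrow>hs1. h y))"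
      "(\<forall>h\<in>set hs2. ?P h) \<and> (\<forall>y. f y = (\<Sum>h\<leftarrow>hs2. h y))" using one[of f] by auto
    then show ?case by (intro exI[of _ "hs2 @ hs1"]) auto
  qed
  from this[of fs] show ?case using fs(2) by auto
qed

section \<open>Functionals as combinations of algebra homomorphisms\<close>

definition hom_comb :: "('k \<Rightarrow> 'q alg_closure) \<Rightarrow> bool" where
  "hom_comb \<psi> \<longleftrightarrow> (\<exists>\<Lambda> a. finite \<Lambda> \<and> (\<forall>\<sigma>\<in>\<Lambda>. alghom \<sigma>) \<and> (\<forall>x. \<psi> x = (\<Sum>\<sigma>\<in>\<Lambda>. a \<sigma> * \<sigma> x)))"

lemma sum_extend_zero:
  fixes a :: "_ \<Rightarrow> 'b::semiring_0"
  assumes "finite B" "A \<subseteq> B"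
  shows "(\<Sum>l\<in>A. a l * f l) = (\<Sum>l\<in>B. (if l \<in> A then a l else 0) * f l)"
  using assms by (intro sum.mono_neutral_cong_left) auto

lemma hom_comb_add:
  assumes "hom_comb f" "hom_comb g" shows "hom_comb (\<lambda>y. f y + g y)"
proof -
  obtain A a where A: "finite A" "\<forall>\<sigma>\<in>A. alghom \<sigma>" "\<And>x. f x = (\<Sum>\<sigma>\<in>A. a \<sigma> * \<sigma> x)"
    using assms(1) by (auto simp: hom_comb_def)
  obtain B b where B: "finite B" "\<forall>\<sigma>\<in>B. alghom \<sigma>" "\<And>x. g x = (\<Sum>\<sigma>\<in>B. b \<sigma> * \<sigma> x)"
    using assms(2) by (auto simp: hom_comb_def)
  have fin: "finite (A \<union> B)" using A B by simp
  have "f x + g x = (\<Sum>\<sigma>\<in>A \<union> B. ((if \<sigma> \<in> A then a \<sigma> else 0) + (if \<sigma> \<in> B then b \<sigma> else 0)) * \<sigma> x)" for x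
    unfolding A(3) B(3) sum_extend_zero[OF fin Un_upper1, where f = "\<lambda>l. l x"]
      sum_extend_zero[OF fin Un_upper2, where f = "\<lambda>l. l x"]
    by (simp add: distrib_right sum.distrib)
  then show ?thesis unfolding hom_comb_def using fin A B
    by (intro exI[of _ "A \<union> B"] exI conjI allI) auto
qed

text \<open>A common eigenvector \<open>f\<close> of a spanning set satisfies
  \<open>f (x * y) = c x * f y\<close> for all \<open>x\<close>. Taking \<open>y = 1\<close> gives
  \<open>f x = c x * f 1\<close>: either \<open>f = 0\<close>, or \<open>f\<close> divided by
  \<open>f 1\<close> is multiplicative.\<close>

theorem qlin_hom_comb:
  assumes gs: "\<forall>g\<in>set gs. separable_elt g" and span: "\<And>x. \<exists>q. x = (\<Sum>g\<in>set gs. \<phi> (q g) * g)"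
    and \<psi>: "qlin \<psi>"
  shows "hom_comb \<psi>"
proof -
  obtain fs where fs: "\<forall>f\<in>set fs. qlin f \<and> (\<forall>g\<in>set gs. \<exists>c. \<forall>y. f (g * y) = c * f y)"
    "\<And>y. \<psi> y = (\<Sum>f\<leftarrow>fs. f y)"
    using simultaneous_eigen_decomposition[OF gs \<psi>] by blast
  have zero: "hom_comb (\<lambda>_. 0)" unfolding hom_comb_def by (intro exI[of _ "{}"]) simp
  have one: "hom_comb f" if "f \<in> set fs" for f
  proof -
    have f: "qlin f" using fs(1) that by blast
    have "\<forall>g\<in>set gs. \<exists>c. \<forall>y. f (g * y) = c * f y" using fs(1) that by blast
    then obtain \<kappa> where \<kappa>: "\<And>g y. g \<in> set gs \<Longrightarrow> f (g * y) = \<kappa> g * f y" by metis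
    have "\<exists>c. \<forall>y. f (x * y) = c * f y" for x
    proof -
      obtain q where q: "x = (\<Sum>g\<in>set gs. \<phi> (q g) * g)" using span by blast
      have "f (x * y) = (\<Sum>g\<in>set gs. to_ac (q g) * \<kappa> g) * f y" for y
        by (simp add: q sum_distrib_right qlin_sum[OF f] mult.assoc qlinD(2)[OF f] \<kappa>)
      then show ?thesis by blast
    qed
    then obtain c where c: "\<And>x y. f (x * y) = c x * f y" by metis
    show ?thesis
    proof (cases "f 1 = 0")
      case True
      then have "f = (\<lambda>_. 0)" using c[of _ 1] by auto
      then show ?thesis using zero by simp
    next
      case False
      define l where "l x = f x / f 1" for x
      have l: "l x = c x" for x using c[of x 1] False by (simp add: l_def)
      have "l (x * y) = l x * l y" for x y unfolding l using c[of "x * y" 1] c[of x y] c[of y 1] False by simp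
      then have "alghom l" using f False by (auto simp: alghom_def qlin_def l_def add_divide_distrib)
      then show ?thesis unfolding hom_comb_def using False
        by (intro exI[of _ "{l}"] exI[of _ "\<lambda>_. f 1"]) (auto simp: l_def)
    qed
  qed
  have "hom_comb (\<lambda>y. \<Sum>f\<leftarrow>es. f y)" if "set es \<subseteq> set fs" for es
    using that
  proof (induction es)
    case (Cons f es)
    then show ?case using hom_comb_add[OF one[of f]] by simp
  qed (simp add: zero)
  moreover have "\<psi> = (\<lambda>y. \<Sum>f\<leftarrow>fs. f y)" using fs(2) by blast
  ultimately show ?thesis by simp
qed

text \<open>Dedekind's independence of characters: replace \<open>x\<close> by \<open>y * x\<close>
  in the relation and subtract \<open>l y\<close> times the original. This eliminates
  \<open>l\<close>, and each remaining coefficient \<open>a f\<close> acquires the factor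
  \<open>f y - l y\<close>, nonzero for some \<open>y\<close>.\<close>

lemma alghom_independent:
  assumes "finite \<Lambda>" "\<forall>\<sigma>\<in>\<Lambda>. alghom \<sigma>" "\<And>x. (\<Sum>\<sigma>\<in>\<Lambda>. a \<sigma> * \<sigma> x) = 0" "\<sigma> \<in> \<Lambda>"
  shows "a \<sigma> = 0"
  using assms
proof (induction \<Lambda> arbitrary: a \<sigma> rule: finite_induct)
  case (insert l L)
  have mult: "f (y * x) = f y * f x" if "f \<in> insert l L" for f x y using insert.prems(1) that by (auto simp: alghom_def)
  have tot: "a l * l x + (\<Sum>f\<in>L. a f * f x) = 0" for x using insert.prems(2)[of x] insert.hyps by simp
  have rest: "(\<Sum>f\<in>L. a f * f x) = - (a l * l x)" for x
    using tot[of x] by (metis add.commute eq_neg_iff_add_eq_0)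
  have z: "a f * (f y - l y) = 0" if "f \<in> L" for f y
  proof (rule insert.IH[OF _ _ that])
    fix x
    have "(\<Sum>f\<in>L. a f * (f y - l y) * f x) = (\<Sum>f\<in>L. a f * f (y * x)) - l y * (\<Sum>f\<in>L. a f * f x)"
      unfolding sum_distrib_left sum_subtractf[symmetric]
      by (intro sum.cong) (simp_all add: mult algebra_simps)
    also have "(\<Sum>f\<in>L. a f * f (y * x)) = - (a l * l (y * x))" by (rule rest)
    also have "(\<Sum>f\<in>L. a f * f x) = - (a l * l x)" by (rule rest)
    also have "- (a l * l (y * x)) - l y * - (a l * l x) = 0" by (simp add: mult mult.left_commute)
    finally show "(\<Sum>f\<in>L. a f * (f y - l y) * f x) = 0" .
  qed (use insert.prems in auto)
  have aL: "a f = 0" if "f \<in> L" for f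
  proof -
    have "f \<noteq> l" using that insert.hyps by auto
    then obtain y where "f y \<noteq> l y" by auto
    then show ?thesis using z[OF that, of y] by simp
  qed
  have "a l * l 1 = 0" using tot[of 1] aL by simp
  then have "a l = 0" using insert.prems(1) by (auto simp: alghom_def)
  then show ?case using insert.prems(3) aL by auto
qed simp

end

section \<open>The trace form\<close>

text \<open>The part of etaleness that the trace form depends on: a finite list of separable
  elements spanning \<open>K\<close> over Q.\<close>

locale split_algebra = q_algebra \<phi> for \<phi> :: "'q::field \<Rightarrow> 'k::comm_ring_1" +
  fixes gs :: "'k list"
  assumes sep: "\<forall>g\<in>set gs. separable_elt g" and span_gs: "vs.span (set gs) = UNIV"
begin

definition lin :: "('k \<Rightarrow> 'q) \<Rightarrow> bool" where
  "lin f \<longleftrightarrow> (\<forall>x y. f (x + y) = f x + f y) \<and> (\<forall>q x. f (\<phi> q * x) = q * f x)"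

lemma linD: "lin f \<Longrightarrow> f (x + y) = f x + f y" "lin f \<Longrightarrow> f (\<phi> q * x) = q * f x"
  by (auto simp: lin_def)

lemma lin_0: "lin f \<Longrightarrow> f 0 = 0"
  using linD(2)[of f 0 0] by simp

lemma lin_diff: "lin f \<Longrightarrow> f (x - y) = f x - f y"
  using linD(1)[of f "x - y" y] by simp

lemma lin_sum: "lin f \<Longrightarrow> f (sum g A) = (\<Sum>i\<in>A. f (g i))"
  by (induction A rule: infinite_finite_induct) (simp_all add: lin_0 linD)

lemma lin_sum_list: "lin f \<Longrightarrow> f (\<Sum>i\<leftarrow>xs. g i) = (\<Sum>i\<leftarrow>xs. f (g i))"
  by (induction xs) (simp_all add: lin_0 linD)

text \<open>The very basis selected inside \<open>algebra_trace\<close>, so the trace unfolds into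
  these coordinates and no independence of the basis has to be shown.\<close>

definition BK :: "'k set" where "BK = (SOME B. is_basis \<phi> B)"

lemma BK_basis: "is_basis \<phi> BK"
proof -
  obtain B where "vs.independent B" "UNIV \<subseteq> vs.span B"
    using vs.maximal_independent_subset[of UNIV] by blast
  then have "is_basis \<phi> B" by (auto simp: is_basis_def)
  then show ?thesis unfolding BK_def by (rule someI)
qed

lemma BK_indep: "vs.independent BK" and BK_span: "vs.span BK = UNIV"
  using BK_basis by (auto simp: is_basis_def)

lemma finite_BK: "finite BK"
  using vs.independent_span_bound[OF finite_set BK_indep, of gs] span_gs by simp

definition coord :: "'k \<Rightarrow> 'k \<Rightarrow> 'q" where
  "coord b x = vs.representation BK x b"

lemma coord_lin: "lin (coord b)"
  using vs.representation_add[OF BK_indep] vs.representation_scale[OF BK_indep]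
  by (simp add: lin_def coord_def BK_span scale_by_def)

lemma coord_expand: "x = (\<Sum>b\<in>BK. \<phi> (coord b x) * b)"
  using vs.sum_representation_eq[OF BK_indep, of x BK] finite_BK
  by (simp add: BK_span coord_def scale_by_def)

lemma coord_eq_0: "(\<And>b. b \<in> BK \<Longrightarrow> coord b x = 0) \<Longrightarrow> x = 0"
  by (subst coord_expand) simp

abbreviation Tr :: "'k \<Rightarrow> 'q" where "Tr \<equiv> algebra_trace \<phi>"

lemma Tr_def: "Tr x = (\<Sum>b\<in>BK. coord b (x * b))"
  by (simp add: algebra_trace_def BK_def coord_def Let_def)

lemma Tr_lin: "lin Tr"
  unfolding lin_def Tr_def
  by (auto simp: distrib_right linD[OF coord_lin] sum.distrib mult.assoc sum_distrib_left)

text \<open>Each coordinate functional is a combination of algebra homomorphisms; padding with zero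
  coefficients lets one finite set \<open>\<Lambda>\<close> serve all of them, as the comparison of
  coefficients in the trace computation requires.\<close>

lemma coord_hom_comb:
  "\<exists>\<Lambda> a. finite \<Lambda> \<and> (\<forall>\<sigma>\<in>\<Lambda>. alghom \<sigma>) \<and>
    (\<forall>b\<in>BK. \<forall>x. to_ac (coord b x) = (\<Sum>\<sigma>\<in>\<Lambda>. a b \<sigma> * \<sigma> x))"
proof -
  have sp: "\<exists>q. x = (\<Sum>g\<in>set gs. \<phi> (q g) * g)" for x
  proof -
    have "x \<in> vs.span (set gs)" using span_gs by simp
    then show ?thesis unfolding vs.span_finite[OF finite_set] by (auto simp: scale_by_def)
  qed
  have "hom_comb (\<lambda>x. to_ac (coord b x))" for b
    by (rule qlin_hom_comb[OF sep sp]) (simp add: qlin_def linD[OF coord_lin])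
  then have "\<forall>b. \<exists>\<Lambda> a. finite \<Lambda> \<and> (\<forall>\<sigma>\<in>\<Lambda>. alghom \<sigma>) \<and> (\<forall>x. to_ac (coord b x) = (\<Sum>\<sigma>\<in>\<Lambda>. a \<sigma> * \<sigma> x))"
    unfolding hom_comb_def by blast
  from choice[OF this] obtain L where
    "\<forall>b. \<exists>a. finite (L b) \<and> (\<forall>\<sigma>\<in>L b. alghom \<sigma>) \<and> (\<forall>x. to_ac (coord b x) = (\<Sum>\<sigma>\<in>L b. a \<sigma> * \<sigma> x))" by blast
  from choice[OF this] obtain a where L: "\<And>b. finite (L b) \<and> (\<forall>\<sigma>\<in>L b. alghom \<sigma>) \<and> (\<forall>x. to_ac (coord b x) = (\<Sum>\<sigma>\<in>L b. a b \<sigma> * \<sigma> x))"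
    by blast
  define \<Lambda> where "\<Lambda> = (\<Union>b\<in>BK. L b)"
  have fin: "finite \<Lambda>" using L finite_BK by (auto simp: \<Lambda>_def)
  have "to_ac (coord b x) = (\<Sum>\<sigma>\<in>\<Lambda>. (if \<sigma> \<in> L b then a b \<sigma> else 0) * \<sigma> x)" if "b \<in> BK" for b x
  proof -
    have "L b \<subseteq> \<Lambda>" using that by (auto simp: \<Lambda>_def)
    from sum_extend_zero[OF fin this, of "a b" "\<lambda>\<sigma>. \<sigma> x"] show ?thesis using L by simp
  qed
  note * = this
  have "\<forall>\<sigma>\<in>\<Lambda>. alghom \<sigma>" using L by (auto simp: \<Lambda>_def)
  with fin * show ?thesis
    by (intro exI[of _ \<Lambda>] exI[of _ "\<lambda>b \<sigma>. if \<sigma> \<in> L b then a b \<sigma> else 0"]) simp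
qed

text \<open>Over the algebraic closure, the trace is the sum of all algebra homomorphisms,
  so nondegeneracy follows from the independence of characters.\<close>

theorem trace_nondegenerate:
  assumes "\<And>y. Tr (x * y) = 0" shows "x = 0"
proof -
  obtain \<Lambda> a where L: "finite \<Lambda>" "\<forall>\<sigma>\<in>\<Lambda>. alghom \<sigma>"
    "\<forall>b\<in>BK. \<forall>x. to_ac (coord b x) = (\<Sum>\<sigma>\<in>\<Lambda>. a b \<sigma> * \<sigma> x)"
    using coord_hom_comb by (elim exE conjE)
  have hom: "qlin \<sigma>" "\<sigma> (x * y) = \<sigma> x * \<sigma> y" if "\<sigma> \<in> \<Lambda>" for \<sigma> x y
    using L(2) that by (auto simp: alghom_def)
  \<comment> \<open>Expanding \<open>y\<close> in coordinates writes \<open>\<sigma>\<close> as a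
    combination of all \<open>\<tau> \<in> \<Lambda>\<close>; by independence the coefficient of
    \<open>\<sigma>\<close> itself is 1.\<close>
  have dual: "(\<Sum>b\<in>BK. a b \<sigma> * \<sigma> b) = 1" if s: "\<sigma> \<in> \<Lambda>" for \<sigma>
  proof -
    have "(\<Sum>\<tau>\<in>\<Lambda>. ((\<Sum>b\<in>BK. a b \<tau> * \<sigma> b) - (if \<tau> = \<sigma> then 1 else 0)) * \<tau> y) = 0" for y
    proof -
      have "\<sigma> y = (\<Sum>b\<in>BK. to_ac (coord b y) * \<sigma> b)"
        by (subst coord_expand[of y]) (simp add: qlin_sum hom(1)[OF s] qlinD)
      also have "\<dots> = (\<Sum>b\<in>BK. \<Sum>\<tau>\<in>\<Lambda>. a b \<tau> * \<sigma> b * \<tau> y)"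
        by (intro sum.cong refl) (simp add: L(3) sum_distrib_left mult_ac)
      also have "\<dots> = (\<Sum>\<tau>\<in>\<Lambda>. (\<Sum>b\<in>BK. a b \<tau> * \<sigma> b) * \<tau> y)"
        by (subst sum.swap) (simp add: sum_distrib_right)
      finally show ?thesis using s L(1)
        by (simp add: left_diff_distrib sum_subtractf if_distrib[of "\<lambda>x. x * _"] cong: if_cong)
    qed
    from alghom_independent[OF L(1,2) this s] show ?thesis by simp
  qed
  have tr: "to_ac (Tr z) = (\<Sum>\<sigma>\<in>\<Lambda>. \<sigma> z)" for z
  proof -
    have "to_ac (Tr z) = (\<Sum>b\<in>BK. \<Sum>\<sigma>\<in>\<Lambda>. a b \<sigma> * \<sigma> (z * b))"
      unfolding Tr_def to_ac_sum by (intro sum.cong refl) (simp add: L(3))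
    also have "\<dots> = (\<Sum>\<sigma>\<in>\<Lambda>. \<Sum>b\<in>BK. \<sigma> z * (a b \<sigma> * \<sigma> b))"
      by (subst sum.swap) (intro sum.cong refl, simp add: hom mult_ac)
    also have "\<dots> = (\<Sum>\<sigma>\<in>\<Lambda>. \<sigma> z)"
      by (intro sum.cong refl) (simp add: dual flip: sum_distrib_left)
    finally show ?thesis .
  qed
  have "(\<Sum>\<sigma>\<in>\<Lambda>. \<sigma> x * \<sigma> y) = 0" for y
  proof -
    have "(\<Sum>\<sigma>\<in>\<Lambda>. \<sigma> x * \<sigma> y) = to_ac (Tr (x * y))" unfolding tr by (intro sum.cong refl) (simp add: hom)
    then show ?thesis using assms by simp
  qed
  from alghom_independent[OF L(1,2) this] have "\<sigma> x = 0" if "\<sigma> \<in> \<Lambda>" for \<sigma> using that by blast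
  then have "(\<Sum>\<sigma>\<in>\<Lambda>. a b \<sigma> * \<sigma> x) = 0" for b by (intro sum.neutral ballI) simp
  then have "to_ac (coord b x) = 0" if "b \<in> BK" for b using L(3) that by simp
  then show ?thesis using coord_eq_0 by simp
qed

text \<open>By nondegeneracy \<open>y \<mapsto> Tr (y * _)\<close> is injective, hence surjective
  onto the functionals by equality of dimensions.\<close>

theorem trace_representation:
  assumes f: "lin f"
  obtains y where "\<And>x. f x = Tr (y * x)"
proof -
  interpret fd: finite_dimensional_vector_space "scale_by \<phi>" BK
    by unfold_locales (use finite_BK BK_indep BK_span in auto)
  \<comment> \<open>The values \<open>Tr (y * b)\<close> are stored as coordinates of an element of
    \<open>K\<close>, so that the dimension count concerns an endomorphism of \<open>K\<close>
    instead of a map into the dual space.\<close>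
  define F where "F y = (\<Sum>b\<in>BK. \<phi> (Tr (y * b)) * b)" for y
  have coF: "coord b (\<Sum>b\<in>BK. \<phi> (c b) * b) = c b" if "b \<in> BK" for b c
  proof -
    have "coord b (\<Sum>b\<in>BK. \<phi> (c b) * b) = (\<Sum>b'\<in>BK. c b' * coord b b')"
      by (simp add: lin_sum[OF coord_lin] linD(2)[OF coord_lin])
    also have "\<dots> = (\<Sum>b'\<in>BK. if b' = b then c b' else 0)"
      using vs.representation_basis[OF BK_indep] by (intro sum.cong) (auto simp: coord_def)
    finally show ?thesis using that finite_BK by simp
  qed
  have "Vector_Spaces.linear (scale_by \<phi>) (scale_by \<phi>) F"
    by unfold_locales (simp_all add: F_def scale_by_def distrib_left distrib_right hom.hom_add hom.hom_mult
        linD[OF Tr_lin] sum.distrib mult.assoc sum_distrib_left)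
  moreover have "inj F"
  proof (rule injI)
    fix y z assume "F y = F z"
    then have "Tr (y * b) = Tr (z * b)" if "b \<in> BK" for b
      using coF[OF that, of "\<lambda>b. Tr (y * b)"] coF[OF that, of "\<lambda>b. Tr (z * b)"] by (simp add: F_def)
    then have b: "Tr ((y - z) * b) = 0" if "b \<in> BK" for b using that
      by (simp add: left_diff_distrib lin_diff[OF Tr_lin])
    have "Tr ((y - z) * v) = 0" for v
      by (subst coord_expand[of v])
        (simp add: sum_distrib_left lin_sum[OF Tr_lin] mult.left_commute[of "y - z"] linD[OF Tr_lin] b)
    then show "y = z" using trace_nondegenerate[of "y - z"] by simp
  qed
  ultimately have "surj F" by (rule fd.linear_inj_imp_surj)
  then obtain y where y: "F y = (\<Sum>b\<in>BK. \<phi> (f b) * b)" by (metis surjD)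
  have b: "f b = Tr (y * b)" if "b \<in> BK" for b
    using coF[OF that, of f] coF[OF that, of "\<lambda>b. Tr (y * b)"] y by (simp add: F_def)
  have "f x = Tr (y * x)" for x
  proof -
    have "f x = (\<Sum>b\<in>BK. coord b x * f b)"
      by (subst coord_expand[of x]) (simp add: lin_sum[OF f] linD[OF f])
    also have "\<dots> = (\<Sum>b\<in>BK. coord b x * Tr (y * b))" by (intro sum.cong refl) (simp add: b)
    also have "\<dots> = Tr (y * x)"
      by (subst (2) coord_expand[of x])
        (simp add: sum_distrib_left lin_sum[OF Tr_lin] mult.left_commute[of y] linD[OF Tr_lin])
    finally show ?thesis .
  qed
  then show ?thesis using that by blast
qed

text \<open>\<open>d b\<close> represents the coordinate functional of \<open>b\<close> through the
  trace, so both sides have the same trace products with every element. The expansion bounds the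
  denominators of the trace dual.\<close>

lemma trace_dual_basis:
  obtains d where "\<And>y. y = (\<Sum>b\<in>BK. \<phi> (Tr (y * b)) * d b)"
proof -
  have "\<forall>b. \<exists>y. \<forall>x. coord b x = Tr (y * x)"
  proof
    fix b show "\<exists>y. \<forall>x. coord b x = Tr (y * x)" using trace_representation[OF coord_lin[of b]] by metis
  qed
  then obtain d where d: "\<And>b x. coord b x = Tr (d b * x)" by metis
  have "y = (\<Sum>b\<in>BK. \<phi> (Tr (y * b)) * d b)" for y
  proof -
    have "Tr ((y - (\<Sum>b\<in>BK. \<phi> (Tr (y * b)) * d b)) * x) = 0" for x
    proof -
      have "Tr (y * x) = (\<Sum>b\<in>BK. coord b x * Tr (y * b))"
        by (subst coord_expand[of x])
          (simp add: sum_distrib_left lin_sum[OF Tr_lin] mult.left_commute[of y] linD[OF Tr_lin])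
      also have "\<dots> = Tr ((\<Sum>b\<in>BK. \<phi> (Tr (y * b)) * d b) * x)"
        unfolding sum_distrib_right lin_sum[OF Tr_lin] mult.assoc linD(2)[OF Tr_lin] d
        by (intro sum.cong refl) (rule mult.commute)
      finally show ?thesis by (simp add: left_diff_distrib lin_diff[OF Tr_lin])
    qed
    then show ?thesis using trace_nondegenerate by (metis eq_iff_diff_eq_0)
  qed
  then show ?thesis using that by blast
qed

end

section \<open>Separating a point from a lattice\<close>

locale lattice_algebra = split_algebra \<phi> gs + dedekind_subring R
  for \<phi> :: "'q::field \<Rightarrow> 'k::comm_ring_1" and gs and R :: "'q set" +
  assumes proper: "R \<noteq> UNIV"
begin

lemma separating_functional_aux:
  assumes "finite N" "N \<subseteq> BK" "submod (\<phi> ` R) L" "d \<noteq> 0" "\<And>v b. v \<in> L \<Longrightarrow> b \<in> BK \<Longrightarrow> d * coord b v \<in> R"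
    "\<And>v b. v \<in> insert x L \<Longrightarrow> b \<in> BK - N \<Longrightarrow> coord b v = 0" "x \<notin> L"
  shows "\<exists>f. lin f \<and> f ` L \<subseteq> R \<and> f x \<notin> R"
  using assms
proof (induction N arbitrary: L x rule: finite_induct)
  case empty
  then have "x = 0" by (intro coord_eq_0) auto
  then show ?case using empty submodD(1) by blast
next
  case (insert b N L x)
  note L = insert.prems(2) and bd = insert.prems(4) and van = insert.prems(5)
  have Lr: "\<phi> r * v \<in> L" if "r \<in> R" "v \<in> L" for r v using submodD(3)[OF L] that by blast
  define e where "e = coord b"
  have e: "lin e" by (simp add: e_def coord_lin)
  have sub: "submod R (e ` L)" unfolding submod_def
  proof (intro conjI ballI)
    show "0 \<in> e ` L" using submodD(1)[OF L] lin_0[OF e] by (intro image_eqI[of _ _ 0]) auto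
    show "p + q \<in> e ` L" if "p \<in> e ` L" "q \<in> e ` L" for p q
      using that submodD(2)[OF L] by (auto simp flip: linD(1)[OF e])
    show "r * p \<in> e ` L" if "r \<in> R" "p \<in> e ` L" for r p
      using that Lr by (auto simp flip: linD(2)[OF e])
  qed
  show ?case
  proof (cases "e ` L = {0}")
    case True
    show ?thesis
    proof (cases "e x = 0")
      case True
      then have "coord b' v = 0" if "v \<in> insert x L" "b' \<in> BK - N" for v b'
        using van[of v b'] that \<open>e ` L = {0}\<close> by (cases "b' = b") (auto simp: e_def)
      then show ?thesis using insert.IH[of L x] insert.prems by auto
    next
      case False
      \<comment> \<open>\<open>e\<close> vanishes on \<open>L\<close> but not at \<open>x\<close>,
        so a multiple of \<open>e\<close> can take any value at \<open>x\<close>;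
        \<open>R \<noteq> UNIV\<close> provides one outside \<open>R\<close>.\<close>
      obtain q where q: "q \<notin> R" using proper by blast
      define f where "f v = (q / e x) * e v" for v
      have "lin f" using e by (auto simp: lin_def f_def distrib_left)
      moreover have "f v \<in> R" if "v \<in> L" for v
      proof -
        have "e v = 0" using True that by blast
        then show ?thesis using R(2) by (simp add: f_def)
      qed
      moreover have "f x = q" using False by (simp add: f_def)
      ultimately show ?thesis using q by blast
    qed
  next
    case False
    have "d * y \<in> R" if "y \<in> e ` L" for y using that bd insert.prems(1) by (auto simp: e_def)
    with fractional_ideal_invertible[OF sub False insert.prems(3)]
    obtain ps where ps: "\<And>u l. (u, l) \<in> set ps \<Longrightarrow> l \<in> e ` L \<and> (\<forall>y\<in>e ` L. u * y \<in> R)"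
      "(\<Sum>(u, l)\<leftarrow>ps. u * l) = 1" unfolding inv_ideal_def by blast
    have sl: "(\<Sum>(u, l)\<leftarrow>qs. c * u * l) = c * (\<Sum>(u, l)\<leftarrow>qs. u * l)" for qs :: "('q \<times> 'q) list" and c
      by (induction qs) (auto simp: distrib_left mult.assoc)
    show ?thesis
    proof (cases "e x \<in> e ` L")
      case False
      have "\<exists>u l. (u, l) \<in> set ps \<and> u * e x \<notin> R"
      proof (rule ccontr)
        assume "\<not> ?thesis"
        then have *: "(e x * u) * l \<in> e ` L" if "(u, l) \<in> set ps" for u l
          using that ps(1)[OF that] submodD(3)[OF sub, of "e x * u" l] by (simp add: mult.commute) blast
        have "(\<Sum>(u, l)\<leftarrow>qs. e x * u * l) \<in> e ` L" if "set qs \<subseteq> set ps" for qs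
          using that by (induction qs) (auto simp: submodD(1)[OF sub] * intro!: submodD(2)[OF sub])
        from this[of ps] False show False unfolding sl ps(2) by simp
      qed
      then obtain u l where u: "(u, l) \<in> set ps" "u * e x \<notin> R" by blast
      have "lin (\<lambda>v. u * e v)" using e by (auto simp: lin_def distrib_left)
      then show ?thesis using u ps(1)[OF u(1)] by (intro exI[of _ "\<lambda>v. u * e v"]) auto
    next
      case True
      have "\<forall>l\<in>e ` L. \<exists>v. v \<in> L \<and> e v = l" by auto
      then obtain g where g: "\<And>l. l \<in> e ` L \<Longrightarrow> g l \<in> L \<and> e (g l) = l" by metis
      \<comment> \<open>With \<open>g l \<in> L\<close> a preimage of \<open>l\<close> under
        \<open>e\<close>, the relation for 1 gives \<open>e (w v) = e v\<close>: \<open>w\<close> is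
        the section of \<open>e\<close> composed with \<open>e\<close>, and \<open>r\<close> is the
        complementary projection.\<close>
      define w where "w v = (\<Sum>(u, l)\<leftarrow>ps. \<phi> (e v * u) * g l)" for v
      define r where "r v = v - w v" for v
      have wsum: "f (w v) = (\<Sum>(u, l)\<leftarrow>ps. e v * u * f (g l))" if "lin f" for f v
        unfolding w_def lin_sum_list[OF that] by (simp add: linD(2)[OF that] split_def)
      have w_add: "w (v + v') = w v + w v'" for v v'
        unfolding w_def by (simp add: linD(1)[OF e] hom.hom_add distrib_right split_def sum_list_addf)
      have w_scale: "w (\<phi> q * v) = \<phi> q * w v" for q v
        unfolding w_def by (simp add: linD(2)[OF e] hom.hom_mult split_def sum_list_const_mult mult.assoc)
      have r_add: "r (v + v') = r v + r v'" and r_scale: "r (\<phi> q * v) = \<phi> q * r v" for v v' q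
        by (simp_all add: r_def w_add w_scale right_diff_distrib)
      have ew: "e (w v) = e v" for v
      proof -
        have "e (w v) = (\<Sum>(u, l)\<leftarrow>ps. e v * u * l)"
          unfolding wsum[OF e] using ps(1) g by (intro arg_cong[where f = sum_list] map_cong) auto
        then show ?thesis unfolding sl ps(2) by simp
      qed
      have wL: "w v \<in> L" if v: "e v \<in> e ` L" for v
      proof -
        have *: "\<phi> (e v * u) * g l \<in> L" if "(u, l) \<in> set ps" for u l
        proof -
          have "e v * u \<in> R" using ps(1)[OF that] v by (auto simp: mult.commute)
          then show ?thesis using Lr g ps(1)[OF that] by blast
        qed
        have "(\<Sum>(u, l)\<leftarrow>qs. \<phi> (e v * u) * g l) \<in> L" if "set qs \<subseteq> set ps" for qs
          using that by (induction qs) (auto simp: submodD(1)[OF L] * intro!: submodD(2)[OF L])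
        then show ?thesis by (simp add: w_def)
      qed
      have neg: "- v \<in> L" if "v \<in> L" for v using Lr[of "-1" v] that R(1,5) by (simp add: hom.hom_uminus)
      have diffL: "v - v' \<in> L" if "v \<in> L" "v' \<in> L" for v v'
        using submodD(2)[OF L that(1) neg[OF that(2)]] by simp
      have rL: "r v \<in> L" if "v \<in> L" for v using diffL[OF that wL] that by (simp add: r_def)
      have sub': "submod (\<phi> ` R) (r ` L)" unfolding submod_def
      proof (intro conjI ballI)
        have "r 0 = 0" using w_scale[of 0 0] by (simp add: r_def)
        then show "0 \<in> r ` L" using submodD(1)[OF L] by (metis image_eqI)
        show "p + q \<in> r ` L" if pq: "p \<in> r ` L" "q \<in> r ` L" for p q
        proof -
          obtain v v' where "v \<in> L" "v' \<in> L" "p = r v" "q = r v'" using pq by blast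
          then show ?thesis using submodD(2)[OF L] by (intro image_eqI[of _ _ "v + v'"]) (auto simp: r_add)
        qed
        show "s * p \<in> r ` L" if sp: "s \<in> \<phi> ` R" "p \<in> r ` L" for s p
        proof -
          obtain s' v where "s' \<in> R" "s = \<phi> s'" "v \<in> L" "p = r v" using sp by blast
          then show ?thesis using Lr
            by (intro image_eqI[of _ _ "\<phi> s' * v"]) (auto simp: r_scale)
        qed
      qed
      \<comment> \<open>\<open>r L \<subseteq> L\<close> and \<open>w x \<in> L\<close>, so
        \<open>r x \<in> r L\<close> would put \<open>x = r x + w x\<close> into
        \<open>L\<close>.\<close>
      have notin: "r x \<notin> r ` L"
      proof
        assume "r x \<in> r ` L"
        then obtain v where v: "v \<in> L" "r x = r v" by (rule imageE)
        have "r x \<in> L" unfolding v(2) by (rule rL[OF v(1)])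
        from submodD(2)[OF L this wL[OF True]] show False using insert.prems(6) by (simp add: r_def)
      qed
      have van': "coord b' v = 0" if v: "v \<in> insert (r x) (r ` L)" and b': "b' \<in> BK - N" for v b'
      proof -
        obtain v' where v': "v' \<in> insert x L" "v = r v'" using v by blast
        show ?thesis
        proof (cases "b' = b")
          case True
          then show ?thesis using ew[of v'] lin_diff[OF e, of v' "w v'"] by (simp add: v' r_def e_def)
        next
          case False
          then have b'': "b' \<in> BK - insert b N" using b' by blast
          have "coord b' (w v') = (\<Sum>(u, l)\<leftarrow>ps. 0)"
            unfolding wsum[OF coord_lin] using van[OF _ b''] g ps(1)
            by (intro arg_cong[where f = sum_list] map_cong) auto
          then show ?thesis using van[OF v'(1) b''] lin_diff[OF coord_lin, of b' v' "w v'"]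
            by (simp add: v' r_def split_def)
        qed
      qed
      have bd': "d * coord b' v \<in> R" if v: "v \<in> r ` L" and b': "b' \<in> BK" for v b'
      proof -
        from v obtain v' where v': "v' \<in> L" "v = r v'" by (rule imageE)
        have "v \<in> L" unfolding v'(2) by (rule rL[OF v'(1)])
        then show ?thesis using b' by (rule bd)
      qed
      have "N \<subseteq> BK" using insert.prems(1) by simp
      have "\<exists>f. lin f \<and> f ` (r ` L) \<subseteq> R \<and> f (r x) \<notin> R"
        by (rule insert.IH[OF \<open>N \<subseteq> BK\<close> sub' insert.prems(3) bd' van' notin])
      then obtain f where f: "lin f" "f ` (r ` L) \<subseteq> R" "f (r x) \<notin> R" by (elim exE conjE)
      have "lin (\<lambda>v. f (r v))"
        unfolding lin_def r_add r_scale by (simp add: linD[OF f(1)])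
      then show ?thesis using f by (intro exI[of _ "\<lambda>v. f (r v)"]) auto
    qed
  qed
qed

corollary separating_functional:
  assumes "submod (\<phi> ` R) L" "d \<noteq> 0" "\<And>v b. v \<in> L \<Longrightarrow> b \<in> BK \<Longrightarrow> d * coord b v \<in> R" "x \<notin> L"
  obtains f where "lin f" "f ` L \<subseteq> R" "f x \<notin> R"
proof -
  have "\<exists>f. lin f \<and> f ` L \<subseteq> R \<and> f x \<notin> R"
    by (rule separating_functional_aux[OF finite_BK order.refl assms(1,2,3) _ assms(4)]) auto
  then show ?thesis using that by blast
qed

end

section \<open>Products and colons of fractional ideals\<close>

lemma prod_modI: "i \<in> I \<Longrightarrow> j \<in> J \<Longrightarrow> i * j \<in> prod_mod I J"
  using ideal_prod.prod[of i I j J "ring_of_type_algebra"] by (simp add: prod_mod_def ring_of_type_algebra_def)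

lemma prod_mod_add: "x \<in> prod_mod I J \<Longrightarrow> y \<in> prod_mod I J \<Longrightarrow> x + y \<in> prod_mod I J"
  using ideal_prod.sum[of x "ring_of_type_algebra" I J y] by (simp add: prod_mod_def ring_of_type_algebra_def)

lemma prod_mod_induct [consumes 1, case_names prod sum]:
  assumes "x \<in> prod_mod I J" "\<And>i j. i \<in> I \<Longrightarrow> j \<in> J \<Longrightarrow> Q (i * j)" "\<And>x y. Q x \<Longrightarrow> Q y \<Longrightarrow> Q (x + y)"
  shows "Q x"
  using assms(1) unfolding prod_mod_def
  by (induction rule: ideal_prod.induct) (use assms(2,3) in \<open>auto simp: ring_of_type_algebra_def\<close>)

lemma submod_prod_mod:
  assumes I: "submod S I" and J: "submod S J" shows "submod S (prod_mod I J)"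
  unfolding submod_def
proof (intro conjI ballI)
  show "0 \<in> prod_mod I J" using prod_modI[OF submodD(1)[OF I] submodD(1)[OF J]] by simp
  show "x + y \<in> prod_mod I J" if "x \<in> prod_mod I J" "y \<in> prod_mod I J" for x y
    using that by (rule prod_mod_add)
  show "r * x \<in> prod_mod I J" if "r \<in> S" "x \<in> prod_mod I J" for r x
    using that(2)
  proof (induction rule: prod_mod_induct)
    case (prod i j)
    then show ?case using prod_modI[OF submodD(3)[OF I that(1)], of i j J] by (simp add: mult.assoc)
  next
    case (sum x y)
    then show ?case using prod_mod_add by (simp add: distrib_left)
  qed
qed

lemma submod_colon: "submod S I \<Longrightarrow> submod S (colon I J)"
  by (auto simp: submod_def colon_def distrib_right mult.assoc)

lemma colonD: "x \<in> colon I J \<Longrightarrow> j \<in> J \<Longrightarrow> x * j \<in> I"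
  by (simp add: colon_def)

lemma colonI: "(\<And>j. j \<in> J \<Longrightarrow> x * j \<in> I) \<Longrightarrow> x \<in> colon I J"
  by (simp add: colon_def)

lemma submod_lin_span_ideal: "submod S P \<Longrightarrow> submod S (lin_span P B)"
  unfolding submod_def
proof (intro conjI ballI)
  assume "0 \<in> P \<and> (\<forall>x\<in>P. \<forall>y\<in>P. x + y \<in> P) \<and> (\<forall>r\<in>S. \<forall>x\<in>P. r * x \<in> P)"
  then have P: "submod S P" by (simp add: submod_def)
  have "(\<Sum>b\<in>B. 0 * b) \<in> lin_span P B" by (rule lin_spanI) (simp add: submodD(1)[OF P])
  then show "0 \<in> lin_span P B" by simp
  fix x y assume "x \<in> lin_span P B" "y \<in> lin_span P B"
  then obtain c d where cd: "c \<in> B \<rightarrow> P" "d \<in> B \<rightarrow> P" "x = (\<Sum>b\<in>B. c b * b)" "y = (\<Sum>b\<in>B. d b * b)"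
    by (auto simp: lin_span_def)
  have "(\<Sum>b\<in>B. (c b + d b) * b) \<in> lin_span P B" 
    by (rule lin_spanI) (use cd submodD(2)[OF P] in auto)
  then show "x + y \<in> lin_span P B" by (simp add: cd distrib_right sum.distrib)
next
  assume "0 \<in> P \<and> (\<forall>x\<in>P. \<forall>y\<in>P. x + y \<in> P) \<and> (\<forall>r\<in>S. \<forall>x\<in>P. r * x \<in> P)"
  then have P: "submod S P" by (simp add: submod_def)
  fix r x assume "r \<in> S" "x \<in> lin_span P B"
  then obtain c where c: "c \<in> B \<rightarrow> P" "x = (\<Sum>b\<in>B. c b * b)" by (auto simp: lin_span_def)
  have "(\<Sum>b\<in>B. (r * c b) * b) \<in> lin_span P B"
    by (rule lin_spanI) (use c submodD(3)[OF P \<open>r \<in> S\<close>] in auto)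
  then show "r * x \<in> lin_span P B" by (simp add: c sum_distrib_left mult.assoc)
qed

text \<open>\<open>Zn\<close> plays the role of the nonzero elements of \<open>Z\<close>, viewed in \<open>K\<close>.\<close>

definition frac_ideal :: "'k::comm_ring_1 set \<Rightarrow> 'k set \<Rightarrow> 'k set \<Rightarrow> bool" where
  "frac_ideal S Zn I \<longleftrightarrow> submod S I \<and> (\<exists>m\<in>Zn. m \<in> I) \<and> (\<exists>d\<in>Zn. \<forall>x\<in>I. d * x \<in> S)"

text \<open>An order with its trace dual, after the trace, Q and Z have been abstracted away.
  \<open>reflexive\<close> is the duality, \<open>maximal\<close> says that primes meeting
  \<open>Zn\<close> are maximal, and \<open>shift_unit\<close> compensates for zero divisors: any
  \<open>x\<close> becomes a unit of \<open>K\<close> after adding a suitable multiple of a given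
  \<open>m\<close>.\<close>

locale dualizing_order =
  fixes S Zn D :: "'k::comm_ring_1 set"
  assumes subring: "is_subring S" and noeth: "noeth_module S S"
    and Zn_sub: "Zn \<subseteq> S" and Zn_unit: "m \<in> Zn \<Longrightarrow> \<exists>n. m * n = 1"
    and Zn_mult: "m \<in> Zn \<Longrightarrow> n \<in> Zn \<Longrightarrow> m * n \<in> Zn" and one_Zn: "1 \<in> Zn"
    and shift_unit: "m \<in> Zn \<Longrightarrow> \<exists>a\<in>S. \<exists>y. (x + a * m) * y = 1"
    and maximal: "prime_in S P \<Longrightarrow> n \<in> P \<Longrightarrow> n \<in> Zn \<Longrightarrow> x \<in> S \<Longrightarrow> x \<notin> P \<Longrightarrow> \<exists>y\<in>S. 1 - y * x \<in> P"
    and D_frac: "frac_ideal S Zn D"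
    and reflexive: "frac_ideal S Zn I \<Longrightarrow> colon D (colon D I) = I"
begin

lemmas R = subringD[OF subring]

abbreviation FI :: "'k set \<Rightarrow> bool" where "FI \<equiv> frac_ideal S Zn"

text \<open>Meeting \<open>Zn\<close> is what makes a prime ideal a lattice; it excludes primes such
  as 0 in the case that \<open>K\<close> is a field.\<close>

definition primes :: "'k set set" where
  "primes = {P. prime_in S P \<and> (\<exists>n\<in>Zn. n \<in> P)}"

definition idl :: "'k set \<Rightarrow> bool" where
  "idl M \<longleftrightarrow> submod S M \<and> M \<subseteq> S \<and> (\<exists>m\<in>Zn. m \<in> M)"

lemma FID:
  assumes "FI I"
  shows "submod S I" "0 \<in> I" "x \<in> I \<Longrightarrow> y \<in> I \<Longrightarrow> x + y \<in> I" "r \<in> S \<Longrightarrow> x \<in> I \<Longrightarrow> r * x \<in> I"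
    "x \<in> I \<Longrightarrow> y \<in> I \<Longrightarrow> x - y \<in> I" "\<exists>m\<in>Zn. m \<in> I" "\<exists>d\<in>Zn. \<forall>x\<in>I. d * x \<in> S"
proof -
  show s: "submod S I" "\<exists>m\<in>Zn. m \<in> I" "\<exists>d\<in>Zn. \<forall>x\<in>I. d * x \<in> S" using assms by (auto simp: frac_ideal_def)
  show "0 \<in> I" "x \<in> I \<Longrightarrow> y \<in> I \<Longrightarrow> x + y \<in> I" "r \<in> S \<Longrightarrow> x \<in> I \<Longrightarrow> r * x \<in> I"
    "x \<in> I \<Longrightarrow> y \<in> I \<Longrightarrow> x - y \<in> I"
    using submodD[OF s(1)] submod_diff[OF s(1) subring] by auto
qed

lemmas D = FID[OF D_frac]

lemma primesD:
  assumes "P \<in> primes"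
  shows "prime_in S P" "submod S P" "P \<subseteq> S" "1 \<notin> P" "x \<in> S \<Longrightarrow> y \<in> S \<Longrightarrow> x \<notin> P \<Longrightarrow> y \<notin> P \<Longrightarrow> x * y \<notin> P"
    "\<exists>n\<in>Zn. n \<in> P" "x \<in> S \<Longrightarrow> x \<notin> P \<Longrightarrow> \<exists>y\<in>S. 1 - y * x \<in> P"
proof -
  show p: "prime_in S P" "\<exists>n\<in>Zn. n \<in> P" using assms by (auto simp: primes_def)
  show "submod S P" "P \<subseteq> S" "1 \<notin> P" "x \<in> S \<Longrightarrow> y \<in> S \<Longrightarrow> x \<notin> P \<Longrightarrow> y \<notin> P \<Longrightarrow> x * y \<notin> P"
    using prime_inD[OF p(1)] by auto
  show "x \<in> S \<Longrightarrow> x \<notin> P \<Longrightarrow> \<exists>y\<in>S. 1 - y * x \<in> P" using p(2) maximal[OF p(1)] by blast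
qed

lemma idlD:
  assumes "idl M"
  shows "submod S M" "M \<subseteq> S" "\<exists>m\<in>Zn. m \<in> M"
  using assms by (auto simp: idl_def)

lemma idl_S: "idl S"
  using submod_self[OF subring] one_Zn R(1) by (auto simp: idl_def)

lemma idl_FI: "idl M \<Longrightarrow> FI M"
proof -
  assume M: "idl M"
  have "\<forall>x\<in>M. 1 * x \<in> S" using idlD(2)[OF M] by auto
  then show "FI M" unfolding frac_ideal_def using idlD(1,3)[OF M] one_Zn by blast
qed

lemma FI_S: "FI S"
  using idl_FI[OF idl_S] .

lemma primes_idl: "P \<in> primes \<Longrightarrow> idl P"
  using primesD(2,3,6) by (auto simp: idl_def)

lemma idl_prime_above:
  assumes "idl M" "1 \<notin> M"
  obtains P where "P \<in> primes" "M \<subseteq> P"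
proof -
  obtain P where "prime_in S P" "M \<subseteq> P"
    by (rule prime_above[OF subring noeth idlD(1,2)[OF assms(1)] assms(2)])
  moreover then have "P \<in> primes" using idlD(3)[OF assms(1)] by (auto simp: primes_def)
  ultimately show ?thesis using that by blast
qed

text \<open>The local-to-global principle: without 1, an ideal that meets \<open>Zn\<close> lies in
  some member of \<open>primes\<close>. It therefore suffices to leave each prime
  separately.\<close>

lemma idl_eq_S_locally:
  assumes "idl M" "\<And>P. P \<in> primes \<Longrightarrow> \<exists>s\<in>M. s \<notin> P"
  shows "1 \<in> M"
proof (rule ccontr)
  assume "1 \<notin> M"
  then obtain P where "P \<in> primes" "M \<subseteq> P" using idl_prime_above[OF assms(1)] by blast
  then show False using assms(2)[of P] by blast
qed

lemma FI_prod:
  assumes "FI I" "FI J" shows "FI (prod_mod I J)"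
proof -
  obtain m n d e where mn: "m \<in> Zn" "m \<in> I" "n \<in> Zn" "n \<in> J" "d \<in> Zn" "\<forall>x\<in>I. d * x \<in> S"
    "e \<in> Zn" "\<forall>x\<in>J. e * x \<in> S" using FID(6,7)[OF assms(1)] FID(6,7)[OF assms(2)] by blast
  have "(d * e) * x \<in> S" if "x \<in> prod_mod I J" for x
    using that
  proof (induction rule: prod_mod_induct)
    case (prod i j)
    have "(d * i) * (e * j) \<in> S" using mn(6,8) prod R(4) by blast
    then show ?case by (simp add: mult_ac)
  next
    case (sum x y)
    then show ?case using R(6) by (simp add: distrib_left)
  qed
  then show ?thesis unfolding frac_ideal_def
    using submod_prod_mod[OF FID(1)[OF assms(1)] FID(1)[OF assms(2)]] Zn_mult[OF mn(1,3)] Zn_mult[OF mn(5,7)]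
      prod_modI[OF mn(2,4)] by blast
qed

lemma FI_colon:
  assumes "FI I" "FI J" shows "FI (colon I J)"
proof -
  obtain m n d e where mn: "m \<in> Zn" "m \<in> I" "n \<in> Zn" "n \<in> J" "d \<in> Zn" "\<forall>x\<in>I. d * x \<in> S"
    "e \<in> Zn" "\<forall>x\<in>J. e * x \<in> S" using FID(6,7)[OF assms(1)] FID(6,7)[OF assms(2)] by blast
  have "e * m \<in> colon I J"
  proof (rule colonI)
    fix j assume "j \<in> J"
    then have "(e * j) * m \<in> I" using mn FID(4)[OF assms(1)] by blast
    then show "e * m * j \<in> I" by (simp add: mult_ac)
  qed
  moreover have "(d * n) * x \<in> S" if "x \<in> colon I J" for x
  proof -
    have "d * (x * n) \<in> S" using colonD[OF that mn(4)] mn(6) by blast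
    then show ?thesis by (simp add: mult_ac)
  qed
  ultimately show ?thesis unfolding frac_ideal_def
    using submod_colon[OF FID(1)[OF assms(1)]] Zn_mult[OF mn(7,1)] Zn_mult[OF mn(5,3)] by blast
qed

lemma colon_D_S: "colon D S = D"
  using D(4) R(1) colonD[of _ D S 1] by (force intro!: colonI simp: mult.commute)

lemma colon_D_D: "colon D D = S"
  using reflexive[OF FI_S] by (simp add: colon_D_S)

lemma colon_S_S: "colon S S = S"
  using R(1,4) colonD[of _ S S 1] by (force intro!: colonI)

text \<open>If \<open>x\<close> maps \<open>I J\<close> into \<open>D\<close>, then
  \<open>x I \<subseteq> (D : J) = I\<close> by reflexivity, so
  \<open>(D : I J) = (I : I) = S\<close>; applying \<open>(D : _)\<close> once more yields
  \<open>I J = (D : S) = D\<close>.\<close>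

lemma prod_colon_D:
  assumes I: "FI I" and m: "colon I I = S"
  shows "prod_mod I (colon D I) = D"
proof -
  let ?J = "colon D I"
  have J: "FI ?J" by (rule FI_colon[OF D_frac I])
  have "colon D (prod_mod I ?J) = S"
  proof (intro equalityI subsetI)
    fix x assume x: "x \<in> colon D (prod_mod I ?J)"
    have "x * i \<in> colon D ?J" if i: "i \<in> I" for i
    proof (rule colonI)
      fix j assume "j \<in> ?J"
      from colonD[OF x prod_modI[OF i this]] show "x * i * j \<in> D" by (simp add: mult.assoc)
    qed
    then have "x \<in> colon I I" unfolding reflexive[OF I] by (rule colonI)
    then show "x \<in> S" by (simp add: m)
  next
    fix x assume x: "x \<in> S"
    show "x \<in> colon D (prod_mod I ?J)"
    proof (rule colonI)
      fix w assume "w \<in> prod_mod I ?J"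
      then show "x * w \<in> D"
      proof (induction rule: prod_mod_induct)
        case (prod i j)
        have "x * (j * i) \<in> D" using D(4)[OF x colonD[OF prod(2,1)]] .
        then show ?case by (simp add: mult.commute)
      next
        case (sum u v)
        then show ?case using D(3) by (simp add: distrib_left)
      qed
    qed
  qed
  then show ?thesis using reflexive[OF FI_prod[OF I J]] colon_D_S by simp
qed

section \<open>Finite generation and Nakayama's lemma\<close>

lemma FI_fg:
  assumes "FI I" obtains B where "finite B" "B \<subseteq> I" "I = lin_span S B"
proof -
  obtain d where d: "d \<in> Zn" "\<forall>x\<in>I. d * x \<in> S" using FID(7)[OF assms] by blast
  obtain e where e: "d * e = 1" using Zn_unit[OF d(1)] by blast
  have "(*) d ` I \<subseteq> S" using d(2) by blast
  then have "fg_submodule S ((*) d ` I)"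
    using noeth submod_scale[OF FID(1)[OF assms], of d] unfolding noeth_module_def by blast
  from fg_submodule_scale[OF this subring, of e] have "fg_submodule S ((*) e ` (*) d ` I)" .
  moreover have "e * (d * x) = x" for x using e by (metis mult.assoc mult.commute mult_1)
  ultimately have "fg_submodule S I" by (simp add: image_image)
  then obtain B where B: "finite B" "I = lin_span S B" by (auto simp: fg_submodule_alt)
  then show ?thesis using that lin_span_base[OF subring B(1)] by blast
qed

text \<open>Denominator-free form: \<open>I = N + P I\<close> implies
  \<open>s I \<subseteq> N\<close> for some \<open>s\<close> outside \<open>P\<close>. The
  generators of \<open>I\<close> are removed one at a time from \<open>M C = N + P C\<close>,
  beginning with all of them and \<open>s = 1\<close>; each removal multiplies \<open>s\<close> by a
  further element outside \<open>P\<close>.\<close>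

lemma nakayama:
  assumes P: "P \<in> primes" and I: "FI I" and N: "submod S N"
    and gen: "\<And>d. d \<in> I \<Longrightarrow> \<exists>n\<in>N. d - n \<in> prod_mod P I"
  obtains s where "s \<in> S" "s \<notin> P" "\<And>d. d \<in> I \<Longrightarrow> s * d \<in> N"
proof -
  obtain B where B: "finite B" "B \<subseteq> I" "I = lin_span S B" using FI_fg[OF I] by blast
  note Pm = primesD[OF P]
  have PB: "prod_mod P I \<subseteq> lin_span P B"
  proof
    fix x assume "x \<in> prod_mod P I"
    then show "x \<in> lin_span P B"
    proof (induction rule: prod_mod_induct)
      case (prod p i)
      then obtain c where c: "c \<in> B \<rightarrow> S" "i = (\<Sum>b\<in>B. c b * b)" using B(3) by (auto simp: lin_span_def)
      have "(\<Sum>b\<in>B. (c b * p) * b) \<in> lin_span P B"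
        by (rule lin_spanI) (use c(1) prod(1) submodD(3)[OF Pm(2)] in auto)
      then show ?case by (simp add: c(2) sum_distrib_left mult_ac)
    next
      case (sum x y)
      then show ?case using submodD(2)[OF submod_lin_span_ideal[OF Pm(2)]] by blast
    qed
  qed
  define M where "M C = {n + w |n w. n \<in> N \<and> w \<in> lin_span P C}" for C
  have subM: "submod S (M C)" for C
    unfolding submod_def
  proof (intro conjI ballI)
    note l = submod_lin_span_ideal[OF Pm(2), of C]
    show "0 \<in> M C" unfolding M_def using submodD(1)[OF N] submodD(1)[OF l] by force
    fix a b assume "a \<in> M C" "b \<in> M C"
    then obtain n w n' w' where *: "n \<in> N" "w \<in> lin_span P C" "a = n + w" "n' \<in> N" "w' \<in> lin_span P C" "b = n' + w'"
      unfolding M_def by blast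
    have "a + b = (n + n') + (w + w')" using * by simp
    then show "a + b \<in> M C" unfolding M_def using submodD(2)[OF N *(1,4)] submodD(2)[OF l *(2,5)] by blast
  next
    note l = submod_lin_span_ideal[OF Pm(2), of C]
    fix r a assume "r \<in> S" "a \<in> M C"
    then obtain n w where *: "n \<in> N" "w \<in> lin_span P C" "a = n + w" unfolding M_def by blast
    have "r * a = r * n + r * w" using * by (simp add: distrib_left)
    then show "r * a \<in> M C" unfolding M_def
      using submodD(3)[OF N \<open>r \<in> S\<close> *(1)] submodD(3)[OF l \<open>r \<in> S\<close> *(2)] by blast
  qed
  have "\<exists>s\<in>S. s \<notin> P \<and> (\<forall>d\<in>I. s * d \<in> N)"
    if "finite C" "C \<subseteq> I" "\<exists>s\<in>S. s \<notin> P \<and> (\<forall>d\<in>I. s * d \<in> M C)" for C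
    using that
  proof (induction C rule: finite_induct)
    case empty
    have "M {} = N" by (auto simp: M_def lin_span_def)
    then show ?case using empty by simp
  next
    case (insert b C)
    obtain s where s: "s \<in> S" "s \<notin> P" "\<forall>d\<in>I. s * d \<in> M (insert b C)" using insert.prems(2) by blast
    have split: "\<exists>m p. m \<in> M C \<and> p \<in> P \<and> s * d = m + p * b" if "d \<in> I" for d
    proof -
      have "s * d \<in> M (insert b C)" using s(3) that by blast
      then obtain n w where nw: "n \<in> N" "w \<in> lin_span P (insert b C)" "s * d = n + w" unfolding M_def by blast
      obtain p y where py: "p \<in> P" "y \<in> lin_span P C" "w = p * b + y"
        by (rule lin_span_insertE[OF insert.hyps nw(2)])
      have "s * d = (n + y) + p * b" using nw py by (simp add: add_ac)
      moreover have "n + y \<in> M C" using nw py unfolding M_def by blast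
      ultimately show ?thesis using py(1) by blast
    qed
    obtain m p where mp: "m \<in> M C" "p \<in> P" "s * b = m + p * b" using split[of b] insert.prems(1) by blast
    \<comment> \<open>From \<open>s * b = m + p * b\<close> follows
      \<open>t * b = m \<in> M C\<close>. As \<open>p \<in> P\<close> and
      \<open>s \<notin> P\<close>, also \<open>t \<notin> P\<close>.\<close>
    define t where "t = s - p"
    have t: "t \<in> S" "t \<notin> P"
    proof -
      show "t \<in> S" using R(3)[OF s(1)] mp(2) Pm(3) unfolding t_def by blast
      show "t \<notin> P"
      proof
        assume "t \<in> P"
        from submodD(2)[OF Pm(2) this mp(2)] show False using s(2) by (simp add: t_def)
      qed
    qed
    have tb: "t * b \<in> M C" using mp by (simp add: t_def left_diff_distrib)
    have "(t * s) * d \<in> M C" if d: "d \<in> I" for d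
    proof -
      obtain m' p' where m': "m' \<in> M C" "p' \<in> P" "s * d = m' + p' * b" using split[OF d] by blast
      have "(t * s) * d = t * m' + p' * (t * b)"
        unfolding mult.assoc m'(3) by (simp add: distrib_left mult.left_commute)
      then show ?thesis using submodD(2)[OF subM submodD(3)[OF subM t(1) m'(1)] submodD(3)[OF subM _ tb]] m'(2) Pm(3)
        by auto
    qed
    moreover have "t * s \<in> S" "t * s \<notin> P" using R(4)[OF t(1) s(1)] Pm(5)[OF t(1) s(1) t(2) s(2)] by auto
    ultimately have "\<exists>s\<in>S. s \<notin> P \<and> (\<forall>d\<in>I. s * d \<in> M C)" by blast
    then show ?case using insert.IH insert.prems(1) by blast
  qed
  moreover have "1 * d \<in> M B" if dI: "d \<in> I" for d
  proof -
    obtain n where n: "n \<in> N" "d - n \<in> prod_mod P I" using gen[OF dI] by blast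
    have "d = n + (d - n)" by simp
    moreover have "d - n \<in> lin_span P B" using n(2) PB by blast
    ultimately show ?thesis using n(1) unfolding M_def mult_1 by blast
  qed
  ultimately have "\<exists>s\<in>S. s \<notin> P \<and> (\<forall>d\<in>I. s * d \<in> N)" using B(1,2) R(1) Pm(4) by blast
  then show ?thesis using that by blast
qed

section \<open>Local isomorphism\<close>

text \<open>\<open>loc_iso P I J\<close> says \<open>s I \<subseteq> x J\<close> and \<open>s x J \<subseteq> I\<close> for a unit \<open>x\<close> of \<open>K\<close> and some \<open>s \<in> S - P\<close>;
  it is a denominator-free form of \<open>I\<^sub>P = x J\<^sub>P\<close>. Here \<open>y\<close> is the inverse of \<open>x\<close>.\<close>

definition loc_iso :: "'k set \<Rightarrow> 'k set \<Rightarrow> 'k set \<Rightarrow> bool" where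
  "loc_iso P I J \<longleftrightarrow> (\<exists>x y s. x * y = 1 \<and> s \<in> S \<and> s \<notin> P \<and> (\<forall>i\<in>I. s * i * y \<in> J) \<and> (\<forall>j\<in>J. s * j * x \<in> I))"

lemma loc_isoI: "x * y = 1 \<Longrightarrow> s \<in> S \<Longrightarrow> s \<notin> P \<Longrightarrow> (\<And>i. i \<in> I \<Longrightarrow> s * i * y \<in> J) \<Longrightarrow> (\<And>j. j \<in> J \<Longrightarrow> s * j * x \<in> I) \<Longrightarrow> loc_iso P I J"
  unfolding loc_iso_def by blast

lemma loc_isoE:
  assumes "loc_iso P I J"
  obtains x y s where "x * y = 1" "s \<in> S" "s \<notin> P" "\<And>i. i \<in> I \<Longrightarrow> s * i * y \<in> J" "\<And>j. j \<in> J \<Longrightarrow> s * j * x \<in> I"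
  using assms unfolding loc_iso_def by blast

lemma loc_iso_sym: "loc_iso P I J \<Longrightarrow> loc_iso P J I"
proof (elim loc_isoE)
  fix x y s assume *: "x * y = 1" "s \<in> S" "s \<notin> P" "\<And>i. i \<in> I \<Longrightarrow> s * i * y \<in> J" "\<And>j. j \<in> J \<Longrightarrow> s * j * x \<in> I"
  have "y * x = 1" using *(1) by (simp add: mult.commute)
  from loc_isoI[OF this *(2,3,5,4)] show "loc_iso P J I" .
qed

lemma loc_iso_trans:
  assumes P: "P \<in> primes" and "loc_iso P I J" "loc_iso P J L" shows "loc_iso P I L"
proof -
  obtain x y s where 1: "x * y = 1" "s \<in> S" "s \<notin> P" "\<And>i. i \<in> I \<Longrightarrow> s * i * y \<in> J" "\<And>j. j \<in> J \<Longrightarrow> s * j * x \<in> I"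
    using loc_isoE[OF assms(2)] by metis
  obtain x' y' t where 2: "x' * y' = 1" "t \<in> S" "t \<notin> P" "\<And>i. i \<in> J \<Longrightarrow> t * i * y' \<in> L" "\<And>j. j \<in> L \<Longrightarrow> t * j * x' \<in> J"
    using loc_isoE[OF assms(3)] by metis
  show ?thesis
  proof (rule loc_isoI)
    show "(x * x') * (y * y') = 1" using 1(1) 2(1) by (metis mult.assoc mult.left_commute mult_1_right)
    show "s * t \<in> S" "s * t \<notin> P" using R(4)[OF 1(2) 2(2)] primesD(5)[OF P 1(2) 2(2) 1(3) 2(3)] by auto
    show "s * t * i * (y * y') \<in> L" if "i \<in> I" for i using 2(4)[OF 1(4)[OF that]] by (simp add: mult_ac)
    show "s * t * j * (x * x') \<in> I" if "j \<in> L" for j using 1(5)[OF 2(5)[OF that]] by (simp add: mult_ac)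
  qed
qed

section \<open>Generators of \<open>D\<close> modulo \<open>P D\<close>, by representatives\<close>

definition gen1 :: "'k set \<Rightarrow> 'k \<Rightarrow> bool" where
  "gen1 P w \<longleftrightarrow> (\<forall>d\<in>D. \<exists>a\<in>S. d - a * w \<in> prod_mod P D)"

definition gen2 :: "'k set \<Rightarrow> 'k \<Rightarrow> 'k \<Rightarrow> bool" where
  "gen2 P v w \<longleftrightarrow> (\<forall>d\<in>D. \<exists>a\<in>S. \<exists>b\<in>S. d - (a * v + b * w) \<in> prod_mod P D)"

lemma PD:
  assumes "P \<in> primes"
  shows "FI (prod_mod P D)" "p \<in> P \<Longrightarrow> d \<in> D \<Longrightarrow> p * d \<in> prod_mod P D" "prod_mod P D \<subseteq> D"
proof -
  show "FI (prod_mod P D)" using FI_prod[OF idl_FI[OF primes_idl[OF assms]] D_frac] .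
  show "p \<in> P \<Longrightarrow> d \<in> D \<Longrightarrow> p * d \<in> prod_mod P D" by (rule prod_modI)
  show "prod_mod P D \<subseteq> D"
  proof
    fix x assume "x \<in> prod_mod P D"
    then show "x \<in> D"
      by (induction rule: prod_mod_induct) (use D(3,4) primesD(3)[OF assms] in blast)+
  qed
qed

text \<open>Shift \<open>w\<close> by a multiple of some \<open>m \<in> Zn\<close> in
  \<open>P D\<close>: the class modulo \<open>P D\<close> is unchanged and the result
  \<open>v\<close> is a unit of \<open>K\<close>. Nakayama's lemma then gives
  \<open>s D \<subseteq> v S\<close>.\<close>

lemma gen1_loc_iso:
  assumes P: "P \<in> primes" and w: "w \<in> D" "gen1 P w"
  shows "loc_iso P D S"
proof -
  note PD = PD[OF P]
  obtain m where m: "m \<in> Zn" "m \<in> prod_mod P D" using FID(6)[OF PD(1)] by blast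
  obtain a y where a: "a \<in> S" "(w + a * m) * y = 1" using shift_unit[OF m(1)] by blast
  define v where "v = w + a * m"
  have am: "a * m \<in> prod_mod P D" using FID(4)[OF PD(1) a(1) m(2)] .
  have v: "v \<in> D" unfolding v_def using D(3)[OF w(1)] am PD(3) by blast
  have "submod S ((*) v ` S)" by (rule submod_scale[OF submod_self[OF subring]])
  moreover have "\<exists>n\<in>(*) v ` S. d - n \<in> prod_mod P D" if dD: "d \<in> D" for d
  proof -
    obtain b where b: "b \<in> S" "d - b * w \<in> prod_mod P D" using w(2) dD unfolding gen1_def by blast
    have "d - v * b = (d - b * w) - b * (a * m)" by (simp add: v_def algebra_simps)
    from FID(5)[OF PD(1) b(2) FID(4)[OF PD(1) b(1) am], folded this]
    show ?thesis using b(1) by blast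
  qed
  ultimately obtain s where s: "s \<in> S" "s \<notin> P" "\<And>d. d \<in> D \<Longrightarrow> s * d \<in> (*) v ` S"
    using nakayama[OF P D_frac, of "(*) v ` S"] by blast
  have vy: "v * y = 1" using a(2) by (simp add: v_def)
  show ?thesis
  proof (rule loc_isoI[OF vy s(1,2)])
    fix d assume "d \<in> D"
    from s(3)[OF this] obtain b where b: "b \<in> S" "s * d = v * b" by blast
    have "s * d * y = b" unfolding b(2) using vy by (metis mult.commute mult.left_commute mult_1_right)
    then show "s * d * y \<in> S" using b by simp
  next
    fix t assume "t \<in> S"
    then show "s * t * v \<in> D" using D(4)[OF R(4)[OF s(1)] v] by blast
  qed
qed

text \<open>The generator is \<open>s * x\<close>: for \<open>d \<in> D\<close> the element
  \<open>s d y\<close> is in \<open>S\<close> and \<open>(s d y) (s x) = s^2 d\<close>, where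
  \<open>s^2\<close> is invertible modulo \<open>P\<close>.\<close>

lemma loc_iso_gen1:
  assumes P: "P \<in> primes" and l: "loc_iso P D S"
  obtains w where "w \<in> D" "gen1 P w"
proof -
  obtain x y s where 1: "x * y = 1" "s \<in> S" "s \<notin> P" "\<And>i. i \<in> D \<Longrightarrow> s * i * y \<in> S" "\<And>j. j \<in> S \<Longrightarrow> s * j * x \<in> D"
    using loc_isoE[OF l] by metis
  have ss: "s * s \<in> S" "s * s \<notin> P" using R(4)[OF 1(2,2)] primesD(5)[OF P 1(2,2,3,3)] by auto
  obtain c where c: "c \<in> S" "1 - c * (s * s) \<in> P" using primesD(7)[OF P ss] by blast
  have "gen1 P (s * x)" unfolding gen1_def
  proof
    fix d assume d: "d \<in> D"
    have "c * (s * d * y) * (s * x) = c * (s * s) * d * (x * y)" by (simp only: mult_ac)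
    then have "d - c * (s * d * y) * (s * x) = (1 - c * (s * s)) * d" by (simp add: 1(1) left_diff_distrib)
    then have "d - c * (s * d * y) * (s * x) \<in> prod_mod P D" using PD(2)[OF P c(2) d] by simp
    then show "\<exists>a\<in>S. d - a * (s * x) \<in> prod_mod P D" using R(4)[OF c(1) 1(4)[OF d]] by blast
  qed
  moreover have "s * x \<in> D" using 1(5)[OF R(1)] by simp
  ultimately show ?thesis using that by blast
qed

lemma gen2_commute: "gen2 P v w \<Longrightarrow> gen2 P w v"
  unfolding gen2_def by (metis add.commute)

text \<open>Steinitz exchange: the coefficient \<open>a\<close> of \<open>v\<close> in
  \<open>u\<close> is outside \<open>P\<close>, hence invertible modulo \<open>P\<close>.\<close>

lemma gen2_exchange:
  assumes P: "P \<in> primes" and g: "gen2 P v w" and vw: "v \<in> D" "w \<in> D" and a: "a \<in> S" "b \<in> S" "a \<notin> P"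
    and u: "u - (a * v + b * w) \<in> prod_mod P D"
  shows "gen2 P u w"
  unfolding gen2_def
proof
  fix d assume "d \<in> D"
  then obtain e f where ef: "e \<in> S" "f \<in> S" "d - (e * v + f * w) \<in> prod_mod P D" using g unfolding gen2_def by blast
  obtain c where c: "c \<in> S" "1 - c * a \<in> P" using primesD(7)[OF P a(1,3)] by blast
  note F = FID[OF PD(1)[OF P]]
  \<comment> \<open>This element equals \<open>v - c * u + c * b * w\<close>, so it expresses
    \<open>v\<close> through \<open>u\<close> and \<open>w\<close> modulo
    \<open>P D\<close>.\<close>
  have "(1 - c * a) * v - c * (u - (a * v + b * w)) \<in> prod_mod P D"
    using F(5)[OF PD(2)[OF P c(2) vw(1)] F(4)[OF c(1) u]] .
  from F(3)[OF ef(3) F(4)[OF ef(1) this]]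
  have "d - ((e * c) * u + (f - e * c * b) * w) \<in> prod_mod P D" by (simp add: algebra_simps)
  moreover have "e * c \<in> S" "f - e * c * b \<in> S"
    using R(4)[OF ef(1) c(1)] R(3)[OF ef(2)] R(4)[OF R(4)[OF ef(1) c(1)] a(2)] by auto
  ultimately show "\<exists>a\<in>S. \<exists>b\<in>S. d - (a * u + b * w) \<in> prod_mod P D" by blast
qed

text \<open>Two exchanges: since \<open>u\<close> is nonzero modulo \<open>P D\<close> it replaces
  \<open>w1\<close> or \<open>w2\<close>, and since \<open>v\<close> is no multiple of
  \<open>u\<close> it replaces the other one.\<close>

lemma gen2_independent:
  assumes P: "P \<in> primes" and g: "gen2 P w1 w2" and w: "w1 \<in> D" "w2 \<in> D" and uv: "u \<in> D" "v \<in> D"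
    and u: "u \<notin> prod_mod P D" and v: "\<And>a. a \<in> S \<Longrightarrow> v - a * u \<notin> prod_mod P D"
  shows "gen2 P u v"
proof -
  note F = FID[OF PD(1)[OF P]]
  have main: "gen2 P u v" if g: "gen2 P w1 w2" and w: "w1 \<in> D" "w2 \<in> D"
    and a: "a \<in> S" "b \<in> S" "a \<notin> P" "u - (a * w1 + b * w2) \<in> prod_mod P D" for w1 w2 a b
  proof -
    have g2: "gen2 P u w2" by (rule gen2_exchange[OF P g w a])
    then obtain c d where cd: "c \<in> S" "d \<in> S" "v - (c * u + d * w2) \<in> prod_mod P D"
      using uv(2) unfolding gen2_def by blast
    have "d \<notin> P"
    proof
      assume "d \<in> P"
      from F(3)[OF cd(3) PD(2)[OF P this w(2)]] have "v - c * u \<in> prod_mod P D" by (simp add: algebra_simps)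
      then show False using v[OF cd(1)] by simp
    qed
    moreover have "v - (d * w2 + c * u) \<in> prod_mod P D" using cd(3) by (simp add: add.commute)
    ultimately show ?thesis
      by (intro gen2_commute[OF gen2_exchange[OF P gen2_commute[OF g2] w(2) uv(1) cd(2,1)]])
  qed
  obtain a b where ab: "a \<in> S" "b \<in> S" "u - (a * w1 + b * w2) \<in> prod_mod P D"
    using g uv(1) unfolding gen2_def by blast
  have "a \<notin> P \<or> b \<notin> P"
  proof (rule ccontr)
    assume "\<not> ?thesis"
    then have "a * w1 \<in> prod_mod P D" "b * w2 \<in> prod_mod P D" using PD(2)[OF P] w by auto
    from F(3)[OF ab(3) F(3)[OF this]] show False using u by simp
  qed
  then show ?thesis
  proof
    assume "a \<notin> P" from main[OF g w ab(1,2) this ab(3)] show ?thesis .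
  next
    assume b: "b \<notin> P"
    have "u - (b * w2 + a * w1) \<in> prod_mod P D" using ab(3) by (simp add: add.commute)
    from main[OF gen2_commute[OF g] w(2,1) ab(2,1) b this] show ?thesis .
  qed
qed

text \<open>A bilinear map onto a two-dimensional space, whose image spans, is already surjective in one
  of its arguments for a suitable fixed value of the other: take products \<open>x1 y1\<close>, \<open>x2 y2\<close> that
  form a basis; unless one of \<open>x1\<close>, \<open>x2\<close>, \<open>y1\<close>, \<open>y2\<close> works, the mixed products vanish, and then
  \<open>x1 + x2\<close> works.\<close>

lemma bilinear_rank_two:
  assumes P: "P \<in> primes" and I: "FI I" and J: "FI J" and IJ: "prod_mod I J = D"
    and g: "gen2 P w1 w2" and w: "w1 \<in> D" "w2 \<in> D"
  shows "(\<exists>x\<in>I. \<forall>d\<in>D. \<exists>j\<in>J. d - x * j \<in> prod_mod P D) \<or> (\<exists>y\<in>J. \<forall>d\<in>D. \<exists>i\<in>I. d - i * y \<in> prod_mod P D)"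
    (is "(\<exists>x\<in>I. ?X x) \<or> (\<exists>y\<in>J. ?Y y)")
proof (rule ccontr)
  assume "\<not> ?thesis"
  then have nX: "\<And>x. x \<in> I \<Longrightarrow> \<not> ?X x" and nY: "\<And>y. y \<in> J \<Longrightarrow> \<not> ?Y y" by auto
  note F = FID[OF PD(1)[OF P]]
  have prodD: "i * j \<in> D" if "i \<in> I" "j \<in> J" for i j using prod_modI[OF that] IJ by simp
  have X: "?X x" if g2: "gen2 P (x * j1) (x * j2)" "j1 \<in> J" "j2 \<in> J" for x j1 j2
  proof
    fix d assume "d \<in> D"
    then obtain a b where ab: "a \<in> S" "b \<in> S" "d - (a * (x * j1) + b * (x * j2)) \<in> prod_mod P D"
      using g2(1) unfolding gen2_def by blast
    have "d - x * (a * j1 + b * j2) \<in> prod_mod P D" using ab(3) by (simp add: distrib_left mult.left_commute)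
    moreover have "a * j1 + b * j2 \<in> J"
      using FID(3)[OF J FID(4)[OF J ab(1) g2(2)] FID(4)[OF J ab(2) g2(3)]] .
    ultimately show "\<exists>j\<in>J. d - x * j \<in> prod_mod P D" by blast
  qed
  have Y: "?Y y" if g2: "gen2 P (i1 * y) (i2 * y)" "i1 \<in> I" "i2 \<in> I" for y i1 i2
  proof
    fix d assume "d \<in> D"
    then obtain a b where ab: "a \<in> S" "b \<in> S" "d - (a * (i1 * y) + b * (i2 * y)) \<in> prod_mod P D"
      using g2(1) unfolding gen2_def by blast
    have "d - (a * i1 + b * i2) * y \<in> prod_mod P D" using ab(3) by (simp add: distrib_right mult.assoc)
    moreover have "a * i1 + b * i2 \<in> I"
      using FID(3)[OF I FID(4)[OF I ab(1) g2(2)] FID(4)[OF I ab(2) g2(3)]] .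
    ultimately show "\<exists>i\<in>I. d - i * y \<in> prod_mod P D" by blast
  qed
  have "\<exists>x1\<in>I. \<exists>y1\<in>J. x1 * y1 \<notin> prod_mod P D"
  proof (rule ccontr)
    assume *: "\<not> ?thesis"
    have "d \<in> prod_mod P D" if "d \<in> D" for d
      using that unfolding IJ[symmetric]
    proof (induction rule: prod_mod_induct)
      case (prod i j) then show ?case using * IJ by auto
    next
      case (sum x y) then show ?case using F(3) IJ by auto
    qed
    then have "?X 0" using FID(2)[OF J] by auto
    then show False using nX FID(2)[OF I] by blast
  qed
  then obtain x1 y1 where 1: "x1 \<in> I" "y1 \<in> J" "x1 * y1 \<notin> prod_mod P D" by blast
  define u where "u = x1 * y1"
  \<comment> \<open>The elements whose class modulo \<open>P D\<close> lies on the line spanned by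
    \<open>u\<close>. Were all products on it, \<open>x1\<close> alone would already yield
    everything.\<close>
  define gu where "gu = {d. \<exists>a\<in>S. d - a * u \<in> prod_mod P D}"
  have "\<exists>x2\<in>I. \<exists>y2\<in>J. x2 * y2 \<notin> gu"
  proof (rule ccontr)
    assume *: "\<not> ?thesis"
    have "d \<in> gu" if "d \<in> prod_mod I J" for d
      using that
    proof (induction rule: prod_mod_induct)
      case (prod i j) then show ?case using * by auto
    next
      case (sum x y)
      then obtain a b where ab: "a \<in> S" "x - a * u \<in> prod_mod P D" "b \<in> S" "y - b * u \<in> prod_mod P D"
        unfolding gu_def by blast
      from F(3)[OF ab(2,4)] have "(x + y) - (a + b) * u \<in> prod_mod P D" by (simp add: algebra_simps)
      then show ?case unfolding gu_def using R(6)[OF ab(1,3)] by blast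
    qed
    then have gD: "d \<in> gu" if "d \<in> D" for d using that IJ by simp
    have "?X x1"
    proof
      fix d assume "d \<in> D"
      from gD[OF this] obtain a where a: "a \<in> S" "d - a * u \<in> prod_mod P D" unfolding gu_def by blast
      then have "d - x1 * (a * y1) \<in> prod_mod P D" by (simp add: u_def mult.left_commute)
      then show "\<exists>j\<in>J. d - x1 * j \<in> prod_mod P D" using FID(4)[OF J a(1) 1(2)] by blast
    qed
    then show False using nX[OF 1(1)] by blast
  qed
  then obtain x2 y2 where 2: "x2 \<in> I" "y2 \<in> J" "x2 * y2 \<notin> gu" by blast
  define v where "v = x2 * y2"
  have uv: "u \<in> D" "v \<in> D" using prodD 1 2 by (auto simp: u_def v_def)
  have u: "u \<notin> prod_mod P D" using 1 by (simp add: u_def)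
  have ind: "gen2 P u z" if "z \<in> D" "z \<notin> gu" for z
    using gen2_independent[OF P g w uv(1) that(1) u] that(2) unfolding gu_def by blast
  have guv: "gen2 P u v" using ind[OF uv(2)] 2(3) by (simp add: v_def)
  \<comment> \<open>A \<open>z\<close> that is nonzero modulo \<open>P D\<close> spans together with
    \<open>u\<close> or together with \<open>v\<close>: off the line of \<open>u\<close> the first
    holds, and on it \<open>z\<close> can be exchanged for \<open>u\<close>.\<close>
  have mixed: "z \<in> prod_mod P D" if z: "z \<in> D" "\<not> gen2 P u z" "\<not> gen2 P z v" for z
  proof (rule ccontr)
    assume nz: "z \<notin> prod_mod P D"
    have "z \<in> gu" using ind z by blast
    then obtain a where a: "a \<in> S" "z - a * u \<in> prod_mod P D" unfolding gu_def by blast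
    have "a \<notin> P"
    proof
      assume "a \<in> P"
      from F(3)[OF a(2) PD(2)[OF P this uv(1)]] show False using nz by simp
    qed
    moreover have "z - (a * u + 0 * v) \<in> prod_mod P D" using a(2) by simp
    ultimately have "gen2 P z v" using gen2_exchange[OF P guv uv a(1) R(2)] by blast
    then show False using z by blast
  qed
  have m12: "x1 * y2 \<in> prod_mod P D"
  proof (rule mixed[OF prodD[OF 1(1) 2(2)]])
    show "\<not> gen2 P u (x1 * y2)" using X[of x1 y1 y2] nX[OF 1(1)] 1(2) 2(2) unfolding u_def by blast
    show "\<not> gen2 P (x1 * y2) v" using Y[of x1 y2 x2] nY[OF 2(2)] 1(1) 2(1) unfolding v_def by blast
  qed
  have m21: "x2 * y1 \<in> prod_mod P D"
  proof (rule mixed[OF prodD[OF 2(1) 1(2)]])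
    show "\<not> gen2 P u (x2 * y1)" using Y[of x1 y1 x2] nY[OF 1(2)] 1(1) 2(1) unfolding u_def by blast
    show "\<not> gen2 P (x2 * y1) v" using X[of x2 y1 y2] nX[OF 2(1)] 1(2) 2(2) unfolding v_def by blast
  qed
  have xx: "x1 + x2 \<in> I" using FID(3)[OF I 1(1) 2(1)] .
  have "?X (x1 + x2)"
  proof
    fix d assume "d \<in> D"
    then obtain a b where ab: "a \<in> S" "b \<in> S" "d - (a * u + b * v) \<in> prod_mod P D"
      using guv unfolding gen2_def by blast
    \<comment> \<open>\<open>(x1 + x2) (a y1 + b y2)\<close> is \<open>a u + b v\<close> plus the
      two mixed products, which lie in \<open>P D\<close>.\<close>
    have "(d - (a * u + b * v)) - (a * (x2 * y1) + b * (x1 * y2)) \<in> prod_mod P D"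
      using F(5)[OF ab(3) F(3)[OF F(4)[OF ab(1) m21] F(4)[OF ab(2) m12]]] .
    then have "d - (x1 + x2) * (a * y1 + b * y2) \<in> prod_mod P D"
      by (simp add: u_def v_def algebra_simps)
    moreover have "a * y1 + b * y2 \<in> J"
      using FID(3)[OF J FID(4)[OF J ab(1) 1(2)] FID(4)[OF J ab(2) 2(2)]] .
    ultimately show "\<exists>j\<in>J. d - (x1 + x2) * j \<in> prod_mod P D" by blast
  qed
  then show False using nX[OF xx] by blast
qed

text \<open>The element of \<open>I\<close> or \<open>J\<close> that generates \<open>D\<close>
  modulo \<open>P D\<close> is first shifted to a unit \<open>v\<close> of \<open>K\<close>;
  Nakayama's lemma then gives \<open>s D \<subseteq> v J\<close> or
  \<open>s D \<subseteq> v I\<close>. In both cases the reverse inclusion comes from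
  \<open>I J = D\<close>.\<close>

theorem locally_S_or_D:
  assumes P: "P \<in> primes" and I: "FI I" and m: "colon I I = S"
    and g: "gen2 P w1 w2" and w: "w1 \<in> D" "w2 \<in> D"
  shows "loc_iso P I S \<or> loc_iso P I D"
proof -
  define J where "J = colon D I"
  have J: "FI J" unfolding J_def by (rule FI_colon[OF D_frac I])
  have IJ: "prod_mod I J = D" unfolding J_def by (rule prod_colon_D[OF I m])
  have prodD: "i * j \<in> D" if "i \<in> I" "j \<in> J" for i j using prod_modI[OF that] IJ by simp
  note F = FID[OF PD(1)[OF P]]
  obtain n where n: "n \<in> Zn" "n \<in> P" using primesD(6)[OF P] by blast
  from bilinear_rank_two[OF P I J IJ g w] show ?thesis
  proof
    assume "\<exists>x\<in>I. \<forall>d\<in>D. \<exists>j\<in>J. d - x * j \<in> prod_mod P D"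
    then obtain x where x: "x \<in> I" "\<And>d. d \<in> D \<Longrightarrow> \<exists>j\<in>J. d - x * j \<in> prod_mod P D" by blast
    obtain m where m: "m \<in> Zn" "m \<in> I" using FID(6)[OF I] by blast
    obtain a y where a: "a \<in> S" "(x + a * (n * m)) * y = 1" using shift_unit[OF Zn_mult[OF n(1) m(1)]] by blast
    \<comment> \<open>The shift is a multiple of \<open>m \<in> I\<close>, so \<open>v\<close> stays
      in \<open>I\<close>, and of \<open>n \<in> P\<close>, so products with \<open>J\<close> change
      only by elements of \<open>P D\<close>.\<close>
    define v where "v = x + a * (n * m)"
    have v: "v \<in> I" unfolding v_def
      using FID(3)[OF I x(1) FID(4)[OF I a(1) FID(4)[OF I _ m(2)]]] n(1) Zn_sub by blast
    have "\<exists>k\<in>(*) v ` J. d - k \<in> prod_mod P D" if dD: "d \<in> D" for d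
    proof -
      obtain j where j: "j \<in> J" "d - x * j \<in> prod_mod P D" using x(2)[OF dD] by blast
      have "n * (m * j) \<in> prod_mod P D" using PD(2)[OF P n(2) prodD[OF m(2) j(1)]] .
      from F(5)[OF j(2) F(4)[OF a(1) this]] have "d - v * j \<in> prod_mod P D"
        by (simp add: v_def algebra_simps)
      then show ?thesis using j(1) by blast
    qed
    then obtain s where s: "s \<in> S" "s \<notin> P" "\<And>d. d \<in> D \<Longrightarrow> s * d \<in> (*) v ` J"
      using nakayama[OF P D_frac submod_scale[OF FID(1)[OF J], of v]] by blast
    have vy: "v * y = 1" using a(2) by (simp add: v_def)
    have "loc_iso P I S"
    proof (rule loc_isoI[OF vy s(1,2)])
      fix i assume i: "i \<in> I"
      \<comment> \<open>\<open>s * i * y\<close> is \<open>s i / v\<close>. It maps \<open>D\<close>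
        into \<open>D\<close> because \<open>s * d = v * j\<close> gives
        \<open>(s i / v) d = i j\<close>.\<close>
      have "s * i * y \<in> colon D D"
      proof (rule colonI)
        fix d assume "d \<in> D"
        from s(3)[OF this] obtain j where j: "j \<in> J" "s * d = v * j" by blast
        have "s * i * y * d = i * y * (s * d)" by (simp only: mult_ac)
        also have "\<dots> = i * j * (v * y)" unfolding j(2) by (simp only: mult_ac)
        finally show "s * i * y * d \<in> D" using prodD[OF i j(1)] by (simp add: vy)
      qed
      then show "s * i * y \<in> S" by (simp add: colon_D_D)
    next
      fix t assume "t \<in> S"
      then show "s * t * v \<in> I" using FID(4)[OF I R(4)[OF s(1)] v] by blast
    qed
    then show ?thesis ..
  next
    assume "\<exists>y\<in>J. \<forall>d\<in>D. \<exists>i\<in>I. d - i * y \<in> prod_mod P D"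
    then obtain x where x: "x \<in> J" "\<And>d. d \<in> D \<Longrightarrow> \<exists>i\<in>I. d - i * x \<in> prod_mod P D" by blast
    obtain m where m: "m \<in> Zn" "m \<in> J" using FID(6)[OF J] by blast
    obtain a y where a: "a \<in> S" "(x + a * (n * m)) * y = 1" using shift_unit[OF Zn_mult[OF n(1) m(1)]] by blast
    define v where "v = x + a * (n * m)"
    have v: "v \<in> J" unfolding v_def
      using FID(3)[OF J x(1) FID(4)[OF J a(1) FID(4)[OF J _ m(2)]]] n(1) Zn_sub by blast
    have "\<exists>k\<in>(*) v ` I. d - k \<in> prod_mod P D" if dD: "d \<in> D" for d
    proof -
      obtain i where i: "i \<in> I" "d - i * x \<in> prod_mod P D" using x(2)[OF dD] by blast
      have "n * (i * m) \<in> prod_mod P D" using PD(2)[OF P n(2) prodD[OF i(1) m(2)]] .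
      from F(5)[OF i(2) F(4)[OF a(1) this]] have "d - v * i \<in> prod_mod P D"
        by (simp add: v_def algebra_simps)
      then show ?thesis using i(1) by blast
    qed
    then obtain s where s: "s \<in> S" "s \<notin> P" "\<And>d. d \<in> D \<Longrightarrow> s * d \<in> (*) v ` I"
      using nakayama[OF P D_frac submod_scale[OF FID(1)[OF I], of v]] by blast
    have yv: "y * v = 1" using a(2) by (simp add: v_def mult.commute)
    \<comment> \<open>Here \<open>v \<in> J = (D : I)\<close> carries \<open>I\<close> into
      \<open>D\<close> directly, so \<open>(D : D) = S\<close> is not involved and the unit is the
      inverse of \<open>v\<close>.\<close>
    have "loc_iso P I D"
    proof (rule loc_isoI[OF yv s(1,2)])
      fix i assume "i \<in> I"
      from D(4)[OF s(1) prodD[OF this v]] show "s * i * v \<in> D" by (simp add: mult.assoc)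
    next
      fix d assume "d \<in> D"
      from s(3)[OF this] obtain i where i: "i \<in> I" "s * d = v * i" by blast
      have "s * d * y = i * (y * v)" unfolding i(2) by (simp only: mult_ac)
      then show "s * d * y \<in> I" using i(1) by (simp add: yv)
    qed
    then show ?thesis ..
  qed
qed

end

section \<open>Ideal classes of a dualizing order\<close>

context dualizing_order
begin

section \<open>Splitting an ideal according to the primes above it\<close>

lemma idl_adjoin:
  assumes M: "idl M" and x: "x \<in> S"
  shows "idl (adjoin S M x)"
proof -
  note a = submod_adjoin[OF subring idlD(1)[OF M], of x]
  have "adjoin S M x \<subseteq> S" by (rule adjoin_subset[OF submod_self[OF subring] idlD(2)[OF M] x])
  then show ?thesis using a(1,2) idlD(3)[OF M] unfolding idl_def by blast
qed

text \<open>Noetherian induction: an ideal that is neither prime nor all of \<open>S\<close>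
  contains a product \<open>x y\<close> of elements outside it, and both \<open>M + x S\<close> and
  \<open>M + y S\<close> are larger. It takes the place of a primary decomposition.\<close>

lemma idl_prime_induct [consumes 1, case_names one prime split]:
  assumes M: "idl M"
    and one: "\<And>M. idl M \<Longrightarrow> 1 \<in> M \<Longrightarrow> Q M"
    and prime: "\<And>P. P \<in> primes \<Longrightarrow> Q P"
    and split: "\<And>M x y. idl M \<Longrightarrow> x \<in> S \<Longrightarrow> y \<in> S \<Longrightarrow> x * y \<in> M \<Longrightarrow> Q (adjoin S M x) \<Longrightarrow> Q (adjoin S M y) \<Longrightarrow> Q M"
  shows "Q M"
proof (rule ccontr)
  assume nQ: "\<not> Q M"
  define F where "F = {M. idl M \<and> \<not> Q M}"
  have ne: "F \<noteq> {}" using M nQ by (auto simp: F_def)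
  have sub: "submod S N \<and> N \<subseteq> S" if "N \<in> F" for N using that idlD(1,2) by (auto simp: F_def)
  obtain N where N: "N \<in> F" "\<And>N'. N' \<in> F \<Longrightarrow> N \<subseteq> N' \<Longrightarrow> N' = N"
    by (rule noeth_max[OF subring noeth ne sub]) blast+
  have N': "idl N" "\<not> Q N" using N(1) by (auto simp: F_def)
  have "1 \<notin> N" using one[OF N'(1)] N'(2) by blast
  moreover have "N \<notin> primes" using prime N'(2) by blast
  ultimately have "\<not> (\<forall>x\<in>S. \<forall>y\<in>S. x * y \<in> N \<longrightarrow> x \<in> N \<or> y \<in> N)"
    using idlD[OF N'(1)] by (auto simp: primes_def prime_in_def)
  then obtain x y where xy: "x \<in> S" "y \<in> S" "x * y \<in> N" "x \<notin> N" "y \<notin> N" by blast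
  have "Q (adjoin S N z)" if z: "z \<in> S" "z \<notin> N" for z
  proof (rule ccontr)
    assume "\<not> Q (adjoin S N z)"
    then have "adjoin S N z \<in> F" using idl_adjoin[OF N'(1) z(1)] by (simp add: F_def)
    from N(2)[OF this] show False using submod_adjoin(2,3)[OF subring idlD(1)[OF N'(1)], of z] z(2) by blast
  qed
  then show False using split[OF N'(1) xy(1-3)] xy N'(2) by blast
qed

lemma adjoin_mult_mem:
  assumes M: "idl M" and xy: "x \<in> S" "y \<in> S" "x * y \<in> M" and uv: "u \<in> adjoin S M x" "v \<in> adjoin S M y"
  shows "u * v \<in> M"
proof -
  obtain m r n t where u: "m \<in> M" "r \<in> S" "u = m + r * x" "n \<in> M" "t \<in> S" "v = n + t * y"
    using uv unfolding adjoin_def by blast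
  note s = submodD[OF idlD(1)[OF M]]
  have "n * m \<in> M" using s(3)[OF _ u(1)] u(4) idlD(2)[OF M] by blast
  moreover have "(r * x) * n \<in> M" using s(3)[OF R(4)[OF u(2) xy(1)] u(4)] .
  moreover have "(t * y) * m \<in> M" using s(3)[OF R(4)[OF u(5) xy(2)] u(1)] .
  moreover have "(r * t) * (x * y) \<in> M" using s(3)[OF R(4)[OF u(2,5)] xy(3)] .
  ultimately have "n * m + (r * x) * n + (t * y) * m + (r * t) * (x * y) \<in> M" using s(2) by blast
  then show ?thesis by (simp add: u algebra_simps)
qed

lemma prime_contains_prod:
  assumes P: "P \<in> primes" and I: "I \<subseteq> S" "J \<subseteq> S" and IJ: "\<And>i j. i \<in> I \<Longrightarrow> j \<in> J \<Longrightarrow> i * j \<in> P"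
  shows "I \<subseteq> P \<or> J \<subseteq> P"
proof (rule ccontr)
  assume "\<not> ?thesis"
  then obtain i j where "i \<in> I" "i \<notin> P" "j \<in> J" "j \<notin> P" by blast
  then show False using primesD(5)[OF P, of i j] I IJ by blast
qed

lemma prime_subset_prime:
  assumes "P \<in> primes" "P' \<in> primes" "P \<subseteq> P'" shows "P' = P"
proof (rule ccontr)
  assume "P' \<noteq> P"
  then obtain x where x: "x \<in> P'" "x \<notin> P" using assms(3) by blast
  then obtain y where y: "y \<in> S" "1 - y * x \<in> P" using primesD(7)[OF assms(1)] primesD(3)[OF assms(2)] by blast
  have "(1 - y * x) + y * x \<in> P'"
    using submodD(2)[OF primesD(2)[OF assms(2)] _ submodD(3)[OF primesD(2)[OF assms(2)] y(1) x(1)]] y(2) assms(3) by blast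
  then show False using primesD(4)[OF assms(2)] by simp
qed

text \<open>If \<open>x * y \<in> M\<close>, a prime over \<open>M\<close> contains \<open>x\<close>
  or \<open>y\<close>, hence lies over \<open>M + x S\<close> or over \<open>M + y S\<close>; and
  the only prime over a prime is itself.\<close>

lemma finite_primes_over:
  assumes "idl M" shows "finite {P \<in> primes. M \<subseteq> P}"
  using assms
proof (induction rule: idl_prime_induct)
  case (one M)
  then have "{P \<in> primes. M \<subseteq> P} = {}" using primesD(4) by blast
  then show ?case by (simp only: finite.emptyI)
next
  case (prime P)
  have "{P' \<in> primes. P \<subseteq> P'} \<subseteq> {P}" using prime_subset_prime[OF prime] by blast
  then show ?case using finite_subset by blast
next
  case (split M x y)
  have "{P \<in> primes. M \<subseteq> P} \<subseteq> {P \<in> primes. adjoin S M x \<subseteq> P} \<union> {P \<in> primes. adjoin S M y \<subseteq> P}"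
  proof
    fix P assume "P \<in> {P \<in> primes. M \<subseteq> P}"
    then have P: "P \<in> primes" "M \<subseteq> P" by auto
    have "x \<in> P \<or> y \<in> P" using primesD(5)[OF P(1) split(2,3)] split(4) P(2) by blast
    then show "P \<in> {P \<in> primes. adjoin S M x \<subseteq> P} \<union> {P \<in> primes. adjoin S M y \<subseteq> P}"
      using adjoin_subset[OF primesD(2)[OF P(1)] P(2)] P(1) by blast
  qed
  then show ?case using split(5,6) finite_subset finite_UnI by blast
qed

text \<open>In effect, a product of primes contained in \<open>M\<close> is grouped into the factors
  belonging to \<open>A\<close> and the others. In the inductive step the ideals for
  \<open>M + x S\<close> and \<open>M + y S\<close> are multiplied, because
  \<open>(M + x S) (M + y S) \<subseteq> M\<close>.\<close>

lemma idl_split_primes: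
  assumes "idl M"
  shows "\<exists>a b. idl a \<and> idl b \<and> (\<forall>x\<in>a. \<forall>y\<in>b. x * y \<in> M) \<and>
    (\<forall>P\<in>primes. (a \<subseteq> P \<longrightarrow> P \<in> A) \<and> (b \<subseteq> P \<longrightarrow> P \<notin> A))"
  using assms
proof (induction rule: idl_prime_induct)
  case (one M)
  have "x * y \<in> M" if "x \<in> S" "y \<in> S" for x y
    using submodD(3)[OF idlD(1)[OF one(1)] R(4)[OF that] one(2)] by simp
  moreover have "\<not> S \<subseteq> P" if "P \<in> primes" for P using primesD(4)[OF that] R(1) by blast
  ultimately show ?case using idl_S by blast
next
  case (prime Q)
  note i = primes_idl[OF prime]
  have S: "\<not> S \<subseteq> P" if "P \<in> primes" for P using primesD(4)[OF that] R(1) by blast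
  have m: "x * y \<in> Q" "y * x \<in> Q" if "x \<in> Q" "y \<in> S" for x y
    using submodD(3)[OF idlD(1)[OF i] that(2,1)] by (auto simp: mult.commute)
  show ?case
  proof (cases "Q \<in> A")
    case True
    show ?thesis
      by (intro exI[of _ Q] exI[of _ S]) (use True i idl_S m S prime_subset_prime[OF prime] in blast)
  next
    case False
    show ?thesis
      by (intro exI[of _ S] exI[of _ Q]) (use False i idl_S m S prime_subset_prime[OF prime] in blast)
  qed
next
  case (split M x y)
  obtain a b where ab: "idl a" "idl b" "\<forall>u\<in>a. \<forall>v\<in>b. u * v \<in> adjoin S M x"
    "\<forall>P\<in>primes. (a \<subseteq> P \<longrightarrow> P \<in> A) \<and> (b \<subseteq> P \<longrightarrow> P \<notin> A)" using split(5) by blast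
  obtain c d where cd: "idl c" "idl d" "\<forall>u\<in>c. \<forall>v\<in>d. u * v \<in> adjoin S M y"
    "\<forall>P\<in>primes. (c \<subseteq> P \<longrightarrow> P \<in> A) \<and> (d \<subseteq> P \<longrightarrow> P \<notin> A)" using split(6) by blast
  have idl_prod: "idl (prod_mod I J)" if IJ: "idl I" "idl J" for I J
  proof -
    have "prod_mod I J \<subseteq> S"
    proof
      fix w assume "w \<in> prod_mod I J"
      then show "w \<in> S"
        by (induction rule: prod_mod_induct) (use R(4,6) idlD(2)[OF IJ(1)] idlD(2)[OF IJ(2)] in blast)+
    qed
    then show ?thesis using FI_prod[OF idl_FI[OF IJ(1)] idl_FI[OF IJ(2)]]
      by (simp add: idl_def frac_ideal_def)
  qed
  have mem: "u * v \<in> M" if u: "u \<in> prod_mod a c" and v: "v \<in> prod_mod b d" for u v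
    using u
  proof (induction rule: prod_mod_induct)
    case (prod i j)
    show ?case using v
    proof (induction rule: prod_mod_induct)
      case (prod k l)
      have "(i * k) * (j * l) \<in> M"
        using adjoin_mult_mem[OF split(1-4)] ab(3) cd(3) prod \<open>i \<in> a\<close> \<open>j \<in> c\<close> by blast
      then show ?case by (simp add: mult_ac)
    next
      case (sum p q)
      then show ?case using submodD(2)[OF idlD(1)[OF split(1)]] by (simp add: distrib_left)
    qed
  next
    case (sum p q)
    then show ?case using submodD(2)[OF idlD(1)[OF split(1)]] by (simp add: distrib_right)
  qed
  have pr: "I \<subseteq> P \<or> J \<subseteq> P" if "P \<in> primes" "idl I" "idl J" "prod_mod I J \<subseteq> P" for I J P
    using prime_contains_prod[OF that(1) idlD(2)[OF that(2)] idlD(2)[OF that(3)]] prod_modI that(4) by blast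
  have "(prod_mod a c \<subseteq> P \<longrightarrow> P \<in> A) \<and> (prod_mod b d \<subseteq> P \<longrightarrow> P \<notin> A)" if "P \<in> primes" for P
    using pr[OF that ab(1) cd(1)] pr[OF that ab(2) cd(2)] ab(4) cd(4) that by blast
  then show ?case using idl_prod[OF ab(1) cd(1)] idl_prod[OF ab(2) cd(2)] mem by blast
qed

text \<open>No prime contains both \<open>a\<close> and \<open>b\<close>, so
  \<open>a + b = S\<close> and 1 splits as \<open>f + g\<close>. A prime over \<open>M\<close>
  contains the product of \<open>a\<close> and \<open>b\<close>, hence one of them, and membership
  in \<open>A\<close> decides which.\<close>

lemma split_one:
  assumes M: "idl M"
  obtains f g where "f \<in> S" "g \<in> S" "f + g = 1" "f * g \<in> M"
    "\<And>P. P \<in> primes \<Longrightarrow> M \<subseteq> P \<Longrightarrow> P \<in> A \<Longrightarrow> f \<in> P" "\<And>P. P \<in> primes \<Longrightarrow> M \<subseteq> P \<Longrightarrow> P \<notin> A \<Longrightarrow> g \<in> P"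
proof -
  obtain a b where ab: "idl a" "idl b" "\<forall>u\<in>a. \<forall>v\<in>b. u * v \<in> M"
    "\<forall>P\<in>primes. (a \<subseteq> P \<longrightarrow> P \<in> A) \<and> (b \<subseteq> P \<longrightarrow> P \<notin> A)" using idl_split_primes[OF M, of A] by blast
  note a = submodD[OF idlD(1)[OF ab(1)]] and b = submodD[OF idlD(1)[OF ab(2)]]
  define c where "c = {x + y |x y. x \<in> a \<and> y \<in> b}"
  have ac: "a \<subseteq> c" "b \<subseteq> c" unfolding c_def using a(1) b(1) by force+
  have "submod S c" unfolding submod_def
  proof (intro conjI ballI)
    show "0 \<in> c" using ac a(1) by blast
    fix x y assume "x \<in> c" "y \<in> c"
    then obtain p q p' q' where *: "p \<in> a" "q \<in> b" "x = p + q" "p' \<in> a" "q' \<in> b" "y = p' + q'" unfolding c_def by blast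
    have "x + y = (p + p') + (q + q')" using * by simp
    then show "x + y \<in> c" unfolding c_def using a(2)[OF *(1,4)] b(2)[OF *(2,5)] by blast
  next
    fix r x assume r: "r \<in> S" "x \<in> c"
    then obtain p q where *: "p \<in> a" "q \<in> b" "x = p + q" unfolding c_def by blast
    have "r * x = r * p + r * q" using * by (simp add: distrib_left)
    then show "r * x \<in> c" unfolding c_def using a(3)[OF r(1) *(1)] b(3)[OF r(1) *(2)] by blast
  qed
  moreover have "c \<subseteq> S" using idlD(2)[OF ab(1)] idlD(2)[OF ab(2)] R(6) unfolding c_def by blast
  ultimately have c: "idl c" using idlD(3)[OF ab(1)] ac(1) unfolding idl_def by blast
  have "1 \<in> c"
  proof (rule ccontr)
    assume "1 \<notin> c"
    then obtain P where "P \<in> primes" "c \<subseteq> P" using idl_prime_above[OF c] by blast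
    then show False using ab(4) ac by blast
  qed
  then obtain f g where fg: "f \<in> a" "g \<in> b" "1 = f + g" unfolding c_def by blast
  have or: "a \<subseteq> P \<or> b \<subseteq> P" if "P \<in> primes" "M \<subseteq> P" for P
    using prime_contains_prod[OF that(1) idlD(2)[OF ab(1)] idlD(2)[OF ab(2)]] ab(3) that(2) by blast
  show ?thesis
  proof (rule that)
    show "f \<in> S" "g \<in> S" using fg idlD(2)[OF ab(1)] idlD(2)[OF ab(2)] by auto
    show "f + g = 1" "f * g \<in> M" using fg ab(3) by auto
    show "f \<in> P" if "P \<in> primes" "M \<subseteq> P" "P \<in> A" for P using or[OF that(1,2)] ab(4) that fg by blast
    show "g \<in> P" if "P \<in> primes" "M \<subseteq> P" "P \<notin> A" for P using or[OF that(1,2)] ab(4) that fg by blast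
  qed
qed

definition T :: "'k set set" where "T = {P \<in> primes. \<not> loc_iso P D S}"

text \<open>Given \<open>d D \<subseteq> S\<close> and \<open>m \<in> d D\<close>, write \<open>1 = f + g\<close> with \<open>f g \<in> m S\<close> such that \<open>f\<close> lies in
  the primes over \<open>m\<close> belonging to \<open>A\<close> and \<open>g\<close> in the others; then \<open>g d D + f S + m S\<close> is locally
  \<open>D\<close> at the primes in \<open>A\<close> and locally \<open>S\<close> elsewhere.\<close>

lemma finite_T_and_prescribed_ideal:
  "finite T" "A \<subseteq> T \<Longrightarrow> \<exists>I. FI I \<and> (\<forall>P\<in>primes. loc_iso P I (if P \<in> A then D else S))"
proof -
  obtain d where d: "d \<in> Zn" "\<forall>x\<in>D. d * x \<in> S" using D(7) by blast
  obtain e where e: "d * e = 1" using Zn_unit[OF d(1)] by blast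
  obtain mD where mD: "mD \<in> Zn" "mD \<in> D" using D(6) by blast
  define m where "m = d * mD"
  have m: "m \<in> Zn" "m \<in> S" using Zn_mult[OF d(1) mD(1)] Zn_sub by (auto simp: m_def)
  define M where "M = (*) m ` S"
  have mM: "m \<in> M" using R(1) unfolding M_def by (intro image_eqI[of _ _ 1]) auto
  have MS: "M \<subseteq> S" using R(4)[OF m(2)] unfolding M_def by blast
  have M: "idl M" unfolding idl_def
    using submod_scale[OF submod_self[OF subring]] MS m(1) mM unfolding M_def by blast
  have ed: "e * (d * x) = x" "d * x * e = x" for x using e by (metis mult.assoc mult.commute mult_1)+
  \<comment> \<open>\<open>m S \<subseteq> d D \<subseteq> S\<close> because
    \<open>m = d * mD\<close>. At primes not containing \<open>m\<close> the ideals
    \<open>d D\<close> and \<open>S\<close> thus agree, so \<open>T\<close> consists of primes over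
    \<open>m\<close>.\<close>
  have away: "loc_iso P D S" if P: "P \<in> primes" "m \<notin> P" for P
  proof (rule loc_isoI[of e d m])
    show "e * d = 1" using e by (simp add: mult.commute)
    show "m \<in> S" "m \<notin> P" using m P by auto
    show "m * i * d \<in> S" if "i \<in> D" for i
      using R(4)[OF m(2), of "d * i"] d(2) that by (simp add: mult.assoc mult.commute[of i d])
    show "m * j * e \<in> D" if "j \<in> S" for j
    proof -
      have "m * j * e = j * mD * (d * e)" by (simp only: m_def mult_ac)
      then show ?thesis using D(4)[OF that mD(2)] e by simp
    qed
  qed
  have over: "M \<subseteq> P" if P: "P \<in> primes" "m \<in> P" for P
  proof
    fix x assume "x \<in> M"
    then obtain r where r: "r \<in> S" "x = m * r" unfolding M_def by blast
    have "r * m \<in> P" using submodD(3)[OF primesD(2)[OF P(1)] r(1) P(2)] .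
    then show "x \<in> P" by (simp add: r(2) mult.commute)
  qed
  have TM: "P \<in> primes" "m \<in> P" if "P \<in> T" for P using that away unfolding T_def by blast+
  have "T \<subseteq> {P \<in> primes. M \<subseteq> P}" using TM over by blast
  then show "finite T" using finite_primes_over[OF M] finite_subset by blast
  assume A: "A \<subseteq> T"
  obtain f g where fg: "f \<in> S" "g \<in> S" "f + g = 1" "f * g \<in> M"
    "\<And>P. P \<in> primes \<Longrightarrow> M \<subseteq> P \<Longrightarrow> P \<in> A \<Longrightarrow> f \<in> P" "\<And>P. P \<in> primes \<Longrightarrow> M \<subseteq> P \<Longrightarrow> P \<notin> A \<Longrightarrow> g \<in> P"
    using split_one[OF M, of A] by metis
  obtain r where r: "r \<in> S" "f * g = m * r" using fg(4) unfolding M_def by blast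
  define I where "I = {g * (d * x) + f * t + m * u |x t u. x \<in> D \<and> t \<in> S \<and> u \<in> S}"
  have II: "g * (d * x) + f * t + m * u \<in> I" if "x \<in> D" "t \<in> S" "u \<in> S" for x t u
    using that unfolding I_def by blast
  have "idl I" unfolding idl_def submod_def
  proof (intro conjI ballI)
    show "0 \<in> I" using II[OF D(2) R(2,2)] by simp
    fix p q assume "p \<in> I" "q \<in> I"
    then obtain x t u x' t' u' where *: "x \<in> D" "t \<in> S" "u \<in> S" "p = g * (d * x) + f * t + m * u"
      "x' \<in> D" "t' \<in> S" "u' \<in> S" "q = g * (d * x') + f * t' + m * u'" unfolding I_def by blast
    have "p + q = g * (d * (x + x')) + f * (t + t') + m * (u + u')" unfolding *(4,8) by (simp add: algebra_simps)
    then show "p + q \<in> I" using II[OF D(3)[OF *(1,5)] R(6)[OF *(2,6)] R(6)[OF *(3,7)]] by simp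
  next
    fix s p assume s: "s \<in> S" "p \<in> I"
    then obtain x t u where *: "x \<in> D" "t \<in> S" "u \<in> S" "p = g * (d * x) + f * t + m * u" unfolding I_def by blast
    have "s * p = g * (d * (s * x)) + f * (s * t) + m * (s * u)" unfolding *(4) by (simp add: algebra_simps)
    then show "s * p \<in> I" using II[OF D(4)[OF s(1) *(1)] R(4)[OF s(1) *(2)] R(4)[OF s(1) *(3)]] by simp
  next
    show "I \<subseteq> S"
    proof
      fix p assume "p \<in> I"
      then obtain x t u where *: "x \<in> D" "t \<in> S" "u \<in> S" "p = g * (d * x) + f * t + m * u" unfolding I_def by blast
      show "p \<in> S" unfolding *(4) using R(6)[OF R(6)[OF R(4)[OF fg(2)] R(4)[OF fg(1) *(2)]] R(4)[OF m(2) *(3)]] d(2) *(1) by blast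
    qed
    have "m \<in> I" using II[OF D(2) R(2,1)] by simp
    then show "\<exists>m\<in>Zn. m \<in> I" using m(1) by blast
  qed
  then have I: "FI I" "I \<subseteq> S" using idl_FI idlD(2) by auto
  have "loc_iso P I (if P \<in> A then D else S)" if P: "P \<in> primes" for P
  proof (cases "P \<in> A")
    case True
    then have mP: "m \<in> P" using A TM by blast
    have "g \<notin> P"
    proof
      assume "g \<in> P"
      from submodD(2)[OF primesD(2)[OF P] fg(5)[OF P over[OF P mP] True] this] show False
        using fg(3) primesD(4)[OF P] by simp
    qed
    have "loc_iso P I D"
    proof (rule loc_isoI[OF e fg(2) \<open>g \<notin> P\<close>])
      fix i assume "i \<in> I"
      then obtain x t u where *: "x \<in> D" "t \<in> S" "u \<in> S" "i = g * (d * x) + f * t + m * u" unfolding I_def by blast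
      \<comment> \<open>\<open>e\<close> divides by \<open>d\<close>. The term with \<open>f\<close>
        stays in \<open>D\<close> because \<open>f * g = m * r\<close> and \<open>m = d * mD\<close>
        turn it into \<open>r * t * mD\<close>.\<close>
      have "g * i * e = (g * g * x + r * t * mD + g * u * mD) * (d * e)"
      proof -
        have "g * i * e = g * g * x * (d * e) + (f * g) * t * e + g * u * mD * (d * e)"
          unfolding *(4) by (simp add: m_def algebra_simps)
        also have "(f * g) * t * e = r * t * mD * (d * e)" unfolding r(2) by (simp only: m_def mult_ac)
        finally show ?thesis by (simp only: distrib_right)
      qed
      then have "g * i * e = g * g * x + r * t * mD + g * u * mD" by (simp add: e)
      then show "g * i * e \<in> D"
        using D(3)[OF D(3)[OF D(4)[OF R(4)[OF fg(2,2)] *(1)] D(4)[OF R(4)[OF r(1) *(2)] mD(2)]]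
            D(4)[OF R(4)[OF fg(2) *(3)] mD(2)]] by simp
    next
      fix j assume "j \<in> D"
      from II[OF this R(2,2)] show "g * j * d \<in> I" by (simp add: mult_ac)
    qed
    then show ?thesis using True by simp
  next
    case False
    \<comment> \<open>The witness is \<open>f\<close> at primes over \<open>m\<close>, where
      \<open>g \<in> P\<close> forces \<open>f \<notin> P\<close>, and \<open>m\<close> itself at
      the other primes.\<close>
    have "\<exists>s\<in>S. s \<notin> P \<and> (\<forall>t\<in>S. s * t \<in> I)"
    proof (cases "m \<in> P")
      case True
      have "f \<notin> P"
      proof
        assume "f \<in> P"
        from submodD(2)[OF primesD(2)[OF P] this fg(6)[OF P over[OF P True] False]] show False
          using fg(3) primesD(4)[OF P] by simp
      qed
      moreover have "f * t \<in> I" if "t \<in> S" for t using II[OF D(2) that R(2)] by simp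
      ultimately show ?thesis using fg(1) by blast
    next
      case False
      moreover have "m * t \<in> I" if "t \<in> S" for t using II[OF D(2) R(2) that] by simp
      ultimately show ?thesis using m(2) by blast
    qed
    then obtain s where s: "s \<in> S" "s \<notin> P" "\<forall>t\<in>S. s * t \<in> I" by blast
    have "loc_iso P I S"
      using s R(4)[OF s(1)] I(2) by (intro loc_isoI[of 1 1 s]) auto
    then show ?thesis using False by simp
  qed
  then show "\<exists>I. FI I \<and> (\<forall>P\<in>primes. loc_iso P I (if P \<in> A then D else S))" using I(1) by blast
qed

text \<open>For \<open>x \<in> (I : I)\<close> consider the ideal \<open>a\<close> of all
  denominators of \<open>x\<close> in \<open>S\<close>. At each prime, \<open>x\<close> also
  multiplies a local model of \<open>I\<close> into itself; as \<open>(S : S) = (D : D) = S\<close>,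
  this produces the denominator \<open>s * s\<close> outside \<open>P\<close>.\<close>

lemma colon_self_local:
  assumes I: "FI I" and loc: "\<And>P. P \<in> primes \<Longrightarrow> loc_iso P I S \<or> loc_iso P I D"
  shows "colon I I = S"
proof
  show "S \<subseteq> colon I I" using FID(4)[OF I] by (auto intro: colonI)
  show "colon I I \<subseteq> S"
  proof
    fix x assume x: "x \<in> colon I I"
    define a where "a = {t \<in> S. t * x \<in> S}"
    have key: "\<exists>s\<in>a. s \<notin> P" if P: "P \<in> primes" and J: "loc_iso P I J" "colon J J = S" for P J
    proof -
      obtain u v s where s: "u * v = 1" "s \<in> S" "s \<notin> P" "\<And>i. i \<in> I \<Longrightarrow> s * i * v \<in> J" "\<And>j. j \<in> J \<Longrightarrow> s * j * u \<in> I"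
        using loc_isoE[OF J(1)] by metis
      have "s * s * x \<in> colon J J"
      proof (rule colonI)
        fix j assume "j \<in> J"
        from s(4)[OF colonD[OF x s(5)[OF this]]] have "s * s * x * j * (u * v) \<in> J" by (simp add: mult_ac)
        then show "s * s * x * j \<in> J" by (simp add: s(1))
      qed
      then have "s * s \<in> a" using R(4)[OF s(2,2)] J(2) by (simp add: a_def)
      then show ?thesis using primesD(5)[OF P s(2,2,3,3)] by blast
    qed
    have "idl a" unfolding idl_def submod_def
    proof (intro conjI ballI)
      show "0 \<in> a" using R(2) by (simp add: a_def)
      show "p + q \<in> a" if "p \<in> a" "q \<in> a" for p q using that R(6) by (simp add: a_def distrib_right)
      show "r * p \<in> a" if "r \<in> S" "p \<in> a" for r p using that R(4) by (simp add: a_def mult.assoc)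
      show "a \<subseteq> S" by (auto simp: a_def)
      obtain d where d: "d \<in> Zn" "\<forall>y\<in>colon I I. d * y \<in> S" using FID(7)[OF FI_colon[OF I I]] by blast
      then have "d \<in> a" using x Zn_sub by (auto simp: a_def)
      then show "\<exists>m\<in>Zn. m \<in> a" using d(1) by blast
    qed
    then have "1 \<in> a" by (rule idl_eq_S_locally) (use key loc colon_S_S colon_D_D in blast)
    then show "x \<in> S" by (simp add: a_def)
  qed
qed

section \<open>Invertible ideals\<close>

definition invertible :: "'k set \<Rightarrow> bool" where
  "invertible L \<longleftrightarrow> FI L \<and> prod_mod L (colon S L) = S"

text \<open>An invertible ideal is locally principal: some product \<open>l * k\<close> with
  \<open>l \<in> L\<close> and \<open>k \<in> (S : L)\<close> is outside \<open>P\<close>. After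
  shifting \<open>l\<close> to a unit \<open>v\<close> of \<open>K\<close>, the element
  \<open>k * v \<in> S - P\<close> is the denominator that compares \<open>L\<close> with
  \<open>v S\<close>.\<close>

lemma invertible_prod_loc_iso:
  assumes L: "invertible L" and I: "FI I" and P: "P \<in> primes"
  shows "loc_iso P (prod_mod L I) I"
proof -
  have FL: "FI L" and LS: "prod_mod L (colon S L) = S" using L by (auto simp: invertible_def)
  have "\<exists>l\<in>L. \<exists>k\<in>colon S L. l * k \<notin> P"
  proof (rule ccontr)
    assume *: "\<not> ?thesis"
    have "w \<in> P" if "w \<in> prod_mod L (colon S L)" for w
      using that
    proof (induction rule: prod_mod_induct)
      case (prod i j) then show ?case using * by blast
    next
      case (sum x y) then show ?case by (rule submodD(2)[OF primesD(2)[OF P]])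
    qed
    then show False using LS R(1) primesD(4)[OF P] by blast
  qed
  then obtain l k where lk: "l \<in> L" "k \<in> colon S L" "l * k \<notin> P" by blast
  obtain n where n: "n \<in> Zn" "n \<in> P" using primesD(6)[OF P] by blast
  obtain m where m: "m \<in> Zn" "m \<in> L" using FID(6)[OF FL] by blast
  obtain a y where a: "a \<in> S" "(l + a * (n * m)) * y = 1" using shift_unit[OF Zn_mult[OF n(1) m(1)]] by blast
  \<comment> \<open>\<open>m \<in> L\<close> keeps \<open>v\<close> in \<open>L\<close>;
    \<open>n \<in> P\<close> keeps \<open>k * v\<close> congruent to \<open>k * l\<close> modulo
    \<open>P\<close>.\<close>
  define v where "v = l + a * (n * m)"
  have v: "v \<in> L" unfolding v_def
    using FID(3)[OF FL lk(1) FID(4)[OF FL a(1) FID(4)[OF FL _ m(2)]]] n(1) Zn_sub by blast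
  have kS: "k * w \<in> S" if "w \<in> L" for w using colonD[OF lk(2) that] .
  have kvP: "k * v \<notin> P"
  proof
    assume "k * v \<in> P"
    have "(a * (k * m)) * n \<in> P" using submodD(3)[OF primesD(2)[OF P] R(4)[OF a(1) kS[OF m(2)]] n(2)] .
    from submod_diff[OF primesD(2)[OF P] subring \<open>k * v \<in> P\<close> this]
    have "l * k \<in> P" by (simp add: v_def algebra_simps)
    then show False using lk(3) by simp
  qed
  have vy: "v * y = 1" using a(2) by (simp add: v_def)
  show ?thesis
  proof (rule loc_isoI[OF vy kS[OF v] kvP])
    fix w assume "w \<in> prod_mod L I"
    then have "k * w \<in> I"
    proof (induction rule: prod_mod_induct)
      case (prod p i)
      have "(k * p) * i \<in> I" using FID(4)[OF I kS[OF prod(1)] prod(2)] .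
      then show ?case by (simp add: mult.assoc)
    next
      case (sum p q) then show ?case using FID(3)[OF I] by (simp add: distrib_left)
    qed
    moreover have "k * v * w * y = k * w * (v * y)" by (simp only: mult_ac)
    ultimately show "k * v * w * y \<in> I" by (simp add: vy)
  next
    fix i assume "i \<in> I"
    from prod_modI[OF v FID(4)[OF I kS[OF v] this]] show "k * v * i * v \<in> prod_mod L I" by (simp add: mult_ac)
  qed
qed

text \<open>Put \<open>L = (I : I')\<close> and \<open>K = (I' : I)\<close>. Then
  \<open>L K \<subseteq> (I' : I') = S\<close>, and a local isomorphism at \<open>P\<close>
  contributes \<open>(s x) (s y) = s^2\<close> outside \<open>P\<close>; so \<open>L K = S\<close>.
  Consequently \<open>I = L K I \<subseteq> L I'\<close>.\<close>

lemma locally_eq_imp_invertible_colon: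
  assumes I: "FI I" and I': "FI I'" and m: "colon I' I' = S" and loc: "\<And>P. P \<in> primes \<Longrightarrow> loc_iso P I I'"
  shows "invertible (colon I I')" "prod_mod (colon I I') I' = I"
proof -
  define L where "L = colon I I'"
  define K where "K = colon I' I"
  define a where "a = prod_mod L K"
  have LK: "FI L" "FI K" unfolding L_def K_def using FI_colon I I' by auto
  have "a \<subseteq> S"
  proof
    fix w assume "w \<in> a"
    then show "w \<in> S" unfolding a_def
    proof (induction rule: prod_mod_induct)
      case (prod l k)
      have "l * k \<in> colon I' I'"
      proof (rule colonI)
        fix i assume "i \<in> I'"
        from colonD[OF prod(2)[unfolded K_def] colonD[OF prod(1)[unfolded L_def] this]]
        show "l * k * i \<in> I'" by (simp add: mult_ac)
      qed
      then show ?case by (simp add: m)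
    next
      case (sum x y) then show ?case by (rule R(6))
    qed
  qed
  moreover have Fa: "FI a" unfolding a_def by (rule FI_prod[OF LK])
  ultimately have a: "idl a" by (simp add: idl_def frac_ideal_def)
  have one: "1 \<in> a"
  proof (rule idl_eq_S_locally[OF a])
    fix P assume P: "P \<in> primes"
    obtain x y s where s: "x * y = 1" "s \<in> S" "s \<notin> P" "\<And>i. i \<in> I \<Longrightarrow> s * i * y \<in> I'" "\<And>j. j \<in> I' \<Longrightarrow> s * j * x \<in> I"
      using loc_isoE[OF loc[OF P]] by metis
    have "s * x \<in> L" unfolding L_def by (rule colonI) (use s(5) in \<open>simp add: mult_ac\<close>)
    moreover have "s * y \<in> K" unfolding K_def by (rule colonI) (use s(4) in \<open>simp add: mult_ac\<close>)
    ultimately have "(s * x) * (s * y) \<in> a" unfolding a_def by (rule prod_modI)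
    moreover have "(s * x) * (s * y) = s * s * (x * y)" by (simp only: mult_ac)
    ultimately have "s * s \<in> a" by (simp add: s(1))
    then show "\<exists>s\<in>a. s \<notin> P" using primesD(5)[OF P s(2,2,3,3)] by blast
  qed
  have aS: "a = S"
  proof
    show "S \<subseteq> a" using FID(4)[OF Fa _ one] by fastforce
  qed fact
  have "prod_mod L (colon S L) = S"
  proof
    show "prod_mod L (colon S L) \<subseteq> S"
    proof
      fix w assume "w \<in> prod_mod L (colon S L)"
      then show "w \<in> S"
      proof (induction rule: prod_mod_induct)
        case (prod i j) then show ?case using colonD[OF prod(2,1)] by (simp add: mult.commute)
      next
        case (sum x y) then show ?case by (rule R(6))
      qed
    qed
    have KS: "K \<subseteq> colon S L"
    proof
      fix k assume k: "k \<in> K"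
      show "k \<in> colon S L"
      proof (rule colonI)
        fix l assume "l \<in> L"
        from prod_modI[OF this k] show "k * l \<in> S" using aS by (simp add: a_def mult.commute)
      qed
    qed
    have "a \<subseteq> prod_mod L (colon S L)"
    proof
      fix w assume "w \<in> a"
      then show "w \<in> prod_mod L (colon S L)" unfolding a_def
      proof (induction rule: prod_mod_induct)
        case (prod i j) then show ?case using prod_modI KS by blast
      next
        case (sum x y) then show ?case by (rule prod_mod_add)
      qed
    qed
    then show "S \<subseteq> prod_mod L (colon S L)" using aS by simp
  qed
  then show "invertible (colon I I')" using LK(1) by (simp add: invertible_def L_def)
  show "prod_mod (colon I I') I' = I"
  proof
    show "prod_mod (colon I I') I' \<subseteq> I"
    proof
      fix w assume "w \<in> prod_mod (colon I I') I'"
      then show "w \<in> I"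
      proof (induction rule: prod_mod_induct)
        case (prod i j) then show ?case by (rule colonD)
      next
        case (sum x y) then show ?case by (rule FID(3)[OF I])
      qed
    qed
    show "I \<subseteq> prod_mod (colon I I') I'"
    proof
      fix i assume i: "i \<in> I"
      have "i * w \<in> prod_mod (colon I I') I'" if "w \<in> prod_mod L K" for w
        using that
      proof (induction rule: prod_mod_induct)
        case (prod l k)
        have "l * (k * i) \<in> prod_mod (colon I I') I'"
          using prod_modI[OF prod(1)[unfolded L_def] colonD[OF prod(2)[unfolded K_def] i]] .
        then show ?case by (simp add: mult_ac)
      next
        case (sum x y) then show ?case using prod_mod_add by (simp add: distrib_left)
      qed
      from this[of 1] one show "i \<in> prod_mod (colon I I') I'" by (simp add: a_def)
    qed
  qed
qed

section \<open>Isomorphism classes and their parametrization\<close>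

definition iso :: "'k set \<Rightarrow> 'k set \<Rightarrow> bool" where
  "iso I J \<longleftrightarrow> (\<exists>x y. x * y = 1 \<and> (\<forall>i\<in>I. x * i \<in> J) \<and> (\<forall>j\<in>J. y * j \<in> I))"

lemma iso_refl: "iso I I"
  unfolding iso_def by (intro exI[of _ 1]) auto

lemma iso_sym: "iso I J \<Longrightarrow> iso J I"
  unfolding iso_def by (metis mult.commute)

lemma iso_trans:
  assumes "iso I J" "iso J L" shows "iso I L"
proof -
  obtain x y where 1: "x * y = 1" "\<forall>i\<in>I. x * i \<in> J" "\<forall>j\<in>J. y * j \<in> I" using assms(1) unfolding iso_def by blast
  obtain u v where 2: "u * v = 1" "\<forall>i\<in>J. u * i \<in> L" "\<forall>j\<in>L. v * j \<in> J" using assms(2) unfolding iso_def by blast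
  have "(u * x) * (y * v) = 1" using 1(1) 2(1) by (metis mult.assoc mult.left_commute mult_1_right)
  moreover have "\<forall>i\<in>I. (u * x) * i \<in> L" using 1(2) 2(2) by (simp add: mult.assoc)
  moreover have "\<forall>j\<in>L. (y * v) * j \<in> I" using 1(3) 2(3) by (simp add: mult.assoc)
  ultimately show ?thesis unfolding iso_def by blast
qed

lemma iso_imp_loc_iso:
  assumes "P \<in> primes" "iso I J" shows "loc_iso P J I"
proof -
  obtain x y where 1: "x * y = 1" "\<forall>i\<in>I. x * i \<in> J" "\<forall>j\<in>J. y * j \<in> I" using assms(2) unfolding iso_def by blast
  show ?thesis
    by (rule loc_isoI[OF 1(1) R(1) primesD(4)[OF assms(1)]]) (use 1(2,3) in \<open>simp_all add: mult.commute\<close>)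
qed

lemma iso_prod:
  assumes "iso L L'" shows "iso (prod_mod L I) (prod_mod L' I)"
proof -
  have *: "z * w \<in> prod_mod M' I" if "w \<in> prod_mod M I" "\<forall>l\<in>M. z * l \<in> M'" for z w M M'
    using that(1)
  proof (induction rule: prod_mod_induct)
    case (prod i j)
    then have "z * i * j \<in> prod_mod M' I" using that(2) by (intro prod_modI) auto
    then show ?case by (simp add: mult.assoc)
  next
    case (sum x y) then show ?case using prod_mod_add by (simp add: distrib_left)
  qed
  from assms show ?thesis unfolding iso_def using * by meson
qed

text \<open>If \<open>x L I \<subseteq> L' I\<close>, then \<open>(S : L') x L\<close> maps
  \<open>I\<close> into itself, hence lies in \<open>(I : I) = S\<close>. Multiplying by
  \<open>L'\<close> gives \<open>x L \<subseteq> L'\<close>.\<close>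

lemma iso_prod_cancel:
  assumes L: "invertible L" "invertible L'" and FI: "FI I" and I: "colon I I = S"
    and iso: "iso (prod_mod L I) (prod_mod L' I)"
  shows "iso L L'"
proof -
  obtain x y where 1: "x * y = 1" "\<forall>w\<in>prod_mod L I. x * w \<in> prod_mod L' I" "\<forall>w\<in>prod_mod L' I. y * w \<in> prod_mod L I"
    using iso unfolding iso_def by blast
  have *: "x * l \<in> M'" if inv: "invertible M'" and mul: "\<forall>w\<in>prod_mod M I. x * w \<in> prod_mod M' I" and l: "l \<in> M"
    for x l M M'
  proof -
    have F: "FI M'" using inv by (simp add: invertible_def)
    have kw: "k * w \<in> I" if k: "k \<in> colon S M'" and w: "w \<in> prod_mod M' I" for k w
      using w
    proof (induction rule: prod_mod_induct)
      case (prod i j)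
      have "(k * i) * j \<in> I" using colonD[OF k prod(1)] colonD[OF _ prod(2), of "k * i" I] I by simp
      then show ?case by (simp add: mult.assoc)
    next
      case (sum p q)
      have "k * p + k * q \<in> I" using FID(3)[OF FI] sum by blast
      then show ?case by (simp add: distrib_left)
    qed
    have kS: "k * (x * l) \<in> S" if k: "k \<in> colon S M'" for k
    proof -
      have "k * (x * l) \<in> colon I I"
      proof (rule colonI)
        fix i assume "i \<in> I"
        then have "x * (l * i) \<in> prod_mod M' I" using mul prod_modI[OF l] by blast
        from kw[OF k this] show "k * (x * l) * i \<in> I" by (simp add: mult.assoc)
      qed
      then show ?thesis by (simp add: I)
    qed
    have "x * l * w \<in> M'" if "w \<in> prod_mod M' (colon S M')" for w
      using that
    proof (induction rule: prod_mod_induct)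
      case (prod p k)
      have "(k * (x * l)) * p \<in> M'" using FID(4)[OF F kS[OF prod(2)] prod(1)] .
      then show ?case by (simp add: mult_ac)
    next
      case (sum p q) then show ?case using FID(3)[OF F] by (simp add: distrib_left)
    qed
    moreover have "1 \<in> prod_mod M' (colon S M')" using inv R(1) by (simp add: invertible_def)
    ultimately show ?thesis by force
  qed
  show ?thesis unfolding iso_def
    using 1(1) *[OF L(2) 1(2)] *[OF L(1) 1(3)] by blast
qed

definition iclasses :: "'k set set \<Rightarrow> 'k set set set" where
  "iclasses F = F // {(I, J). I \<in> F \<and> J \<in> F \<and> iso I J}"

lemma equiv_iso: "equiv F {(I, J). I \<in> F \<and> J \<in> F \<and> iso I J}"
  by (rule equivI) (auto simp: refl_on_def sym_def trans_def intro: iso_refl iso_sym iso_trans)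

text \<open>The bijection sends \<open>(A, [L])\<close> to the class of \<open>L W(A)\<close>, where
  \<open>W(A)\<close> is a fixed ideal that is locally \<open>D\<close> on \<open>A\<close> and
  locally \<open>S\<close> elsewhere. \<open>A\<close> is recovered as the locus where a class looks
  like \<open>D\<close>, and \<open>[L]\<close> by cancellation. Every \<open>I\<close> is locally
  isomorphic to the \<open>W(A)\<close> of its own locus, so it is an invertible multiple of
  it.\<close>

theorem ideal_classes_eqpoll:
  assumes loc: "\<And>P I. P \<in> primes \<Longrightarrow> FI I \<Longrightarrow> colon I I = S \<Longrightarrow> loc_iso P I S \<or> loc_iso P I D"
  shows "iclasses {I. FI I \<and> colon I I = S} \<approx> Pow T \<times> iclasses {L. invertible L}"
proof -
  define F where "F = {I. FI I \<and> colon I I = S}"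
  define G where "G = {L. invertible L}"
  define rF where "rF = {(I, J). I \<in> F \<and> J \<in> F \<and> iso I J}"
  define rG where "rG = {(I, J). I \<in> G \<and> J \<in> G \<and> iso I J}"
  have eF: "equiv F rF" and eG: "equiv G rG" unfolding rF_def rG_def by (rule equiv_iso)+
  have "\<forall>A. \<exists>I. A \<subseteq> T \<longrightarrow> FI I \<and> (\<forall>P\<in>primes. loc_iso P I (if P \<in> A then D else S))"
    using finite_T_and_prescribed_ideal(2) by blast
  from choice[OF this] obtain W where
    W: "\<And>A. A \<subseteq> T \<Longrightarrow> FI (W A)" "\<And>A P. A \<subseteq> T \<Longrightarrow> P \<in> primes \<Longrightarrow> loc_iso P (W A) (if P \<in> A then D else S)" by blast
  have WF: "colon (W A) (W A) = S" if "A \<subseteq> T" for A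
  proof (rule colon_self_local[OF W(1)[OF that]])
    fix P assume "P \<in> primes"
    from W(2)[OF that this] show "loc_iso P (W A) S \<or> loc_iso P (W A) D" by (cases "P \<in> A") simp_all
  qed
  \<comment> \<open>At primes of \<open>T\<close> the two local shapes exclude each other; this
    makes the locus an invariant of the class.\<close>
  have not_bothT: "\<not> loc_iso P I S \<or> \<not> loc_iso P I D" if "P \<in> T" for P I
    using that loc_iso_trans[of P D I S] loc_iso_sym[of P I D] unfolding T_def by blast
  have DS: "loc_iso P D S" if "P \<in> primes" "P \<notin> T" for P using that unfolding T_def by blast
  have prodW: "loc_iso P (prod_mod L (W A)) (if P \<in> A then D else S)" if A: "A \<subseteq> T" and L: "L \<in> G" and P: "P \<in> primes" for A L P
    by (rule loc_iso_trans[OF P invertible_prod_loc_iso[OF _ W(1)[OF A] P] W(2)[OF A P]]) (use L in \<open>simp add: G_def\<close>)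
  have prodF: "prod_mod L (W A) \<in> F" if A: "A \<subseteq> T" and L: "L \<in> G" for A L
  proof -
    have "FI (prod_mod L (W A))" using FI_prod[OF _ W(1)[OF A]] L by (simp add: G_def invertible_def)
    moreover from this have "colon (prod_mod L (W A)) (prod_mod L (W A)) = S"
    proof (rule colon_self_local)
      fix P assume "P \<in> primes"
      from prodW[OF A L this] show "loc_iso P (prod_mod L (W A)) S \<or> loc_iso P (prod_mod L (W A)) D"
        by (cases "P \<in> A") simp_all
    qed
    ultimately show ?thesis by (simp add: F_def)
  qed
  have locus: "A = {P \<in> T. loc_iso P I D}" if A: "A \<subseteq> T" and I: "\<And>P. P \<in> primes \<Longrightarrow> loc_iso P I (if P \<in> A then D else S)" for A I
  proof (intro equalityI subsetI)
    fix P assume P: "P \<in> A"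
    then have "P \<in> primes" using A unfolding T_def by blast
    from I[OF this] show "P \<in> {P \<in> T. loc_iso P I D}" using P A by auto
  next
    fix P assume P: "P \<in> {P \<in> T. loc_iso P I D}"
    show "P \<in> A"
    proof (rule ccontr)
      assume "P \<notin> A"
      then show False using I[of P] not_bothT[of P I] P unfolding T_def by auto
    qed
  qed
  define rep where "rep c = (SOME L. L \<in> c)" for c :: "'k set set"
  have rep: "rep c \<in> c" "rep c \<in> G" if "c \<in> G // rG" for c
  proof -
    show "rep c \<in> c" unfolding rep_def using in_quotient_imp_non_empty[OF eG that] by (simp add: some_in_eq)
    then show "rep c \<in> G" using in_quotient_imp_subset[OF eG that] by blast
  qed
  have rep_iso: "iso L (rep (rG `` {L}))" if "L \<in> G" for L
  proof -
    have "rep (rG `` {L}) \<in> rG `` {L}" by (rule rep(1)) (use that in \<open>rule quotientI\<close>)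
    then have "(L, rep (rG `` {L})) \<in> rG" by (rule Image_singleton_iff[THEN iffD1])
    moreover have "iso a b" if "(a, b) \<in> rG" for a b using that by (simp add: rG_def)
    ultimately show ?thesis by blast
  qed
  define \<Phi> where "\<Phi> = (\<lambda>(A, c). rF `` {prod_mod (rep c) (W A)})"
  have clsF: "iso I J" if "I \<in> F" "J \<in> F" "rF `` {I} = rF `` {J}" for I J
    using eq_equiv_class[OF that(3) eF that(2)] by (simp add: rF_def)
  have "bij_betw \<Phi> (Pow T \<times> (G // rG)) (F // rF)"
    unfolding bij_betw_def
  proof
    show "inj_on \<Phi> (Pow T \<times> (G // rG))"
    proof (rule inj_onI, clarsimp)
      fix A B c c' assume A: "A \<subseteq> T" "c \<in> G // rG" and B: "B \<subseteq> T" "c' \<in> G // rG" and eq: "\<Phi> (A, c) = \<Phi> (B, c')"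
      define I where "I = prod_mod (rep c) (W A)"
      define J where "J = prod_mod (rep c') (W B)"
      have F: "I \<in> F" "J \<in> F" unfolding I_def J_def using prodF A B rep(2) by auto
      have i: "iso I J" using clsF[OF F] eq by (simp add: \<Phi>_def I_def J_def)
      have loc: "loc_iso P I J" if "P \<in> primes" for P using loc_iso_sym[OF iso_imp_loc_iso[OF that i]] .
      have IA: "loc_iso P I (if P \<in> A then D else S)" if "P \<in> primes" for P
        unfolding I_def using prodW[OF A(1) rep(2)[OF A(2)] that] .
      have IB: "loc_iso P I (if P \<in> B then D else S)" if "P \<in> primes" for P
        using loc_iso_trans[OF that loc[OF that] prodW[OF B(1) rep(2)[OF B(2)] that, folded J_def]] .
      have AB: "A = B" using locus[OF A(1) IA] locus[OF B(1) IB] by simp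
      have "iso (rep c) (rep c')"
        using iso_prod_cancel[OF _ _ W(1)[OF A(1)] WF[OF A(1)]] i rep(2)[OF A(2)] rep(2)[OF B(2)]
        unfolding I_def J_def AB by (simp add: G_def)
      then have "(rep c, rep c') \<in> rG" using rep(2)[OF A(2)] rep(2)[OF B(2)] by (simp add: rG_def)
      then have "c = c'" using quotient_eqI[OF eG A(2) B(2) rep(1)[OF A(2)] rep(1)[OF B(2)]] by blast
      then show "A = B \<and> c = c'" using AB by simp
    qed
    show "\<Phi> ` (Pow T \<times> (G // rG)) = F // rF"
    proof
      show "\<Phi> ` (Pow T \<times> (G // rG)) \<subseteq> F // rF"
        using prodF rep(2) by (auto simp: \<Phi>_def intro!: quotientI)
      show "F // rF \<subseteq> \<Phi> ` (Pow T \<times> (G // rG))"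
      proof
        fix c assume "c \<in> F // rF"
        then obtain I where I: "I \<in> F" "c = rF `` {I}" by (auto elim: quotientE)
        have FI: "FI I" "colon I I = S" using I(1) by (auto simp: F_def)
        define A where "A = {P \<in> T. loc_iso P I D}"
        have A: "A \<subseteq> T" by (auto simp: A_def)
        have IA: "loc_iso P I (if P \<in> A then D else S)" if P: "P \<in> primes" for P
        proof (cases "P \<in> A")
          case True then show ?thesis by (simp add: A_def)
        next
          case False
          then show ?thesis
            using loc[OF P FI] DS[OF P] loc_iso_trans[OF P, of I D S] by (auto simp: A_def)
        qed
        have IW: "loc_iso P I (W A)" if P: "P \<in> primes" for P
          using loc_iso_trans[OF P IA[OF P] loc_iso_sym[OF W(2)[OF A P]]] .
        note L = locally_eq_imp_invertible_colon[OF FI(1) W(1)[OF A] WF[OF A] IW]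
        define L where "L = colon I (W A)"
        have LG: "L \<in> G" using L(1) by (simp add: G_def L_def)
        have q: "rG `` {L} \<in> G // rG" using LG by (rule quotientI)
        have "iso I (prod_mod (rep (rG `` {L})) (W A))"
          using iso_prod[OF rep_iso[OF LG], of "W A"] L(2) by (simp add: L_def)
        then have "(I, prod_mod (rep (rG `` {L})) (W A)) \<in> rF"
          using I(1) prodF[OF A rep(2)[OF q]] by (simp add: rF_def)
        then have "c = \<Phi> (A, rG `` {L})" unfolding I(2) \<Phi>_def by (simp add: equiv_class_eq[OF eF])
        then show "c \<in> \<Phi> ` (Pow T \<times> (G // rG))" using A q by blast
      qed
    qed
  qed
  then have "Pow T \<times> (G // rG) \<approx> F // rF" by (auto simp: eqpoll_def)
  then show ?thesis unfolding iclasses_def F_def[symmetric] G_def[symmetric] rF_def[symmetric] rG_def[symmetric]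
    by (rule eqpoll_sym)
qed

end

section \<open>Subrings and ideals as HOL-Algebra structures\<close>

lemma ring_on_simps [simp]:
  "carrier (ring_on S) = S" "monoid.mult (ring_on S) = (*)" "one (ring_on S) = 1"
  "ring.zero (ring_on S) = 0" "add (ring_on S) = (+)"
  by (simp_all add: ring_on_def ring_of_type_algebra_def)

lemma ring_on_UNIV: "ring_on UNIV = ring_of_type_algebra"
  by (simp add: ring_on_def ring_of_type_algebra_def)

lemma cring_ring_on:
  assumes "is_subring S" shows "cring (ring_on S)"
proof (rule cringI)
  note S = subringD[OF assms]
  show "abelian_group (ring_on S)"
    by (rule abelian_groupI) (use S in \<open>auto simp: add_ac intro: bexI[of _ "- _"]\<close>)
  show "comm_monoid (ring_on S)"
    by (rule comm_monoidI) (use S in \<open>auto simp: mult_ac\<close>)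
qed (simp add: distrib_right)

lemma a_inv_ring_on:
  assumes "is_subring S" "x \<in> S" shows "a_inv (ring_on S) x = - x"
proof -
  interpret cring "ring_on S" by (rule cring_ring_on[OF assms(1)])
  show ?thesis by (rule minus_equality) (use assms subringD(5)[OF assms(1)] in auto)
qed

lemma is_subring_UNIV: "is_subring UNIV"
  by (simp add: is_subring_def)

lemma subring_imp_is_subring:
  assumes "subring S (ring_of_type_algebra :: 'k::comm_ring_1 ring)" shows "is_subring S"
proof -
  have "a_inv ring_of_type_algebra y = - y" for y :: 'k
    using a_inv_ring_on[OF is_subring_UNIV, of y] by (simp add: ring_on_UNIV)
  then have "1 \<in> S" "- y \<in> S" "x * y \<in> S" "x + y \<in> S" if "x \<in> S" "y \<in> S" for x y
    using subringE(3)[OF assms] subringE(5)[OF assms that(2)] subringE(6,7)[OF assms that]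
    by (simp_all add: ring_of_type_algebra_def)
  moreover have "S \<noteq> {}" using subringE(4)[OF assms] .
  ultimately show ?thesis unfolding is_subring_def by (metis all_not_in_conv diff_conv_add_uminus)
qed

lemma ideal_ring_on_iff:
  assumes S: "is_subring S"
  shows "ideal I (ring_on S) \<longleftrightarrow> submod S I \<and> I \<subseteq> S"
proof
  assume "ideal I (ring_on S)"
  then interpret ideal I "ring_on S" .
  show "submod S I \<and> I \<subseteq> S"
    using additive_subgroup.zero_closed[OF is_additive_subgroup]
      additive_subgroup.a_closed[OF is_additive_subgroup] I_l_closed a_subset by (auto simp: submod_def)
next
  assume I: "submod S I \<and> I \<subseteq> S"
  then have s: "submod S I" by simp
  show "ideal I (ring_on S)"
  proof (rule idealI)
    show "ring (ring_on S)" using cring_ring_on[OF S] by (simp add: cring_def)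
    show "subgroup I (add_monoid (ring_on S))"
    proof (rule subgroup.intro)
      fix x assume "x \<in> I"
      then have "m_inv (add_monoid (ring_on S)) x = - x" using a_inv_ring_on[OF S] I unfolding a_inv_def by blast
      then show "m_inv (add_monoid (ring_on S)) x \<in> I" using submod_neg[OF s S \<open>x \<in> I\<close>] by simp
    qed (use I submodD[OF s] in auto)
    show "x \<otimes>\<^bsub>ring_on S\<^esub> a \<in> I" "a \<otimes>\<^bsub>ring_on S\<^esub> x \<in> I" if "a \<in> I" "x \<in> carrier (ring_on S)" for a x
      using submodD(3)[OF s, of x a] that by (simp_all add: mult.commute)
  qed
qed

lemma primeideal_ring_on_iff:
  assumes S: "is_subring S"
  shows "primeideal P (ring_on S) \<longleftrightarrow> prime_in S P"
proof
  assume "primeideal P (ring_on S)"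
  then interpret primeideal P "ring_on S" .
  have i: "submod S P" "P \<subseteq> S" using ideal_ring_on_iff[OF S] is_ideal by auto
  have "1 \<notin> P"
  proof
    assume "1 \<in> P"
    then have "x \<in> P" if "x \<in> S" for x using submodD(3)[OF i(1) that, of 1] by simp
    then show False using I_notcarr i(2) by auto
  qed
  then show "prime_in S P" using i I_prime by (auto simp: prime_in_def)
next
  assume P: "prime_in S P"
  show "primeideal P (ring_on S)"
    by (rule primeidealI)
      (use P S subringD(1)[OF S] in \<open>auto simp: ideal_ring_on_iff prime_in_def cring_ring_on\<close>)
qed

section \<open>Dedekind domains in their fraction field\<close>

text \<open>Ideals of the image are pulled back along \<open>\<iota>\<close> to ideals of the type
  \<open>'z\<close>, where the algebraic hypotheses apply; a relation
  \<open>x ^ n = (\<Sum>i<n. z i * x ^ i)\<close> is turned into a monic polynomial.\<close>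

lemma dedekind_subring_range:
  assumes frac: "fraction_field (\<iota> :: 'z::idom \<Rightarrow> 'q::field)" and ded: "dedekind_domain \<iota>"
  shows "dedekind_subring (range \<iota>)"
proof -
  interpret i: comm_ring_hom \<iota> using frac by (simp add: fraction_field_def)
  have inj: "inj \<iota>" using frac by (simp add: fraction_field_def)
  note U = is_subring_UNIV
  let ?R = "range \<iota>"
  have sr: "is_subring ?R" unfolding is_subring_def
    by (auto simp flip: i.hom_one i.hom_minus i.hom_mult)
  have idl: "ideal J (ring_of_type_algebra :: 'z ring) \<longleftrightarrow> submod UNIV J" for J
    using ideal_ring_on_iff[OF U, of J] by (simp add: ring_on_UNIV)
  have vimage: "submod UNIV (\<iota> -` I)" if "submod ?R I" for I
    using submodD[OF that] by (auto simp: submod_def i.hom_add i.hom_mult)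
  show ?thesis
  proof
    show "is_subring ?R" by (rule sr)
    show "noeth_module ?R ?R" unfolding noeth_module_def
    proof (intro allI impI)
      fix I assume I: "I \<subseteq> ?R" "submod ?R I"
      interpret N: noetherian_domain "ring_of_type_algebra :: 'z ring"
        using ded by (simp add: dedekind_domain_def)
      have "ideal (\<iota> -` I) (ring_of_type_algebra :: 'z ring)" using vimage[OF I(2)] idl by simp
      from N.finetely_gen[OF this] obtain A where A: "finite A" "\<iota> -` I = genideal ring_of_type_algebra A" by blast
      have AI: "\<iota> ` A \<subseteq> I"
        using N.genideal_self[of A] A(2) by (auto simp: ring_of_type_algebra_def)
      have "genideal ring_of_type_algebra A \<subseteq> \<iota> -` lin_span ?R (\<iota> ` A)"
        by (rule N.genideal_minimal) (use vimage[OF submod_lin_span[OF sr]] idl lin_span_base[OF sr] A(1) in auto)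
      then have "I \<subseteq> lin_span ?R (\<iota> ` A)" using A(2) I(1) by blast
      then have "I = lin_span ?R (\<iota> ` A)" using lin_span_least[OF I(2) AI] by blast
      then show "fg_submodule ?R I" using A(1) by (auto simp: fg_submodule_alt)
    qed
  next
    fix P x assume P: "prime_in ?R P" "P \<noteq> {0}" and x: "x \<in> ?R" "x \<notin> P"
    note Pm = prime_inD[OF P(1)]
    define p where "p = \<iota> -` P"
    have sp: "submod UNIV p" unfolding p_def by (rule vimage[OF Pm(1)])
    have "prime_in UNIV p" unfolding prime_in_def
      using sp Pm(3) Pm(4) by (auto simp: p_def i.hom_mult)
    then have "primeideal p (ring_of_type_algebra :: 'z ring)"
      using primeideal_ring_on_iff[OF U, of p] by (simp add: ring_on_UNIV)
    moreover have "p \<noteq> {0}"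
    proof
      assume "p = {0}"
      have "y = 0" if y: "y \<in> P" for y
      proof -
        obtain w where "y = \<iota> w" using y Pm(2) by blast
        moreover from this have "w \<in> p" using y by (simp add: p_def)
        ultimately show ?thesis using \<open>p = {0}\<close> by simp
      qed
      then show False using P(2) submodD(1)[OF Pm(1)] by blast
    qed
    ultimately have "maximalideal p (ring_of_type_algebra :: 'z ring)" using ded by (simp add: dedekind_domain_def)
    then interpret M: maximalideal p "ring_of_type_algebra :: 'z ring" .
    obtain z where z: "x = \<iota> z" using x(1) by blast
    have "ideal (adjoin UNIV p z) (ring_of_type_algebra :: 'z ring)"
      using submod_adjoin(1)[OF U sp] idl by simp
    from M.I_maximal[OF this submod_adjoin(2)[OF U sp]] have "adjoin UNIV p z = p \<or> adjoin UNIV p z = UNIV"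
      by (simp add: ring_of_type_algebra_def)
    moreover have "z \<notin> p" using x z by (simp add: p_def)
    ultimately have "1 \<in> adjoin UNIV p z" using submod_adjoin(3)[OF U sp, of z] by auto
    then obtain y r where "y \<in> p" "1 = y + r * z" unfolding adjoin_def by blast
    then have "1 - \<iota> r * x \<in> P"
      by (metis (no_types, lifting) p_def vimage_eq add_diff_cancel_right' i.hom_minus i.hom_mult i.hom_one z)
    then show "\<exists>y\<in>?R. 1 - y * x \<in> P" by blast
  next
    fix z x n assume z: "\<And>i. z i \<in> ?R" and x: "x ^ n = (\<Sum>i<n. z i * x ^ i)"
    have "\<forall>i. \<exists>w. z i = \<iota> w"
    proof
      fix i from z[of i] show "\<exists>w. z i = \<iota> w" by blast
    qed
    from choice[OF this] obtain w where w: "\<And>i. z i = \<iota> (w i)" by blast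
    define q where "q = (\<Sum>i<n. monom (w i) i)"
    define p where "p = monom 1 n - q"
    have cq: "coeff q i = (if i < n then w i else 0)" for i
      unfolding q_def by (simp add: coeff_sum)
    have "degree p = n"
    proof (rule antisym)
      show "degree p \<le> n" by (rule degree_le) (auto simp: p_def cq)
      show "n \<le> degree p" by (rule le_degree) (simp add: p_def cq)
    qed
    then have "lead_coeff p = 1" by (simp add: p_def cq)
    moreover have "poly (map_poly \<iota> p) x = 0"
    proof -
      have "poly (map_poly \<iota> p) x = (\<Sum>i\<le>n. coeff (map_poly \<iota> p) i * x ^ i)"
        using \<open>degree p = n\<close> map_poly_degree_leq[of \<iota> p] unfolding poly_altdef
        by (intro sum.mono_neutral_left) (auto simp: coeff_eq_0)
      also have "\<dots> = (\<Sum>i<n. coeff (map_poly \<iota> p) i * x ^ i) + coeff (map_poly \<iota> p) n * x ^ n"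
        by (simp add: lessThan_Suc_atMost[symmetric])
      also have "\<dots> = (\<Sum>i<n. - (z i * x ^ i)) + x ^ n"
        by (simp add: coeff_map_poly p_def cq w i.hom_uminus)
      finally show ?thesis using x by (simp add: sum_negf)
    qed
    ultimately show "x \<in> ?R" using ded by (auto simp: dedekind_domain_def)
  qed
qed

text \<open>Such an element shows that Z is strictly smaller than Q, and its powers supply
  infinitely many candidates for the shift to a unit of \<open>K\<close>.\<close>

lemma dedekind_nonunit:
  assumes "dedekind_domain (\<iota> :: 'z::idom \<Rightarrow> 'q::field)"
  obtains z where "z \<noteq> (0 :: 'z)" "\<And>w. z * w \<noteq> 1"
proof -
  interpret cring "ring_of_type_algebra :: 'z ring" by (rule cring_from_type_algebra)
  have "\<not> (\<forall>z::'z. z \<noteq> 0 \<longrightarrow> (\<exists>w. z * w = 1))"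
  proof
    assume "\<forall>z::'z. z \<noteq> 0 \<longrightarrow> (\<exists>w. z * w = 1)"
    then have "Ring.field (ring_of_type_algebra :: 'z ring)"
      by (intro cring_fieldI2) (auto simp: ring_of_type_algebra_def)
    then show False using assms by (simp add: dedekind_domain_def)
  qed
  then show ?thesis using that by blast
qed

section \<open>Etale algebras\<close>

text \<open>Everything later used of the decomposition into fields: componentwise computation, the
  fact that an element with no zero component is a unit, and a spanning list of separable elements.
  The latter are supported on one component each, with values in a spanning set of that
  factor.\<close>

lemma (in q_algebra) etale_structure:
  assumes "etale_algebra \<phi>"
  obtains n :: nat and \<theta> :: "'k \<Rightarrow> nat \<Rightarrow> 'q alg_closure"
  where "\<And>i x y. i < n \<Longrightarrow> \<theta> (x + y) i = \<theta> x i + \<theta> y i" "\<And>i x y. i < n \<Longrightarrow> \<theta> (x * y) i = \<theta> x i * \<theta> y i"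
    "\<And>i q. i < n \<Longrightarrow> \<theta> (\<phi> q) i = to_ac q" "\<And>x. (\<And>i. i < n \<Longrightarrow> \<theta> x i \<noteq> 0) \<Longrightarrow> \<exists>y. x * y = 1"
    "\<exists>gs. (\<forall>g\<in>set gs. separable_elt g) \<and> vs.span (set gs) = UNIV"
proof -
  obtain n L and \<theta> :: "'k \<Rightarrow> nat \<Rightarrow> 'q alg_closure" where
    L: "\<And>i. i < n \<Longrightarrow> finite_separable_extension (L i)" and bij: "bij_betw \<theta> UNIV (PiE {..<n} L)"
    and add: "\<And>i x y. i < n \<Longrightarrow> \<theta> (x + y) i = \<theta> x i + \<theta> y i"
    and mul: "\<And>i x y. i < n \<Longrightarrow> \<theta> (x * y) i = \<theta> x i * \<theta> y i"
    and sc: "\<And>i q. i < n \<Longrightarrow> \<theta> (\<phi> q) i = to_ac q"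
    using assms unfolding etale_algebra_def by blast
  interpret ac: vector_space "\<lambda>q (x :: 'q alg_closure). to_ac q * x"
    by unfold_locales (simp_all add: algebra_simps)
  have one: "\<theta> 1 i = 1" if "i < n" for i using sc[OF that, of 1] by simp
  have zero: "\<theta> 0 i = 0" if "i < n" for i using sc[OF that, of 0] by simp
  have sum: "\<theta> (sum f A) i = (\<Sum>a\<in>A. \<theta> (f a) i)" if "i < n" for f and A :: "nat set" and i
    by (induction A rule: infinite_finite_induct) (simp_all add: zero add that)
  have sum': "\<theta> (sum f A) i = (\<Sum>a\<in>A. \<theta> (f a) i)" if "i < n" for f and A :: "'q alg_closure set" and i
    by (induction A rule: infinite_finite_induct) (simp_all add: zero add that)
  have mem: "\<theta> x \<in> PiE {..<n} L" for x using bij by (auto simp: bij_betw_def)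
  have eqI: "x = y" if "\<And>i. i < n \<Longrightarrow> \<theta> x i = \<theta> y i" for x y
  proof -
    have "\<theta> x = \<theta> y" by (rule PiE_ext[OF mem mem]) (use that in auto)
    then show ?thesis using bij by (auto simp: bij_betw_def inj_on_def)
  qed
  have lift: "\<exists>x. \<forall>i<n. \<theta> x i = f i" if "\<And>i. i < n \<Longrightarrow> f i \<in> L i" for f
  proof -
    have "restrict f {..<n} \<in> PiE {..<n} L" using that by auto
    then have "restrict f {..<n} \<in> range \<theta>" using bij by (simp add: bij_betw_def)
    then obtain x where "restrict f {..<n} = \<theta> x" by blast
    then show ?thesis by (metis lessThan_iff restrict_apply')
  qed
  have sf: "subfield (L i) (ring_of_type_algebra :: 'q alg_closure ring)" if "i < n" for i
    using L[OF that] by (simp add: finite_separable_extension_def)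
  have L0: "0 \<in> L i" if "i < n" for i
    using subringE(2)[OF subfieldE(1)[OF sf[OF that]]] by (simp add: ring_of_type_algebra_def)
  have Linv: "\<exists>w\<in>L i. v * w = 1" if "i < n" "v \<in> L i" "v \<noteq> 0" for i v
  proof -
    interpret F: ring "ring_of_type_algebra :: 'q alg_closure ring" by (rule ring_from_type_algebra)
    have "v \<in> L i - {\<zero>\<^bsub>ring_of_type_algebra\<^esub>}" using that by (simp add: ring_of_type_algebra_def)
    from F.subfield_m_inv(1,2)[OF sf[OF that(1)] this] show ?thesis
      by (intro bexI[of _ "inv\<^bsub>ring_of_type_algebra\<^esub> v"]) (auto simp: ring_of_type_algebra_def)
  qed
  have unit: "\<exists>y. x * y = 1" if x: "\<And>i. i < n \<Longrightarrow> \<theta> x i \<noteq> 0" for x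
  proof -
    have "\<forall>i. \<exists>w. i < n \<longrightarrow> w \<in> L i \<and> \<theta> x i * w = 1" using Linv[OF _ _ x] mem[of x] by (meson PiE_mem lessThan_iff)
    from choice[OF this] obtain w where w: "\<And>i. i < n \<Longrightarrow> w i \<in> L i \<and> \<theta> x i * w i = 1" by blast
    then obtain y where "\<forall>i<n. \<theta> y i = w i" using lift[of w] by blast
    then have "x * y = 1" by (intro eqI) (simp add: mul one w)
    then show ?thesis by blast
  qed
  have fg: "\<exists>B. finite B \<and> L i = ac.span B" if "i < n" for i
    using L[OF that] unfolding finite_separable_extension_def by (elim conjE)
  have "\<forall>i. \<exists>B. i < n \<longrightarrow> finite B \<and> L i = ac.span B"
  proof
    fix i show "\<exists>B. i < n \<longrightarrow> finite B \<and> L i = ac.span B"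
      by (cases "i < n") (use fg[of i] in auto)
  qed
  from choice[OF this] obtain B where B: "\<And>i. i < n \<Longrightarrow> finite (B i) \<and> L i = ac.span (B i)" by blast
  \<comment> \<open>\<open>c i v\<close> is the element of \<open>K\<close> with component
    \<open>v\<close> at \<open>i\<close> and 0 elsewhere.\<close>
  define c where "c i v = (SOME x. \<forall>j<n. \<theta> x j = (if j = i then v else 0))" for i v
  have c: "\<theta> (c i v) j = (if j = i then v else 0)" if iv: "i < n" "v \<in> L i" "j < n" for i v j
  proof -
    have "\<exists>x. \<forall>j<n. \<theta> x j = (if j = i then v else 0)" by (rule lift) (use iv L0 in auto)
    from someI_ex[OF this] show ?thesis using iv(3) unfolding c_def by blast
  qed
  have poly: "\<theta> (poly (map_poly \<phi> f) b) i = poly (map_poly to_ac f) (\<theta> b i)" if "i < n" for f b i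
    by (induction f) (simp_all add: zero[OF that] map_poly_pCons add[OF that] mul[OF that] sc[OF that])
  text \<open>An element supported on one component is annihilated by \<open>f\<close> or \<open>X f\<close>, where \<open>f\<close> is the
    minimal polynomial of that component.\<close>
  have sep: "separable_elt (c i v)" if iv: "i < n" "v \<in> L i" for i v
  proof -
    have "\<forall>x\<in>L i. \<exists>f. irreducible f \<and> poly (map_poly to_ac f) x = 0 \<and> rsquarefree (map_poly to_ac f)"
      using L[OF iv(1)] unfolding finite_separable_extension_def by (elim conjE)
    from bspec[OF this iv(2)] obtain f where
      f: "poly (map_poly to_ac f) v = 0" "rsquarefree (map_poly to_ac f)" by (elim exE conjE)
    have ann: "poly (map_poly \<phi> g) (c i v) = 0" if "poly (map_poly to_ac g) v = 0" "poly (map_poly to_ac g) 0 = 0" for g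
      by (rule eqI) (use that in \<open>auto simp: poly c[OF iv] zero\<close>)
    show ?thesis
    proof (cases "poly (map_poly to_ac f) 0 = 0")
      case True
      then show ?thesis using ann[OF f(1)] f(2) by (auto simp: separable_elt_def)
    next
      case False
      have e: "map_poly to_ac (pCons 0 f) = [:- 0, 1:] * map_poly to_ac f" by (simp add: map_poly_pCons)
      have nz: "map_poly to_ac f \<noteq> 0" using f(2) by (simp add: rsquarefree_def)
      have "rsquarefree (map_poly to_ac (pCons 0 f))" unfolding rsquarefree_def
      proof (intro conjI allI)
        show n0: "map_poly to_ac (pCons 0 f) \<noteq> 0" using nz by (simp add: map_poly_pCons)
        fix a
        have o: "order a (map_poly to_ac (pCons 0 f)) = order a [:- 0, 1:] + order a (map_poly to_ac f)"
          unfolding e by (rule order_mult) (use n0 e in simp)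
        show "order a (map_poly to_ac (pCons 0 f)) = 0 \<or> order a (map_poly to_ac (pCons 0 f)) = 1"
        proof (cases "a = 0")
          case True
          then have "order a (map_poly to_ac f) = 0" using False by (simp add: order_0I)
          moreover have "order a [:- 0, 1 :: 'q alg_closure:] \<le> 1" using order_degree[of "[:- 0, 1:]" a] by simp
          ultimately show ?thesis using o by linarith
        next
          case False
          then have "order a [:- 0, 1:] = 0" by (intro order_0I) simp
          then show ?thesis using o f(2) by (simp add: rsquarefree_def)
        qed
      qed
      moreover have "poly (map_poly \<phi> (pCons 0 f)) (c i v) = 0"
        by (rule ann) (use f(1) in \<open>simp_all add: map_poly_pCons\<close>)
      ultimately show ?thesis by (auto simp: separable_elt_def)
    qed
  qed
  define G where "G = (\<Union>i<n. c i ` B i)"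
  have BL: "v \<in> L i" if "i < n" "v \<in> B i" for i v using B[OF that(1)] ac.span_base that(2) by blast
  have fin: "finite G" using B by (auto simp: G_def)
  have sepG: "\<forall>g\<in>G. separable_elt g" using sep BL by (auto simp: G_def)
  have "x \<in> vs.span G" for x
  proof -
    have "\<forall>i. \<exists>q. i < n \<longrightarrow> \<theta> x i = (\<Sum>v\<in>B i. to_ac (q v) * v)"
    proof (intro allI)
      fix i show "\<exists>q. i < n \<longrightarrow> \<theta> x i = (\<Sum>v\<in>B i. to_ac (q v) * v)"
      proof (cases "i < n")
        case True
        then have "\<theta> x i \<in> ac.span (B i)" using mem[of x] B[OF True] by auto
        then show ?thesis using ac.span_finite[of "B i"] B[OF True] by auto
      qed simp
    qed
    from choice[OF this] obtain q where q: "\<And>i. i < n \<Longrightarrow> \<theta> x i = (\<Sum>v\<in>B i. to_ac (q i v) * v)" by blast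
    have "x = (\<Sum>i<n. \<Sum>v\<in>B i. \<phi> (q i v) * c i v)"
    proof (rule eqI)
      fix j assume j: "j < n"
      have "\<theta> (\<Sum>i<n. \<Sum>v\<in>B i. \<phi> (q i v) * c i v) j
        = (\<Sum>i<n. \<Sum>v\<in>B i. to_ac (q i v) * (if j = i then v else 0))"
        unfolding sum[OF j] sum'[OF j] mul[OF j] sc[OF j] by (intro sum.cong refl) (simp add: c[OF _ BL j])
      also have "\<dots> = (\<Sum>i<n. if i = j then \<theta> x j else 0)"
        by (intro sum.cong refl) (auto simp: q)
      finally show "\<theta> x j = \<theta> (\<Sum>i<n. \<Sum>v\<in>B i. \<phi> (q i v) * c i v) j" using j by simp
    qed
    also have "\<dots> \<in> vs.span G"
    proof (intro vs.span_sum)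
      fix i v assume "i \<in> {..<n}" "v \<in> B i"
      then have "c i v \<in> G" by (auto simp: G_def)
      from vs.span_scale[OF vs.span_base[OF this], of "q i v"] show "\<phi> (q i v) * c i v \<in> vs.span G"
        by (simp add: scale_by_def)
    qed
    finally show ?thesis .
  qed
  then have "vs.span G = UNIV" by blast
  moreover obtain gs where "set gs = G" using finite_list[OF fin] by blast
  ultimately have "\<exists>gs. (\<forall>g\<in>set gs. separable_elt g) \<and> vs.span (set gs) = UNIV" using sepG by blast
  from that[OF add mul sc unit this] show ?thesis .
qed

section \<open>Orders in etale algebras\<close>

locale etale_order =
  fixes \<iota> :: "'z::idom \<Rightarrow> 'q::field" and \<phi> :: "'q \<Rightarrow> 'k::comm_ring_1" and S :: "'k set"
  assumes frac: "fraction_field \<iota>" and ded: "dedekind_domain \<iota>" and etale: "etale_algebra \<phi>"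
    and order: "order_in \<iota> \<phi> S"

sublocale etale_order \<subseteq> q_algebra \<phi>
  using etale by (simp add: q_algebra_def etale_algebra_def)

sublocale etale_order \<subseteq> i: comm_ring_hom \<iota>
  using frac by (simp add: fraction_field_def)

context etale_order
begin

text \<open>Fixed by choice so that the list can instantiate a parameter of
  \<open>lattice_algebra\<close>.\<close>

definition gs :: "'k list" where
  "gs = (SOME gs. (\<forall>g\<in>set gs. separable_elt g) \<and> vs.span (set gs) = UNIV)"

lemma gs: "\<forall>g\<in>set gs. separable_elt g" "vs.span (set gs) = UNIV"
proof -
  have "\<exists>gs. (\<forall>g\<in>set gs. separable_elt g) \<and> vs.span (set gs) = UNIV"
    by (rule etale_structure[OF etale])
  from someI_ex[OF this] show "\<forall>g\<in>set gs. separable_elt g" "vs.span (set gs) = UNIV"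
    unfolding gs_def by blast+
qed

lemma inj_iota: "\<iota> a = \<iota> b \<Longrightarrow> a = b"
  using frac by (auto simp: fraction_field_def inj_def)

lemma iota_nz: "a \<noteq> 0 \<Longrightarrow> \<iota> a \<noteq> 0"
  using inj_iota[of a 0] by auto

lemma range_iota_proper: "range \<iota> \<noteq> UNIV"
proof
  assume *: "range \<iota> = UNIV"
  obtain z :: 'z where z: "z \<noteq> 0" "\<And>w. z * w \<noteq> 1" using dedekind_nonunit[OF ded] by blast
  obtain w where "inverse (\<iota> z) = \<iota> w" using * by (metis rangeE UNIV_I)
  then have "\<iota> (z * w) = \<iota> 1" using iota_nz[OF z(1)] by (metis i.hom_mult i.hom_one right_inverse)
  then show False using inj_iota z(2) by blast
qed

end

sublocale etale_order \<subseteq> lattice_algebra \<phi> gs "range \<iota>"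
proof -
  interpret d: dedekind_subring "range \<iota>" by (rule dedekind_subring_range[OF frac ded])
  show "lattice_algebra \<phi> gs (range \<iota>)"
    by unfold_locales (use gs range_iota_proper in auto)
qed

context etale_order
begin

section \<open>Z as a subring of \<open>K\<close>\<close>

abbreviation R0 :: "'k set" where "R0 \<equiv> range (\<phi> \<circ> \<iota>)"

abbreviation sc :: "'z \<Rightarrow> 'k" where "sc z \<equiv> \<phi> (\<iota> z)"

definition Zn :: "'k set" where "Zn = {sc z |z. z \<noteq> 0}"

lemma R0_image: "R0 = \<phi> ` range \<iota>"
  by auto

lemma sc_R0: "sc z \<in> R0"
  by simp

lemma sc_hom: "sc (a * b) = sc a * sc b" "sc (a + b) = sc a + sc b" "sc (a - b) = sc a - sc b" "sc 1 = 1" "sc 0 = 0"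
  by (simp_all add: i.hom_mult hom.hom_mult i.hom_add hom.hom_add i.hom_minus hom.hom_minus)

lemma phi_inverse: "q \<noteq> 0 \<Longrightarrow> \<phi> q * \<phi> (inverse q) = 1"
  by (simp flip: hom.hom_mult)

lemma phi_nz: "q \<noteq> 0 \<Longrightarrow> \<phi> q \<noteq> 0"
  using phi_inverse[of q] by auto

lemma phi_inj: "\<phi> p = \<phi> q \<Longrightarrow> p = q"
  using phi_nz[of "p - q"] by (auto simp: hom.hom_minus)

lemma sc_cancel: "z \<noteq> 0 \<Longrightarrow> \<phi> (inverse (\<iota> z)) * (sc z * x) = x"
  using phi_inverse[OF iota_nz, of z] by (metis mult.assoc mult.commute mult_1)

lemma subring_R0: "is_subring R0"
  unfolding is_subring_def by (auto simp flip: i.hom_minus hom.hom_minus hom.hom_mult i.hom_mult)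
    (metis hom.hom_one i.hom_one rangeI)

lemma noeth_R0: "noeth_module R0 R0"
  unfolding noeth_module_def
proof (intro allI impI)
  fix N assume N: "N \<subseteq> R0" "submod R0 N"
  define N' where "N' = \<phi> -` N"
  have "N' \<subseteq> range \<iota>" using N(1) phi_inj by (fastforce simp: N'_def)
  moreover have "submod (range \<iota>) N'" using submodD[OF N(2)]
    by (auto simp: submod_def N'_def hom.hom_add hom.hom_mult)
  ultimately have "fg_submodule (range \<iota>) N'" using noeth unfolding noeth_module_def by blast
  then obtain B where B: "finite B" "N' = lin_span (range \<iota>) B" by (auto simp: fg_submodule_alt)
  have "N \<subseteq> lin_span R0 (\<phi> ` B)"
  proof
    fix x assume "x \<in> N"
    moreover from this obtain q where q: "x = \<phi> q" using N(1) by auto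
    ultimately have "q \<in> lin_span (range \<iota>) B" unfolding B(2)[symmetric] by (simp add: N'_def)
    then obtain c where c: "c \<in> B \<rightarrow> range \<iota>" "q = (\<Sum>b\<in>B. c b * b)" by (auto simp: lin_span_def)
    have "x = (\<Sum>b\<in>B. \<phi> (c b) * \<phi> b)" by (simp add: q c(2) hom.hom_sum hom.hom_mult)
    also have "\<dots> \<in> lin_span R0 (\<phi> ` B)"
    proof (rule submod_sum[OF submod_lin_span[OF subring_R0]])
      fix b assume b: "b \<in> B"
      have "c b \<in> range \<iota>" using c(1) b by (rule funcset_mem)
      then have "\<phi> (c b) \<in> R0" by auto
      moreover have "\<phi> b \<in> lin_span R0 (\<phi> ` B)" by (rule lin_span_base[OF subring_R0]) (use B(1) b in auto)
      ultimately show "\<phi> (c b) * \<phi> b \<in> lin_span R0 (\<phi> ` B)"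
        by (rule submodD(3)[OF submod_lin_span[OF subring_R0]])
    qed
    finally show "x \<in> lin_span R0 (\<phi> ` B)" .
  qed
  moreover have "\<phi> ` B \<subseteq> N" using lin_span_base[OF subring B(1)] B(2) by (auto simp: N'_def)
  ultimately have "N = lin_span R0 (\<phi> ` B)" using lin_span_least[OF N(2)] by blast
  then show "fg_submodule R0 N" using B(1) by (auto simp: fg_submodule_alt)
qed

section \<open>Denominators, lattices and fractional ideals\<close>

lemma common_denominator:
  assumes "finite A"
  shows "\<exists>z. z \<noteq> 0 \<and> (\<forall>a\<in>A. \<iota> z * q a \<in> range \<iota>)"
  using assms
proof induction
  case empty
  then show ?case by (intro exI[of _ 1]) simp
next
  case (insert a A)
  then obtain z where z: "z \<noteq> 0" "\<forall>a\<in>A. \<iota> z * q a \<in> range \<iota>" by blast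
  have "\<exists>x b. b \<noteq> 0 \<and> q a = \<iota> x / \<iota> b" using frac by (simp add: fraction_field_def)
  then obtain x b where b: "b \<noteq> 0" "q a = \<iota> x / \<iota> b" by blast
  have "\<iota> (z * b) * q a = \<iota> (z * x)" using iota_nz[OF b(1)] by (simp add: b(2) i.hom_mult)
  moreover have "\<iota> (z * b) * q c \<in> range \<iota>" if "c \<in> A" for c
  proof -
    obtain y where "\<iota> z * q c = \<iota> y" using z(2) \<open>c \<in> A\<close> by blast
    then have "\<iota> (z * b) * q c = \<iota> (b * y)" by (simp add: i.hom_mult mult_ac)
    then show ?thesis by simp
  qed
  ultimately show ?case using z(1) b(1) by (intro exI[of _ "z * b"]) auto
qed

text \<open>For an \<open>R0\<close>-submodule this amounts to containing a Q-basis of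
  \<open>K\<close>, in a form that does not mention bases.\<close>

definition full :: "'k set \<Rightarrow> bool" where
  "full L \<longleftrightarrow> (\<forall>x. \<exists>z. z \<noteq> 0 \<and> sc z * x \<in> L)"

lemma lattice_full:
  assumes "lattice_in \<iota> \<phi> L" shows "fg_submodule R0 L" "submod R0 L" "full L"
proof -
  show fg: "fg_submodule R0 L" using assms by (simp add: lattice_in_def)
  show sub: "submod R0 L" by (rule fg_submodule_submod[OF fg subring_R0])
  obtain B where B: "B \<subseteq> L" "vs.independent B" "vs.span B = UNIV"
    using assms by (auto simp: lattice_in_def is_basis_def)
  have fin: "finite B" using vs.independent_span_bound[OF finite_set B(2), of gs] gs(2) by simp
  show "full L" unfolding full_def
  proof
    fix x
    have "x \<in> vs.span B" using B(3) by simp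
    then obtain q where q: "x = (\<Sum>b\<in>B. \<phi> (q b) * b)"
      unfolding vs.span_finite[OF fin] by (auto simp: scale_by_def)
    obtain z where z: "z \<noteq> 0" "\<forall>b\<in>B. \<iota> z * q b \<in> range \<iota>" using common_denominator[OF fin] by blast
    have "sc z * x = (\<Sum>b\<in>B. \<phi> (\<iota> z * q b) * b)" by (simp add: q sum_distrib_left hom.hom_mult mult.assoc)
    also have "\<dots> \<in> L"
    proof (rule submod_sum[OF sub])
      fix b assume b: "b \<in> B"
      have "\<phi> (\<iota> z * q b) \<in> R0" using z(2) b by (metis R0_image imageI)
      then show "\<phi> (\<iota> z * q b) * b \<in> L" using submodD(3)[OF sub] B(1) b by blast
    qed
    finally show "\<exists>z. z \<noteq> 0 \<and> sc z * x \<in> L" using z(1) by blast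
  qed
qed

lemma full_scale:
  assumes L: "full L" "submod R0 L" and A: "finite A"
  shows "\<exists>z. z \<noteq> 0 \<and> (\<forall>a\<in>A. sc z * a \<in> L)"
  using A
proof induction
  case empty
  then show ?case by (intro exI[of _ 1]) simp
next
  case (insert a A)
  then obtain z where z: "z \<noteq> 0" "\<forall>a\<in>A. sc z * a \<in> L" by blast
  obtain y where y: "y \<noteq> 0" "sc y * a \<in> L" using L(1) unfolding full_def by blast
  have "sc (z * y) * c \<in> L" if "c \<in> A" for c
    using submodD(3)[OF L(2) sc_R0[of y], of "sc z * c"] z(2) that by (simp add: sc_hom mult_ac)
  moreover have "sc (z * y) * a \<in> L"
    using submodD(3)[OF L(2) sc_R0[of z] y(2)] by (simp add: sc_hom mult_ac)
  ultimately show ?case using z(1) y(1) by (intro exI[of _ "z * y"]) auto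
qed

lemma bounded_by_full:
  assumes L: "full L" "submod R0 L" and M: "fg_submodule R0 M"
  shows "\<exists>z. z \<noteq> 0 \<and> (\<forall>x\<in>M. sc z * x \<in> L)"
proof -
  obtain B where B: "finite B" "M = lin_span R0 B" using M by (auto simp: fg_submodule_alt)
  obtain z where z: "z \<noteq> 0" "\<forall>a\<in>B. sc z * a \<in> L" using full_scale[OF L B(1)] by blast
  have "sc z * x \<in> L" if x: "x \<in> M" for x
  proof -
    obtain c where c: "c \<in> B \<rightarrow> R0" "x = (\<Sum>b\<in>B. c b * b)" using x B(2) by (auto simp: lin_span_def)
    have "sc z * x = (\<Sum>b\<in>B. c b * (sc z * b))" by (simp add: c(2) sum_distrib_left mult.left_commute)
    also have "\<dots> \<in> L"
    proof (rule submod_sum[OF L(2)])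
      fix b assume b: "b \<in> B"
      have "sc z * b \<in> L" using z(2) b by blast
      then show "c b * (sc z * b) \<in> L" by (rule submodD(3)[OF L(2) funcset_mem[OF c(1) b]])
    qed
    finally show ?thesis .
  qed
  then show ?thesis using z(1) by blast
qed

lemma S_subring: "is_subring S" and S_lattice: "lattice_in \<iota> \<phi> S"
  using order subring_imp_is_subring by (auto simp: order_in_def)

lemmas S = subringD[OF S_subring] and S_full = lattice_full[OF S_lattice]

lemma R0_S: "R0 \<subseteq> S"
proof
  fix x assume "x \<in> R0"
  from submodD(3)[OF S_full(2) this S(1)] show "x \<in> S" by simp
qed

lemma noeth_R0_S: "noeth_module R0 S"
  by (rule noeth_module_fg[OF subring_R0 noeth_R0 S_full(1)])

lemma frac_ideal_fg:
  assumes "frac_ideal S Zn I" shows "fg_submodule R0 I"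
proof -
  have sub: "submod R0 I" using assms submod_mono[OF _ R0_S] by (auto simp: frac_ideal_def)
  obtain z where z: "z \<noteq> 0" "\<forall>x\<in>I. sc z * x \<in> S" using assms by (auto simp: frac_ideal_def Zn_def)
  have "(*) (sc z) ` I \<subseteq> S" using z(2) by blast
  then have "fg_submodule R0 ((*) (sc z) ` I)"
    using noeth_R0_S submod_scale[OF sub] unfolding noeth_module_def by blast
  from fg_submodule_scale[OF this subring_R0, of "\<phi> (inverse (\<iota> z))"]
  have "fg_submodule R0 ((*) (\<phi> (inverse (\<iota> z))) ` (*) (sc z) ` I)" .
  moreover have "(*) (\<phi> (inverse (\<iota> z))) ` (*) (sc z) ` I = I"
    unfolding image_image sc_cancel[OF z(1)] by simp
  ultimately show ?thesis by simp
qed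

lemma frac_ideal_full:
  assumes "frac_ideal S Zn I" shows "full I"
  unfolding full_def
proof
  fix x
  obtain m where m: "m \<noteq> 0" "sc m \<in> I" using assms by (auto simp: frac_ideal_def Zn_def)
  obtain z where z: "z \<noteq> 0" "sc z * x \<in> S" using S_full(3) unfolding full_def by blast
  have "submod S I" using assms by (simp add: frac_ideal_def)
  from submodD(3)[OF this z(2) m(2)] have "sc (z * m) * x \<in> I" by (simp add: sc_hom mult_ac)
  then show "\<exists>z. z \<noteq> 0 \<and> sc z * x \<in> I" using z(1) m(1) by (intro exI[of _ "z * m"]) simp
qed

text \<open>Passage between the two descriptions: containing a basis corresponds to meeting
  \<open>Zn\<close>, and finite generation over Z corresponds to bounded denominators, because
  \<open>S\<close> is noetherian over Z.\<close>

lemma fractional_ideal_iff: "fractional_ideal \<iota> \<phi> S I \<longleftrightarrow> frac_ideal S Zn I"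
proof
  assume I: "fractional_ideal \<iota> \<phi> S I"
  then have sub: "submod S I" and lat: "lattice_in \<iota> \<phi> I"
    using fg_submodule_submod[OF _ S_subring] by (auto simp: fractional_ideal_def)
  note L = lattice_full[OF lat]
  obtain m where m: "m \<noteq> 0" "sc m * 1 \<in> I" using L(3) unfolding full_def by blast
  obtain z where z: "z \<noteq> 0" "\<forall>x\<in>I. sc z * x \<in> S" using bounded_by_full[OF S_full(3,2) L(1)] by blast
  have "sc m \<in> Zn" "sc z \<in> Zn" using m z by (auto simp: Zn_def)
  then show "frac_ideal S Zn I" unfolding frac_ideal_def using sub m(2) z(2) by auto
next
  assume I: "frac_ideal S Zn I"
  note fg = frac_ideal_fg[OF I]
  have "fg_submodule S I"
    using fg_submodule_mono[OF subring_R0 S_subring R0_S fg] I by (simp add: frac_ideal_def)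
  moreover have "\<exists>B\<subseteq>I. is_basis \<phi> B"
  proof -
    \<comment> \<open>A maximal independent subset of \<open>I\<close> spans \<open>K\<close>,
      because every element of \<open>K\<close> has a nonzero Z-multiple in
      \<open>I\<close>.\<close>
    obtain B where B: "B \<subseteq> I" "vs.independent B" "I \<subseteq> vs.span B"
      using vs.maximal_independent_subset[of I] by blast
    have "x \<in> vs.span B" for x
    proof -
      obtain z where z: "z \<noteq> 0" "sc z * x \<in> I" using frac_ideal_full[OF I] unfolding full_def by blast
      then have "scale_by \<phi> (inverse (\<iota> z)) (sc z * x) \<in> vs.span B" using B(3) by (intro vs.span_scale) blast
      then show ?thesis using sc_cancel[OF z(1)] by (simp add: scale_by_def)
    qed
    then show ?thesis using B(1,2) unfolding is_basis_def by blast
  qed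
  ultimately show "fractional_ideal \<iota> \<phi> S I" using fg by (simp add: fractional_ideal_def lattice_in_def)
qed

text \<open>\<open>S\<close> is integral over Z. In a monic relation for \<open>x\<close> modulo
  \<open>P\<close> of least degree the constant term \<open>z 0\<close> is outside \<open>P\<close>,
  since otherwise \<open>x\<close> could be cancelled. It is invertible modulo the maximal ideal
  \<open>P \<inter> Z\<close>, and it is congruent to a multiple \<open>x * w\<close> of
  \<open>x\<close>.\<close>

lemma prime_in_maximal:
  assumes P: "prime_in S P" and n: "n \<in> P" "n \<in> Zn" and x: "x \<in> S" "x \<notin> P"
  shows "\<exists>y\<in>S. 1 - y * x \<in> P"
proof -
  note Pm = prime_inD[OF P]
  have powS: "x ^ n * 1 \<in> S" for n by (induction n) (use S x in auto)
  have ex: "\<exists>n z. (\<forall>i. z i \<in> R0) \<and> x ^ n - (\<Sum>i<n. z i * x ^ i) \<in> P"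
  proof -
    from noeth_power_relation[OF subring_R0 noeth_R0_S S_full(2) powS]
    obtain n z where z: "\<And>i. z i \<in> R0" "x ^ n * 1 = (\<Sum>i<n. z i * x ^ i) * 1" by blast
    then have "x ^ n - (\<Sum>i<n. z i * x ^ i) = 0" by simp
    then have "x ^ n - (\<Sum>i<n. z i * x ^ i) \<in> P" using submodD(1)[OF Pm(1)] by simp
    then show ?thesis using z(1) by blast
  qed
  define n where "n = (LEAST n. \<exists>z. (\<forall>i. z i \<in> R0) \<and> x ^ n - (\<Sum>i<n. z i * x ^ i) \<in> P)"
  obtain z where z: "\<forall>i. z i \<in> R0" "x ^ n - (\<Sum>i<n. z i * x ^ i) \<in> P"
    using LeastI_ex[OF ex] unfolding n_def by blast
  have "n \<noteq> 0" using z(2) Pm(3) by (intro notI) simp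
  then obtain k where k: "n = Suc k" by (cases n) auto
  define w where "w = x ^ k - (\<Sum>i<k. z (Suc i) * x ^ i)"
  have zS: "z i \<in> S" for i using z(1) R0_S by blast
  have wS: "w \<in> S"
  proof -
    have "(\<Sum>i<k. z (Suc i) * x ^ i) \<in> S"
      by (rule submod_sum[OF submod_self[OF S_subring]]) (use S(4)[OF zS] powS in auto)
    then show ?thesis using powS[of k] S(3) by (simp add: w_def)
  qed
  have eq: "x ^ n - (\<Sum>i<n. z i * x ^ i) = x * w - z 0"
    unfolding k sum.lessThan_Suc_shift w_def
    by (simp add: right_diff_distrib sum_distrib_left mult_ac)
  have z0: "z 0 \<notin> P"
  proof
    assume "z 0 \<in> P"
    from submodD(2)[OF Pm(1) z(2)[unfolded eq] this] have "x * w \<in> P" by simp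
    then have "w \<in> P" using Pm(4)[OF x(1) wS] x(2) by blast
    then have "\<exists>z. (\<forall>i. z i \<in> R0) \<and> x ^ k - (\<Sum>i<k. z i * x ^ i) \<in> P"
      using z(1) unfolding w_def by (intro exI[of _ "\<lambda>i. z (Suc i)"]) simp
    then have "n \<le> k" unfolding n_def by (rule Least_le)
    then show False using k by simp
  qed
  obtain y where y: "y \<in> R0" "1 - y * z 0 \<in> P"
  proof -
    \<comment> \<open>The contraction of \<open>P\<close> to Z, viewed in Q. It is nonzero because
      \<open>P\<close> meets \<open>Zn\<close>, hence it is maximal.\<close>
    define p where "p = {q \<in> range \<iota>. \<phi> q \<in> P}"
    have "prime_in (range \<iota>) p" unfolding prime_in_def
    proof (intro conjI ballI impI)
      show "submod (range \<iota>) p" unfolding submod_def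
      proof (intro conjI ballI)
        show "0 \<in> p" using submodD(1)[OF Pm(1)] R(2) by (simp add: p_def)
        show "a + b \<in> p" if "a \<in> p" "b \<in> p" for a b
          using that submodD(2)[OF Pm(1)] R(6) by (simp add: p_def hom.hom_add)
        show "r * a \<in> p" if "r \<in> range \<iota>" "a \<in> p" for r a
        proof -
          have "\<phi> r \<in> S" using that(1) R0_S by auto
          then show ?thesis using that R(4) submodD(3)[OF Pm(1)] by (simp add: p_def hom.hom_mult)
        qed
      qed
      show "1 \<notin> p" using Pm(3) by (simp add: p_def)
      show "p \<subseteq> range \<iota>" by (auto simp: p_def)
      fix a b assume ab: "a \<in> range \<iota>" "b \<in> range \<iota>" "a * b \<in> p"
      then have "\<phi> a \<in> S" "\<phi> b \<in> S" using R0_S by auto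
      then show "a \<in> p \<or> b \<in> p" using Pm(4)[of "\<phi> a" "\<phi> b"] ab by (auto simp: p_def hom.hom_mult)
    qed
    moreover obtain m where m: "m \<noteq> 0" "sc m \<in> P" using n by (auto simp: Zn_def)
    then have "\<iota> m \<in> p" "\<iota> m \<noteq> 0" using iota_nz by (auto simp: p_def)
    then have "p \<noteq> {0}" by blast
    moreover obtain c where c: "c \<in> range \<iota>" "z 0 = \<phi> c" using z(1) R0_image by blast
    moreover have "c \<notin> p" using c z0 by (simp add: p_def)
    ultimately obtain y where "y \<in> range \<iota>" "1 - y * c \<in> p" using maximal by blast
    then show ?thesis using that[of "\<phi> y"] c(2) by (auto simp: p_def hom.hom_minus hom.hom_mult)
  qed
  have yS: "y \<in> S" using y(1) R0_S by blast
  from submodD(2)[OF Pm(1) y(2) submod_neg[OF Pm(1) S_subring submodD(3)[OF Pm(1) yS z(2)[unfolded eq]]]]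
  have "1 - (y * w) * x \<in> P" by (simp add: algebra_simps)
  then show ?thesis using S(4)[OF yS wS] by blast
qed

text \<open>The candidates for \<open>a\<close> are the powers of a nonzero nonunit of Z, which are
  pairwise distinct. Each of the finitely many components of \<open>K\<close> rules out at most one
  exponent, namely one at which that component of the sum vanishes.\<close>

lemma shift_unit:
  assumes "m \<in> Zn" shows "\<exists>a\<in>S. \<exists>y. (x + a * m) * y = 1"
proof -
  show ?thesis
  proof (rule etale_structure[OF etale])
    fix n :: nat and \<theta> :: "'k \<Rightarrow> nat \<Rightarrow> 'q alg_closure"
    assume t: "\<And>i x y. i < n \<Longrightarrow> \<theta> (x + y) i = \<theta> x i + \<theta> y i"
      "\<And>i x y. i < n \<Longrightarrow> \<theta> (x * y) i = \<theta> x i * \<theta> y i" "\<And>i q. i < n \<Longrightarrow> \<theta> (\<phi> q) i = to_ac q"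
      "\<And>x. (\<And>i. i < n \<Longrightarrow> \<theta> x i \<noteq> 0) \<Longrightarrow> \<exists>y. x * y = 1"
    obtain c where c: "c \<noteq> 0" "m = sc c" using assms by (auto simp: Zn_def)
    obtain z :: 'z where z: "z \<noteq> 0" "\<And>w. z * w \<noteq> 1" using dedekind_nonunit[OF ded] by blast
    have inj: "k = l" if "\<iota> (z ^ k * c) = \<iota> (z ^ l * c)" for k l
    proof -
      have *: "False" if kl: "k < l" "z ^ k = z ^ l" for k l
      proof -
        obtain j where "l = k + Suc j" using kl(1) less_imp_Suc_add by fastforce
        then have "z ^ k * (z * z ^ j) = z ^ k * 1" using kl(2) by (simp add: power_add)
        then have "z * z ^ j = 1" using z(1) by (simp only: mult_cancel_left) simp
        then show False using z(2) by blast
      qed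
      have "z ^ k = z ^ l" using inj_iota[OF that] c(1) by simp
      then show ?thesis using *[of k l] *[of l k] by (metis linorder_neqE_nat)
    qed
    define bad where "bad i = {k. \<theta> x i + to_ac (\<iota> (z ^ k * c)) = 0}" for i
    have "finite (bad i)" for i
    proof -
      have "k = l" if "k \<in> bad i" "l \<in> bad i" for k l
      proof -
        have "to_ac (\<iota> (z ^ k * c)) = to_ac (\<iota> (z ^ l * c))"
          using that unfolding bad_def by (metis (mono_tags, lifting) add_left_cancel mem_Collect_eq)
        then show ?thesis using inj by simp
      qed
      then have "\<exists>k. bad i \<subseteq> {k}" by blast
      then show ?thesis using finite_subset by blast
    qed
    then have "finite (\<Union>i<n. bad i)" by blast
    then obtain k where k: "k \<notin> (\<Union>i<n. bad i)" using ex_new_if_finite infinite_UNIV_nat by blast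
    have "\<exists>y. (x + sc (z ^ k) * m) * y = 1"
    proof (rule t(4))
      fix i assume i: "i < n"
      then have "\<theta> x i + to_ac (\<iota> (z ^ k * c)) \<noteq> 0" using k by (auto simp: bad_def)
      moreover have "sc (z ^ k) * m = sc (z ^ k * c)" by (simp add: c(2) sc_hom)
      ultimately show "\<theta> (x + sc (z ^ k) * m) i \<noteq> 0" by (simp add: t(1,3)[OF i])
    qed
    then show "\<exists>a\<in>S. \<exists>y. (x + a * m) * y = 1" using R0_S sc_R0 by blast
  qed
qed

section \<open>The trace dual of the order\<close>

abbreviation Dt :: "'k set" where "Dt \<equiv> trace_dual \<iota> \<phi> S"

lemma trace_dual_mem: "x \<in> Dt \<longleftrightarrow> (\<forall>y\<in>S. Tr (x * y) \<in> range \<iota>)"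
  by (simp add: trace_dual_def)

text \<open>A common denominator of the traces of generators of \<open>S\<close> lies in the dual.
  In the other direction, the coordinates of an element of the dual with respect to the trace-dual
  basis are traces, and they become integral once the basis is scaled into \<open>S\<close>.\<close>

lemma frac_ideal_trace_dual: "frac_ideal S Zn Dt"
  unfolding frac_ideal_def
proof (intro conjI)
  show "submod S Dt" unfolding submod_def
  proof (intro conjI ballI)
    show "0 \<in> Dt" using R(2) by (simp add: trace_dual_mem lin_0[OF Tr_lin])
    show "x + y \<in> Dt" if "x \<in> Dt" "y \<in> Dt" for x y
      using that R(6) by (simp add: trace_dual_mem distrib_right linD(1)[OF Tr_lin])
    show "r * x \<in> Dt" if "r \<in> S" "x \<in> Dt" for r x
      unfolding trace_dual_mem
    proof
      fix y assume "y \<in> S"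
      then have "Tr (x * (r * y)) \<in> range \<iota>" using that S(4) by (simp add: trace_dual_mem)
      then show "Tr (r * x * y) \<in> range \<iota>" by (simp add: mult_ac)
    qed
  qed
  obtain G where G: "finite G" "S = lin_span R0 G" using S_full(1) by (auto simp: fg_submodule_alt)
  obtain m where m: "m \<noteq> 0" "\<forall>g\<in>G. \<iota> m * Tr g \<in> range \<iota>" using common_denominator[OF G(1), of Tr] by blast
  have "sc m \<in> Dt" unfolding trace_dual_mem
  proof
    fix y assume "y \<in> S"
    then obtain c where c: "c \<in> G \<rightarrow> R0" "y = (\<Sum>g\<in>G. c g * g)" using G(2) by (auto simp: lin_span_def)
    have "Tr (sc m * y) = (\<Sum>g\<in>G. \<iota> m * Tr (c g * g))"
      by (simp add: c(2) linD(2)[OF Tr_lin] lin_sum[OF Tr_lin] sum_distrib_left)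
    also have "\<dots> \<in> range \<iota>"
    proof (rule submod_sum[OF submod_self[OF subring]])
      fix g assume g: "g \<in> G"
      then obtain r where r: "r \<in> range \<iota>" "c g = \<phi> r" using c(1) R0_image by blast
      have eq: "\<iota> m * Tr (c g * g) = r * (\<iota> m * Tr g)" by (simp add: r(2) linD(2)[OF Tr_lin])
      show "\<iota> m * Tr (c g * g) \<in> range \<iota>"
        unfolding eq by (rule R(4)[OF r(1) bspec[OF m(2) g]])
    qed
    finally show "Tr (sc m * y) \<in> range \<iota>" .
  qed
  moreover have "sc m \<in> Zn" using m(1) by (auto simp: Zn_def)
  ultimately show "\<exists>m\<in>Zn. m \<in> Dt" by blast
  obtain d where d: "\<And>y. y = (\<Sum>b\<in>BK. \<phi> (Tr (y * b)) * d b)" using trace_dual_basis by blast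
  obtain e where e: "e \<noteq> 0" "\<forall>b\<in>BK. sc e * b \<in> S" using full_scale[OF S_full(3,2) finite_BK] by blast
  obtain f where f: "f \<noteq> 0" "\<forall>b\<in>d ` BK. sc f * b \<in> S"
    using full_scale[OF S_full(3,2) finite_imageI[OF finite_BK]] by blast
  have "sc (e * f) * y \<in> S" if y: "y \<in> Dt" for y
  proof -
    \<comment> \<open>The factor \<open>e\<close> moves the basis into \<open>S\<close>, so that
      these traces are integral; the factor \<open>f\<close> moves the dual basis vectors into
      \<open>S\<close>.\<close>
    have te: "Tr (y * (sc e * b)) = \<iota> e * Tr (y * b)" for b
      by (simp add: mult.left_commute[of y] linD(2)[OF Tr_lin])
    have "sc (e * f) * y = (\<Sum>b\<in>BK. \<phi> (Tr (y * (sc e * b))) * (sc f * d b))"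
    proof -
      have "sc (e * f) * y = (\<Sum>b\<in>BK. sc (e * f) * (\<phi> (Tr (y * b)) * d b))"
        by (subst d[of y]) (simp add: sum_distrib_left)
      also have "\<dots> = (\<Sum>b\<in>BK. \<phi> (Tr (y * (sc e * b))) * (sc f * d b))"
        unfolding te by (intro sum.cong refl) (simp add: hom.hom_mult i.hom_mult mult_ac)
      finally show ?thesis .
    qed
    also have "\<dots> \<in> S"
    proof (rule submod_sum[OF submod_self[OF S_subring]])
      fix b assume b: "b \<in> BK"
      have "Tr (y * (sc e * b)) \<in> range \<iota>" using y e(2) b by (simp add: trace_dual_mem)
      then have "\<phi> (Tr (y * (sc e * b))) \<in> S" using R0_S by auto
      then show "\<phi> (Tr (y * (sc e * b))) * (sc f * d b) \<in> S" using S(4) f(2) b by blast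
    qed
    finally show ?thesis .
  qed
  moreover have "sc (e * f) \<in> Zn" using e f by (auto simp: Zn_def)
  ultimately show "\<exists>d\<in>Zn. \<forall>x\<in>Dt. d * x \<in> S" by blast
qed

text \<open>For \<open>x\<close> outside \<open>I\<close> a separating functional has the form
  \<open>Tr (y * _)\<close>. Integrality on \<open>I\<close>, which is stable under
  \<open>S\<close>, means \<open>y \<in> (Dt : I)\<close>; then \<open>x * y \<in> Dt\<close> makes
  \<open>Tr (x * y)\<close> integral, a contradiction.\<close>

lemma trace_dual_reflexive:
  assumes I: "frac_ideal S Zn I" shows "colon Dt (colon Dt I) = I"
proof
  show "I \<subseteq> colon Dt (colon Dt I)"
    by (auto simp: colon_def mult.commute)
  show "colon Dt (colon Dt I) \<subseteq> I"
  proof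
    fix x assume x: "x \<in> colon Dt (colon Dt I)"
    show "x \<in> I"
    proof (rule ccontr)
      assume "x \<notin> I"
      have sS: "submod S I" using I by (simp add: frac_ideal_def)
      have sub: "submod (\<phi> ` range \<iota>) I" using submod_mono[OF sS R0_S] R0_image by simp
      obtain G where G: "finite G" "I = lin_span R0 G" using frac_ideal_fg[OF I] by (auto simp: fg_submodule_alt)
      obtain d where d: "d \<noteq> 0" "\<forall>gb\<in>G \<times> BK. \<iota> d * coord (snd gb) (fst gb) \<in> range \<iota>"
        using common_denominator[OF finite_cartesian_product[OF G(1) finite_BK],
            of "\<lambda>gb. coord (snd gb) (fst gb)"] by blast
      have bd: "\<iota> d * coord b v \<in> range \<iota>" if v: "v \<in> I" and b: "b \<in> BK" for v b
      proof -
        obtain c where c: "c \<in> G \<rightarrow> R0" "v = (\<Sum>g\<in>G. c g * g)" using v G(2) by (auto simp: lin_span_def)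
        have "\<iota> d * coord b v = (\<Sum>g\<in>G. \<iota> d * coord b (c g * g))"
          by (simp add: c(2) lin_sum[OF coord_lin] sum_distrib_left)
        also have "\<dots> \<in> range \<iota>"
        proof (rule submod_sum[OF submod_self[OF subring]])
          fix g assume g: "g \<in> G"
          then obtain r where r: "r \<in> range \<iota>" "c g = \<phi> r" using c(1) R0_image by blast
          have eq: "\<iota> d * coord b (c g * g) = r * (\<iota> d * coord b g)" by (simp add: r(2) linD(2)[OF coord_lin])
          have "\<iota> d * coord b g \<in> range \<iota>" using bspec[OF d(2), of "(g, b)"] g b by simp
          then show "\<iota> d * coord b (c g * g) \<in> range \<iota>" unfolding eq by (rule R(4)[OF r(1)])
        qed
        finally show ?thesis .
      qed
      obtain f where f: "lin f" "f ` I \<subseteq> range \<iota>" "f x \<notin> range \<iota>"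
        by (rule separating_functional[OF sub iota_nz[OF d(1)] bd \<open>x \<notin> I\<close>])
      obtain y where y: "\<And>x. f x = Tr (y * x)" by (rule trace_representation[OF f(1)]) blast
      have "y \<in> colon Dt I"
      proof (rule colonI)
        fix i assume i: "i \<in> I"
        show "y * i \<in> Dt" unfolding trace_dual_mem
        proof
          fix s assume "s \<in> S"
          then have "f (s * i) \<in> range \<iota>" using f(2) submodD(3)[OF sS _ i] by blast
          then show "Tr (y * i * s) \<in> range \<iota>" unfolding y by (simp add: mult_ac)
        qed
      qed
      from colonD[OF x this] have "Tr (x * y * 1) \<in> range \<iota>" using S(1) unfolding trace_dual_mem by blast
      then show False using f(3) y[of x] by (simp add: mult.commute)
    qed
  qed
qed

end

sublocale etale_order \<subseteq> dual: dualizing_order S Zn Dt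
proof
  show "is_subring S" by (rule S_subring)
  show "noeth_module S S" by (rule noeth_module_mono[OF subring_R0 S_subring R0_S noeth_R0_S])
  show "Zn \<subseteq> S" using R0_S by (auto simp: Zn_def)
  show "\<exists>n. m * n = 1" if "m \<in> Zn" for m
    using that phi_inverse[OF iota_nz] by (auto simp: Zn_def)
  show "m * n \<in> Zn" if m: "m \<in> Zn" "n \<in> Zn" for m n
  proof -
    obtain a b where "a \<noteq> 0" "b \<noteq> 0" "m = sc a" "n = sc b" using m unfolding Zn_def by blast
    then show ?thesis unfolding Zn_def by (intro CollectI exI[of _ "a * b"]) (simp add: sc_hom)
  qed
  show "1 \<in> Zn" unfolding Zn_def by (intro CollectI exI[of _ 1]) simp
qed (fact shift_unit prime_in_maximal frac_ideal_trace_dual trace_dual_reflexive)+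

section \<open>Localizations\<close>

text \<open>The operations on fractions are unions over all representatives; such a union is
  evaluated as soon as its members do not depend on the representatives.\<close>

lemma UN_pairs_eq:
  assumes "A \<noteq> {}" "B \<noteq> {}" "\<And>x s y t. (x, s) \<in> A \<Longrightarrow> (y, t) \<in> B \<Longrightarrow> f x s y t = c"
  shows "(\<Union>(x, s)\<in>A. \<Union>(y, t)\<in>B. f x s y t) = c"
proof -
  obtain a b where ab: "a \<in> A" "b \<in> B" using assms(1,2) by blast
  have *: "(\<Union>(y, t)\<in>B. f x s y t) = c" if "(x, s) \<in> A" for x s
    by (rule UN_constant_eq[OF ab(2)]) (use assms(3)[OF that] in auto)
  show ?thesis
  proof (rule UN_constant_eq[OF ab(1)], rule ballI)
    fix p assume "p \<in> A"
    then show "(case p of (x, s) \<Rightarrow> \<Union>(y, t)\<in>B. f x s y t) = c" by (cases p) (simp add: *)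
  qed
qed

context dualizing_order
begin

context
  fixes P assumes P: "P \<in> primes"
begin

lemma comp1: "1 \<in> S - P" and compM: "s \<in> S - P \<Longrightarrow> t \<in> S - P \<Longrightarrow> s * t \<in> S - P"
  using R(1,4) primesD(4,5)[OF P] by auto

lemma equiv_loc_rel: "equiv (M \<times> (S - P)) (loc_rel S P M)"
proof (rule equivI)
  show "loc_rel S P M \<subseteq> (M \<times> (S - P)) \<times> (M \<times> (S - P))" by (auto simp: loc_rel_def)
  show "refl_on (M \<times> (S - P)) (loc_rel S P M)"
  proof (rule refl_onI)
    fix p assume "p \<in> M \<times> (S - P)"
    then obtain x s where "p = (x, s)" "x \<in> M" "s \<in> S - P" by blast
    moreover have "1 * (s * x - s * x) = (0 :: 'k)" by simp
    ultimately show "(p, p) \<in> loc_rel S P M" unfolding loc_rel_def using comp1 by blast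
  qed
  show "sym (loc_rel S P M)"
  proof (rule symI, clarsimp simp: loc_rel_def)
    fix x s y t u assume u: "u * (t * x - s * y) = 0" "u \<in> S" "u \<notin> P"
    have "u * (s * y - t * x) = - (u * (t * x - s * y))" by (simp add: algebra_simps)
    then show "\<exists>u\<in>S - P. u * (s * y - t * x) = 0" using u by auto
  qed
  show "trans (loc_rel S P M)"
  proof (rule transI, clarsimp simp: loc_rel_def)
    fix x s y t z r u v
    assume st: "s \<in> S" "s \<notin> P" "t \<in> S" "t \<notin> P" "r \<in> S" "r \<notin> P"
      and u: "u \<in> S" "u \<notin> P" "u * (t * x - s * y) = 0" and v: "v \<in> S" "v \<notin> P" "v * (r * y - t * z) = 0"
    have "u * v * t * (r * x - s * z) = r * v * (u * (t * x - s * y)) + s * u * (v * (r * y - t * z))"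
      by (simp add: algebra_simps)
    then have "u * v * t * (r * x - s * z) = 0" using u(3) v(3) by simp
    moreover have "u * v * t \<in> S - P" using compM u v st by auto
    ultimately show "\<exists>u\<in>S - P. u * (r * x - s * z) = 0" by blast
  qed
qed

lemma mem_frac_iff:
  "(y, t) \<in> frac S P M x s \<longleftrightarrow> x \<in> M \<and> y \<in> M \<and> s \<in> S - P \<and> t \<in> S - P \<and> (\<exists>u\<in>S - P. u * (t * x - s * y) = 0)"
  by (simp add: frac_def loc_rel_def)

lemma frac_eq_iff:
  assumes "x \<in> M" "s \<in> S - P" "y \<in> M" "t \<in> S - P"
  shows "frac S P M x s = frac S P M y t \<longleftrightarrow> (\<exists>u\<in>S - P. u * (t * x - s * y) = 0)"
proof -
  have "frac S P M x s = frac S P M y t \<longleftrightarrow> ((x, s), (y, t)) \<in> loc_rel S P M"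
    unfolding frac_def by (rule eq_equiv_class_iff[OF equiv_loc_rel]) (use assms in auto)
  then show ?thesis using assms by (simp add: loc_rel_def)
qed

lemma frac_eqI:
  "x \<in> M \<Longrightarrow> s \<in> S - P \<Longrightarrow> y \<in> M \<Longrightarrow> t \<in> S - P \<Longrightarrow> u \<in> S - P \<Longrightarrow> u * (t * x - s * y) = 0 \<Longrightarrow>
    frac S P M x s = frac S P M y t"
  using frac_eq_iff by blast

lemma frac_nonempty: "x \<in> M \<Longrightarrow> s \<in> S - P \<Longrightarrow> frac S P M x s \<noteq> {}"
  using equiv_class_self[OF equiv_loc_rel, of "(x, s)" M] unfolding frac_def by blast

lemma carrier_loc_module: "carrier (loc_module S P M) = {frac S P M x s |x s. x \<in> M \<and> s \<in> S - P}"
  by (auto simp: loc_module_def quotient_def frac_def)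

lemma carrier_loc_ring: "carrier (loc_ring S P) = {frac S P S x s |x s. x \<in> S \<and> s \<in> S - P}"
  by (auto simp: loc_ring_def quotient_def frac_def)

lemma loc_module_add:
  assumes M: "submod S M" and x: "x \<in> M" "s \<in> S - P" and y: "y \<in> M" "t \<in> S - P"
  shows "frac S P M x s \<oplus>\<^bsub>loc_module S P M\<^esub> frac S P M y t = frac S P M (t * x + s * y) (s * t)"
proof -
  note m = submodD[OF M]
  have "(\<Union>(x', s')\<in>frac S P M x s. \<Union>(y', t')\<in>frac S P M y t. frac S P M (t' * x' + s' * y') (s' * t'))
      = frac S P M (t * x + s * y) (s * t)"
  proof (rule UN_pairs_eq[OF frac_nonempty[OF x] frac_nonempty[OF y]])
    fix x' s' y' t' assume "(x', s') \<in> frac S P M x s" "(y', t') \<in> frac S P M y t"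
    then obtain u v where x': "x' \<in> M" "s' \<in> S - P" "u \<in> S - P" "u * (s' * x - s * x') = 0"
      and y': "y' \<in> M" "t' \<in> S - P" "v \<in> S - P" "v * (t' * y - t * y') = 0" unfolding mem_frac_iff by blast
    show "frac S P M (t' * x' + s' * y') (s' * t') = frac S P M (t * x + s * y) (s * t)"
    proof (rule frac_eqI[of _ _ _ _ _ "u * v"])
      show "t' * x' + s' * y' \<in> M" "t * x + s * y \<in> M" using m(2,3) x y x' y' by auto
      show "s' * t' \<in> S - P" "s * t \<in> S - P" "u * v \<in> S - P" using compM x y x' y' by auto
      have "u * v * ((s * t) * (t' * x' + s' * y') - (s' * t') * (t * x + s * y))
        = - (t * t' * v * (u * (s' * x - s * x')) + s * s' * u * (v * (t' * y - t * y')))"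
        by (simp add: algebra_simps)
      then show "u * v * ((s * t) * (t' * x' + s' * y') - (s' * t') * (t * x + s * y)) = 0"
        using x'(4) y'(4) by simp
    qed
  qed
  then show ?thesis by (simp add: loc_module_def)
qed

lemma loc_module_smult:
  assumes M: "submod S M" and x: "x \<in> S" "s \<in> S - P" and y: "y \<in> M" "t \<in> S - P"
  shows "frac S P S x s \<odot>\<^bsub>loc_module S P M\<^esub> frac S P M y t = frac S P M (x * y) (s * t)"
proof -
  note m = submodD[OF M]
  have "(\<Union>(x', s')\<in>frac S P S x s. \<Union>(y', t')\<in>frac S P M y t. frac S P M (x' * y') (s' * t'))
      = frac S P M (x * y) (s * t)"
  proof (rule UN_pairs_eq[OF frac_nonempty[OF x] frac_nonempty[OF y]])
    fix x' s' y' t' assume "(x', s') \<in> frac S P S x s" "(y', t') \<in> frac S P M y t"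
    then obtain u v where x': "x' \<in> S" "s' \<in> S - P" "u \<in> S - P" "u * (s' * x - s * x') = 0"
      and y': "y' \<in> M" "t' \<in> S - P" "v \<in> S - P" "v * (t' * y - t * y') = 0" unfolding mem_frac_iff by blast
    show "frac S P M (x' * y') (s' * t') = frac S P M (x * y) (s * t)"
    proof (rule frac_eqI[of _ _ _ _ _ "u * v"])
      show "x' * y' \<in> M" "x * y \<in> M" using m(3) x y x' y' by auto
      show "s' * t' \<in> S - P" "s * t \<in> S - P" "u * v \<in> S - P" using compM x y x' y' by auto
      have "u * v * ((s * t) * (x' * y') - (s' * t') * (x * y))
        = - (v * t' * y * (u * (s' * x - s * x')) + u * s * x' * (v * (t' * y - t * y')))"
        by (simp add: algebra_simps)
      then show "u * v * ((s * t) * (x' * y') - (s' * t') * (x * y)) = 0"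
        using x'(4) y'(4) by simp
    qed
  qed
  then show ?thesis by (simp add: loc_module_def)
qed

text \<open>The map is \<open>i/t \<mapsto> (s i y)/(s t)\<close>, with inverse
  \<open>j/t \<mapsto> (s j x)/(s t)\<close>. The factor \<open>s\<close> is needed because
  multiplication by \<open>y\<close> alone need not carry \<open>I\<close> into
  \<open>J\<close>.\<close>

theorem loc_iso_imp_module_iso:
  assumes I: "submod S I" and J: "submod S J" and "loc_iso P I J"
  shows "module_iso (loc_ring S P) (loc_module S P I) (loc_module S P J)"
proof -
  obtain x y s where s: "x * y = 1" "s \<in> S" "s \<notin> P" "\<And>i. i \<in> I \<Longrightarrow> s * i * y \<in> J" "\<And>j. j \<in> J \<Longrightarrow> s * j * x \<in> I"
    using loc_isoE[OF assms(3)] by metis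
  have sP: "s \<in> S - P" using s by simp
  define h where "h A = (\<Union>(i, t)\<in>A. frac S P J (s * i * y) (s * t))" for A
  have h: "h (frac S P I i t) = frac S P J (s * i * y) (s * t)" if it: "i \<in> I" "t \<in> S - P" for i t
  proof -
    have mem: "(i, t) \<in> frac S P I i t" unfolding mem_frac_iff using it comp1 by (auto intro!: bexI[of _ 1])
    have eq: "frac S P J (s * i' * y) (s * t') = frac S P J (s * i * y) (s * t)"
      if "(i', t') \<in> frac S P I i t" for i' t'
    proof -
      obtain u where u: "i' \<in> I" "t' \<in> S - P" "u \<in> S - P" "u * (t' * i - t * i') = 0"
        using \<open>(i', t') \<in> frac S P I i t\<close> unfolding mem_frac_iff by blast
      show ?thesis
      proof (rule frac_eqI[OF s(4)[OF u(1)] compM[OF sP u(2)] s(4)[OF it(1)] compM[OF sP it(2)] u(3)])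
        have "u * (s * t * (s * i' * y) - s * t' * (s * i * y)) = - (s * s * y * (u * (t' * i - t * i')))"
          by (simp add: algebra_simps)
        then show "u * (s * t * (s * i' * y) - s * t' * (s * i * y)) = 0" using u(4) by simp
      qed
    qed
    show ?thesis unfolding h_def
    proof (rule UN_constant_eq[OF mem], rule ballI)
      fix p assume "p \<in> frac S P I i t"
      then show "(case p of (i, t) \<Rightarrow> frac S P J (s * i * y) (s * t)) = frac S P J (s * i * y) (s * t)"
        using eq by (cases p) simp
    qed
  qed
  have "h \<in> LinearCombinations.module_hom (loc_ring S P) (loc_module S P I) (loc_module S P J)"
    unfolding LinearCombinations.module_hom_def
  proof (intro CollectI conjI allI impI; (elim conjE)?)
    show "h \<in> carrier (loc_module S P I) \<rightarrow> carrier (loc_module S P J)"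
    proof (rule funcsetI)
      fix A assume "A \<in> carrier (loc_module S P I)"
      then obtain i t where "A = frac S P I i t" "i \<in> I" "t \<in> S - P" unfolding carrier_loc_module by blast
      then show "h A \<in> carrier (loc_module S P J)"
        unfolding carrier_loc_module using h s(4) compM[OF sP] by blast
    qed
  next
    fix A B assume "A \<in> carrier (loc_module S P I)" "B \<in> carrier (loc_module S P I)"
    then obtain i t i' t' where A: "A = frac S P I i t" "i \<in> I" "t \<in> S - P"
      and B: "B = frac S P I i' t'" "i' \<in> I" "t' \<in> S - P" unfolding carrier_loc_module by blast
    have n: "t' * i + t * i' \<in> I" using A B submodD(2,3)[OF I] by auto
    have "h (A \<oplus>\<^bsub>loc_module S P I\<^esub> B) = frac S P J (s * (t' * i + t * i') * y) (s * (t * t'))"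
      unfolding A(1) B(1) loc_module_add[OF I A(2,3) B(2,3)] by (rule h[OF n compM[OF A(3) B(3)]])
    also have "\<dots> = frac S P J ((s * t') * (s * i * y) + (s * t) * (s * i' * y)) ((s * t) * (s * t'))"
    proof (rule frac_eqI[OF s(4)[OF n] compM[OF sP compM[OF A(3) B(3)]] _ compM[OF compM[OF sP A(3)] compM[OF sP B(3)]] comp1])
      show "(s * t') * (s * i * y) + (s * t) * (s * i' * y) \<in> J"
        using submodD(2,3)[OF J] s(4)[OF A(2)] s(4)[OF B(2)] compM[OF sP A(3)] compM[OF sP B(3)] by auto
    qed (simp add: algebra_simps)
    also have "\<dots> = h A \<oplus>\<^bsub>loc_module S P J\<^esub> h B"
      unfolding A(1) B(1) h[OF A(2,3)] h[OF B(2,3)]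
      by (rule loc_module_add[symmetric, OF J s(4)[OF A(2)] compM[OF sP A(3)] s(4)[OF B(2)] compM[OF sP B(3)]])
    finally show "h (A \<oplus>\<^bsub>loc_module S P I\<^esub> B) = h A \<oplus>\<^bsub>loc_module S P J\<^esub> h B" .
  next
    fix a A assume "a \<in> carrier (loc_ring S P)" "A \<in> carrier (loc_module S P I)"
    then obtain b r i t where a: "a = frac S P S b r" "b \<in> S" "r \<in> S - P"
      and A: "A = frac S P I i t" "i \<in> I" "t \<in> S - P" unfolding carrier_loc_module carrier_loc_ring by blast
    have "h (a \<odot>\<^bsub>loc_module S P I\<^esub> A) = frac S P J (s * (b * i) * y) (s * (r * t))"
      unfolding A(1) a(1) loc_module_smult[OF I a(2,3) A(2,3)]
      by (rule h[OF submodD(3)[OF I a(2) A(2)] compM[OF a(3) A(3)]])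
    also have "\<dots> = frac S P J (b * (s * i * y)) (r * (s * t))" by (simp only: mult_ac)
    also have "\<dots> = a \<odot>\<^bsub>loc_module S P J\<^esub> h A"
      unfolding A(1) a(1) h[OF A(2,3)]
      by (rule loc_module_smult[symmetric, OF J a(2,3) s(4)[OF A(2)] compM[OF sP A(3)]])
    finally show "h (a \<odot>\<^bsub>loc_module S P I\<^esub> A) = a \<odot>\<^bsub>loc_module S P J\<^esub> h A" .
  qed
  moreover have "inj_on h (carrier (loc_module S P I))"
  proof (rule inj_onI)
    fix A B assume "A \<in> carrier (loc_module S P I)" "B \<in> carrier (loc_module S P I)" and eq: "h A = h B"
    then obtain i t i' t' where A: "A = frac S P I i t" "i \<in> I" "t \<in> S - P"
      and B: "B = frac S P I i' t'" "i' \<in> I" "t' \<in> S - P" unfolding carrier_loc_module by blast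
    have "frac S P J (s * i * y) (s * t) = frac S P J (s * i' * y) (s * t')"
      using eq unfolding A(1) B(1) h[OF A(2,3)] h[OF B(2,3)] .
    then obtain u where u: "u \<in> S - P" "u * (s * t' * (s * i * y) - s * t * (s * i' * y)) = 0"
      using frac_eq_iff[OF s(4)[OF A(2)] compM[OF sP A(3)] s(4)[OF B(2)] compM[OF sP B(3)]] by blast
    \<comment> \<open>Multiplying by \<open>x\<close> removes \<open>y\<close>, so
      \<open>u * (s * s)\<close> witnesses the equality of the original fractions.\<close>
    have "(u * (s * s)) * (t' * i - t * i') * (x * y) = x * (u * (s * t' * (s * i * y) - s * t * (s * i' * y)))"
      by (simp add: algebra_simps)
    then have "(u * (s * s)) * (t' * i - t * i') = 0" using u(2) by (simp add: s(1))
    then show "A = B" unfolding A(1) B(1)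
      by (rule frac_eqI[OF A(2,3) B(2,3) compM[OF u(1) compM[OF sP sP]]])
  qed
  moreover have "h ` carrier (loc_module S P I) = carrier (loc_module S P J)"
  proof
    show "h ` carrier (loc_module S P I) \<subseteq> carrier (loc_module S P J)"
      using calculation(1) by (auto simp: LinearCombinations.module_hom_def)
    show "carrier (loc_module S P J) \<subseteq> h ` carrier (loc_module S P I)"
    proof
      fix B assume "B \<in> carrier (loc_module S P J)"
      then obtain j t where B: "B = frac S P J j t" "j \<in> J" "t \<in> S - P" unfolding carrier_loc_module by blast
      have "h (frac S P I (s * j * x) (s * t)) = frac S P J (s * (s * j * x) * y) (s * (s * t))"
        by (rule h[OF s(5)[OF B(2)] compM[OF sP B(3)]])
      also have "\<dots> = B" unfolding B(1)
      proof (rule frac_eqI[OF s(4)[OF s(5)[OF B(2)]] compM[OF sP compM[OF sP B(3)]] B(2,3) comp1])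
        have "1 * (t * (s * (s * j * x) * y) - s * (s * t) * j) = t * s * s * j * (x * y) - s * s * t * j"
          by (simp add: algebra_simps)
        then show "1 * (t * (s * (s * j * x) * y) - s * (s * t) * j) = 0" by (simp add: s(1) algebra_simps)
      qed
      finally show "B \<in> h ` carrier (loc_module S P I)"
        using s(5)[OF B(2)] compM[OF sP B(3)] unfolding carrier_loc_module by blast
    qed
  qed
  ultimately show ?thesis unfolding module_iso_def bij_betw_def by blast
qed

end

section \<open>The type as a number of generators\<close>

definition coset :: "'k set \<Rightarrow> 'k \<Rightarrow> 'k set" where "coset N x = (\<lambda>n. n + x) ` N"

lemma coset_iff: "y \<in> coset N x \<longleftrightarrow> y - x \<in> N"
  unfolding coset_def by (force simp: image_iff)

lemma coset_eq_iff:
  assumes N: "FI N" shows "coset N x = coset N y \<longleftrightarrow> x - y \<in> N"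
proof
  assume "coset N x = coset N y"
  moreover have "x \<in> coset N x" using FID(2)[OF N] by (simp add: coset_iff)
  ultimately show "x - y \<in> N" by (simp add: coset_iff)
next
  assume xy: "x - y \<in> N"
  have "z - x \<in> N \<longleftrightarrow> z - y \<in> N" for z
    using FID(3)[OF N _ xy, of "z - x"] FID(5)[OF N _ xy, of "z - y"] by auto
  then show "coset N x = coset N y" by (auto simp: coset_iff)
qed

lemma coset_add:
  assumes N: "FI N" shows "set_add (module_on M) (coset N x) (coset N y) = coset N (x + y)"
proof (rule Set.set_eqI)
  fix z
  have "z \<in> set_add (module_on M) (coset N x) (coset N y) \<longleftrightarrow> (\<exists>a\<in>coset N x. \<exists>b\<in>coset N y. z = a + b)"
    by (auto simp: set_add_def' module_on_def)
  also have "\<dots> \<longleftrightarrow> z \<in> coset N (x + y)"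
  proof
    assume "\<exists>a\<in>coset N x. \<exists>b\<in>coset N y. z = a + b"
    then obtain a b where ab: "a - x \<in> N" "b - y \<in> N" "z = a + b" by (auto simp: coset_iff)
    have "z - (x + y) = (a - x) + (b - y)" by (simp add: ab(3))
    also have "\<dots> \<in> N" by (rule FID(3)[OF N ab(1,2)])
    finally show "z \<in> coset N (x + y)" by (simp add: coset_iff)
  next
    assume "z \<in> coset N (x + y)"
    then have "z - y \<in> coset N x" by (simp add: coset_iff algebra_simps)
    moreover have "y \<in> coset N y" using FID(2)[OF N] by (simp add: coset_iff)
    ultimately show "\<exists>a\<in>coset N x. \<exists>b\<in>coset N y. z = a + b" by (intro bexI[of _ "z - y"] bexI[of _ y]) auto
  qed
  finally show "z \<in> set_add (module_on M) (coset N x) (coset N y) \<longleftrightarrow> z \<in> coset N (x + y)" .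
qed

context
  fixes P assumes P: "P \<in> primes"
begin

abbreviation N where "N \<equiv> prod_mod P D"
abbreviation V where "V \<equiv> quot_module (module_on D) N"
abbreviation kP where "kP \<equiv> ring_on S Quot P"

lemma N: "FI N" "p \<in> P \<Longrightarrow> d \<in> D \<Longrightarrow> p * d \<in> N" "N \<subseteq> D"
  using PD[OF P] by auto

lemma r_coset_module: "a_r_coset (module_on D) M x = coset M x"
  by (auto simp: a_r_coset_def' module_on_def coset_def)

lemma r_coset_ring: "a_r_coset (ring_on S) M x = coset M x"
  by (auto simp: a_r_coset_def' coset_def)

lemma V_simps: "carrier V = coset N ` D" "\<zero>\<^bsub>V\<^esub> = coset N 0"
    "coset N x \<oplus>\<^bsub>V\<^esub> coset N y = coset N (x + y)"
proof -
  show "carrier V = coset N ` D"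
    by (auto simp: quot_module_def A_RCOSETS_def' r_coset_module) (auto simp: module_on_def)
  show "\<zero>\<^bsub>V\<^esub> = coset N 0" by (auto simp: quot_module_def coset_def)
  show "coset N x \<oplus>\<^bsub>V\<^esub> coset N y = coset N (x + y)" by (simp add: quot_module_def coset_add[OF N(1)])
qed

interpretation maximalideal P "ring_on S"
proof (rule maximalidealI)
  show "ideal P (ring_on S)" using ideal_ring_on_iff[OF subring] primesD(2,3)[OF P] by blast
  show "carrier (ring_on S) \<noteq> P" using R(1) primesD(4)[OF P] by auto
  fix J assume J: "ideal J (ring_on S)" "P \<subseteq> J" "J \<subseteq> carrier (ring_on S)"
  have sJ: "submod S J" using J(1) ideal_ring_on_iff[OF subring] by blast
  show "J = P \<or> J = carrier (ring_on S)"
  proof (rule disjCI)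
    assume "J \<noteq> carrier (ring_on S)"
    have "1 \<notin> J"
    proof
      assume "1 \<in> J"
      then have "x \<in> J" if "x \<in> S" for x using submodD(3)[OF sJ that, of 1] by simp
      then show False using \<open>J \<noteq> _\<close> J(3) by auto
    qed
    have "x \<in> P" if x: "x \<in> J" for x
    proof (rule ccontr)
      assume "x \<notin> P"
      then obtain y where y: "y \<in> S" "1 - y * x \<in> P" using primesD(7)[OF P, of x] x J(3) by auto
      have "(1 - y * x) + y * x \<in> J" using submodD(2,3)[OF sJ] y x J(2) by blast
      then show False using \<open>1 \<notin> J\<close> by simp
    qed
    then show "J = P" using J(2) by blast
  qed
qed

lemma kP_simps: "carrier kP = coset P ` S" "\<one>\<^bsub>kP\<^esub> = coset P 1"
    "a \<in> S \<Longrightarrow> b \<in> S \<Longrightarrow> coset P a \<otimes>\<^bsub>kP\<^esub> coset P b = coset P (a * b)"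
    "a \<in> S \<Longrightarrow> b \<in> S \<Longrightarrow> coset P a \<oplus>\<^bsub>kP\<^esub> coset P b = coset P (a + b)"
proof -
  show "carrier kP = coset P ` S" by (auto simp: FactRing_def A_RCOSETS_def' r_coset_ring)
  show "\<one>\<^bsub>kP\<^esub> = coset P 1" by (simp add: FactRing_def r_coset_ring)
  show "coset P a \<otimes>\<^bsub>kP\<^esub> coset P b = coset P (a * b)" if "a \<in> S" "b \<in> S"
    using rcoset_mult_add[of a b] that by (simp add: FactRing_def r_coset_ring)
  show "coset P a \<oplus>\<^bsub>kP\<^esub> coset P b = coset P (a + b)" if "a \<in> S" "b \<in> S"
    using a_rcos_sum[of a b] that by (simp add: FactRing_def r_coset_ring)
qed

text \<open>Independence of representatives: \<open>b y - a x = b (y - x) + (b - a) x\<close>, and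
  both terms lie in \<open>P D\<close>.\<close>

lemma V_smult:
  assumes a: "a \<in> S" and x: "x \<in> D"
  shows "coset P a \<odot>\<^bsub>V\<^esub> coset N x = coset N (a * x)"
proof -
  have PI: "FI P" using idl_FI[OF primes_idl[OF P]] .
  have eq: "coset N (b * y) = coset N (a * x)" if b: "b \<in> coset P a" and y: "y \<in> coset N x" for b y
  proof -
    have b': "b - a \<in> P" and y': "y - x \<in> N" using b y by (auto simp: coset_iff)
    have "b - a + a \<in> S" using b' a R(6) primesD(3)[OF P] by blast
    then have bS: "b \<in> S" by simp
    have "b * (y - x) + (b - a) * x \<in> N" using N(2)[OF b' x] FID(4)[OF N(1) bS y'] FID(3)[OF N(1)] by blast
    then show ?thesis unfolding coset_eq_iff[OF N(1)] by (simp add: algebra_simps)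
  qed
  have ne: "a \<in> coset P a" "x \<in> coset N x"
    using FID(2)[OF PI] FID(2)[OF N(1)] by (auto simp: coset_iff)
  have "coset P a \<odot>\<^bsub>V\<^esub> coset N x = (\<Union>b\<in>coset P a. \<Union>y\<in>coset N x. coset N (b * y))"
    by (simp add: quot_module_def r_coset_module) (simp add: module_on_def)
  also have "\<dots> = coset N (a * x)"
  proof (rule UN_constant_eq[OF ne(1)], rule ballI)
    fix b assume b: "b \<in> coset P a"
    show "(\<Union>y\<in>coset N x. coset N (b * y)) = coset N (a * x)"
      by (rule UN_constant_eq[OF ne(2)], rule ballI) (rule eq[OF b])
  qed
  finally show ?thesis .
qed

interpretation V: vectorspace kP V
proof -
  have cr: "cring (ring_on S)" by (rule cring_ring_on[OF subring])
  have f: "Ring.field kP" by (rule quotient_is_field[OF cr])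
  have ag: "abelian_group V"
  proof (rule abelian_groupI)
    show "x \<oplus>\<^bsub>V\<^esub> y \<in> carrier V" if "x \<in> carrier V" "y \<in> carrier V" for x y
      using that D(3) by (auto simp: V_simps)
    show "\<zero>\<^bsub>V\<^esub> \<in> carrier V" using D(2) by (auto simp: V_simps)
    show "x \<oplus>\<^bsub>V\<^esub> y \<oplus>\<^bsub>V\<^esub> z = x \<oplus>\<^bsub>V\<^esub> (y \<oplus>\<^bsub>V\<^esub> z)" if "x \<in> carrier V" "y \<in> carrier V" "z \<in> carrier V" for x y z
      using that by (auto simp: V_simps add.assoc)
    show "x \<oplus>\<^bsub>V\<^esub> y = y \<oplus>\<^bsub>V\<^esub> x" if "x \<in> carrier V" "y \<in> carrier V" for x y
      using that by (auto simp: V_simps add.commute)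
    show "\<zero>\<^bsub>V\<^esub> \<oplus>\<^bsub>V\<^esub> x = x" if "x \<in> carrier V" for x
      using that by (auto simp: V_simps)
    show "\<exists>y\<in>carrier V. y \<oplus>\<^bsub>V\<^esub> x = \<zero>\<^bsub>V\<^esub>" if "x \<in> carrier V" for x
    proof -
      obtain d where d: "d \<in> D" "x = coset N d" using \<open>x \<in> carrier V\<close> by (auto simp: V_simps)
      have "- d \<in> D" using D(5)[OF D(2) d(1)] by simp
      then show ?thesis by (intro bexI[of _ "coset N (- d)"]) (auto simp: V_simps d(2))
    qed
  qed
  have "module kP V"
  proof (rule moduleI[OF _ ag])
    show "cring kP" using quotient_is_cring[OF cr] .
    show "a \<odot>\<^bsub>V\<^esub> x \<in> carrier V" if "a \<in> carrier kP" "x \<in> carrier V" for a x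
      using that D(4) by (auto simp: V_simps(1) kP_simps(1) V_smult)
    show "(a \<oplus>\<^bsub>kP\<^esub> b) \<odot>\<^bsub>V\<^esub> x = a \<odot>\<^bsub>V\<^esub> x \<oplus>\<^bsub>V\<^esub> b \<odot>\<^bsub>V\<^esub> x"
      if "a \<in> carrier kP" "b \<in> carrier kP" "x \<in> carrier V" for a b x
      using that R(6) by (auto simp: V_simps kP_simps V_smult distrib_right)
    show "a \<odot>\<^bsub>V\<^esub> (x \<oplus>\<^bsub>V\<^esub> y) = a \<odot>\<^bsub>V\<^esub> x \<oplus>\<^bsub>V\<^esub> a \<odot>\<^bsub>V\<^esub> y"
      if "a \<in> carrier kP" "x \<in> carrier V" "y \<in> carrier V" for a x y
      using that D(3) by (auto simp: V_simps kP_simps V_smult distrib_left)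
    show "(a \<otimes>\<^bsub>kP\<^esub> b) \<odot>\<^bsub>V\<^esub> x = a \<odot>\<^bsub>V\<^esub> (b \<odot>\<^bsub>V\<^esub> x)"
      if "a \<in> carrier kP" "b \<in> carrier kP" "x \<in> carrier V" for a b x
      using that R(4) D(4) by (auto simp: V_simps kP_simps V_smult mult.assoc)
    show "\<one>\<^bsub>kP\<^esub> \<odot>\<^bsub>V\<^esub> x = x" if "x \<in> carrier V" for x
      using that R(1) by (auto simp: V_simps kP_simps V_smult)
  qed
  with f show "vectorspace kP V" by (simp add: vectorspace_def)
qed

text \<open>Spans of cosets over \<open>S/P\<close> and spans of representatives over
  \<open>S\<close> are compared by minimality: the image of the latter is a submodule over
  \<open>S/P\<close>, and the preimage of the former is a submodule over \<open>S\<close>.\<close>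

lemma gen_set_iff:
  assumes W: "W \<subseteq> D" "finite W"
  shows "V.gen_set (coset N ` W) \<longleftrightarrow> (\<forall>d\<in>D. \<exists>y\<in>lin_span S W. d - y \<in> N)"
proof
  have WD: "lin_span S W \<subseteq> D" by (rule lin_span_least[OF D(1) W(1)])
  note sW = submodD[OF submod_lin_span[OF subring, of W]]
  define M where "M = coset N ` lin_span S W"
  have sub: "LinearCombinations.submodule kP M V"
  proof (rule LinearCombinations.submodule.intro)
    show "module kP V" ..
    show "M \<subseteq> carrier V" using WD by (auto simp: M_def V_simps)
    show "v \<oplus>\<^bsub>V\<^esub> w \<in> M" if "v \<in> M" "w \<in> M" for v w
      using that sW(2) by (auto simp: M_def V_simps)
    show "\<zero>\<^bsub>V\<^esub> \<in> M" using sW(1) by (auto simp: M_def V_simps)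
    show "c \<odot>\<^bsub>V\<^esub> v \<in> M" if cv: "c \<in> carrier kP" "v \<in> M" for c v
    proof -
      obtain a x where "a \<in> S" "c = coset P a" "x \<in> lin_span S W" "v = coset N x"
        using cv by (auto simp: M_def kP_simps)
      then show ?thesis using sW(3) WD V_smult[of a x] by (auto simp: M_def)
    qed
  qed
  have WM: "coset N ` W \<subseteq> M" using lin_span_base[OF subring W(2)] by (auto simp: M_def)
  assume gen: "V.gen_set (coset N ` W)"
  show "\<forall>d\<in>D. \<exists>y\<in>lin_span S W. d - y \<in> N"
  proof
    fix d assume "d \<in> D"
    then have "coset N d \<in> V.span (coset N ` W)" using gen by (simp add: V_simps)
    then have "coset N d \<in> M" using V.span_is_subset[OF WM sub] by blast
    then obtain y where "y \<in> lin_span S W" "coset N d = coset N y" by (auto simp: M_def)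
    then show "\<exists>y\<in>lin_span S W. d - y \<in> N" using coset_eq_iff[OF N(1)] by blast
  qed
next
  assume gen: "\<forall>d\<in>D. \<exists>y\<in>lin_span S W. d - y \<in> N"
  have Wc: "coset N ` W \<subseteq> carrier V" using W(1) by (auto simp: V_simps)
  interpret sp: LinearCombinations.submodule kP "V.span (coset N ` W)" V by (rule V.span_is_submodule[OF Wc])
  define M where "M = {d \<in> D. coset N d \<in> V.span (coset N ` W)}"
  have "submod S M" unfolding submod_def
  proof (intro conjI ballI)
    show "0 \<in> M" using D(2) sp.zero_closed by (simp add: M_def V_simps)
    show "x + y \<in> M" if "x \<in> M" "y \<in> M" for x y
      using that D(3) sp.m_closed[of "coset N x" "coset N y"] by (simp add: M_def V_simps)
    show "r * x \<in> M" if "r \<in> S" "x \<in> M" for r x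
      using that D(4) sp.smult_closed[of "coset P r" "coset N x"] V_smult[of r x] by (simp add: M_def kP_simps)
  qed
  moreover have "W \<subseteq> M" using V.in_own_span[OF Wc] W(1) by (auto simp: M_def)
  ultimately have LM: "lin_span S W \<subseteq> M" by (rule lin_span_least)
  have "carrier V \<subseteq> V.span (coset N ` W)"
  proof
    fix v assume "v \<in> carrier V"
    then obtain d where d: "d \<in> D" "v = coset N d" by (auto simp: V_simps)
    then obtain y where y: "y \<in> lin_span S W" "d - y \<in> N" using gen by blast
    then have "v = coset N y" using coset_eq_iff[OF N(1)] d(2) by blast
    then show "v \<in> V.span (coset N ` W)" using y(1) LM by (auto simp: M_def)
  qed
  then show "V.gen_set (coset N ` W)" using V.span_is_subset2[OF Wc] by blast
qed

text \<open>The dimension is the least size of a finite generating set. This least number is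
  attained because \<open>D\<close> is finitely generated over \<open>S\<close>.\<close>

lemma dim_le_iff:
  "V.dim \<le> n \<longleftrightarrow> (\<exists>W. W \<subseteq> D \<and> finite W \<and> card W \<le> n \<and> (\<forall>d\<in>D. \<exists>y\<in>lin_span S W. d - y \<in> N))"
proof
  assume le: "V.dim \<le> n"
  let ?Q = "\<lambda>n. \<exists>A. finite A \<and> card A = n \<and> A \<subseteq> carrier V \<and> V.gen_set A"
  obtain B where B: "finite B" "B \<subseteq> D" "D = lin_span S B" using FI_fg[OF D_frac] by blast
  have "\<forall>d\<in>D. \<exists>y\<in>lin_span S B. d - y \<in> N"
    unfolding B(3)[symmetric] using FID(2)[OF N(1)] by (intro ballI bexI) auto
  then have "V.gen_set (coset N ` B)" using gen_set_iff[OF B(2,1)] by blast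
  then have "?Q (card (coset N ` B))" using B(1,2) by (intro exI[of _ "coset N ` B"]) (auto simp: V_simps)
  then have "?Q V.dim" unfolding V.dim_def by (rule LeastI)
  then obtain A where A: "finite A" "card A = V.dim" "A \<subseteq> coset N ` D" "V.gen_set A" by (auto simp: V_simps)
  \<comment> \<open>One representative for each coset, so that lifting does not increase the number
    of generators.\<close>
  obtain W where W': "W \<subseteq> D" "inj_on (coset N) W" "A = coset N ` W"
    using A(3) unfolding subset_image_inj by blast
  have fW: "finite W" using A(1) unfolding W'(3) by (rule finite_imageD[OF _ W'(2)])
  have cW: "card W = card A" unfolding W'(3) by (rule card_image[OF W'(2), symmetric])
  have "\<forall>d\<in>D. \<exists>y\<in>lin_span S W. d - y \<in> N"
    using A(4) gen_set_iff[OF W'(1) fW] unfolding W'(3) by blast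
  moreover have "card W \<le> n" using cW A(2) le by simp
  ultimately show "\<exists>W. W \<subseteq> D \<and> finite W \<and> card W \<le> n \<and> (\<forall>d\<in>D. \<exists>y\<in>lin_span S W. d - y \<in> N)"
    using W'(1) fW by blast
next
  assume "\<exists>W. W \<subseteq> D \<and> finite W \<and> card W \<le> n \<and> (\<forall>d\<in>D. \<exists>y\<in>lin_span S W. d - y \<in> N)"
  then obtain W where W: "W \<subseteq> D" "finite W" "card W \<le> n" "\<forall>d\<in>D. \<exists>y\<in>lin_span S W. d - y \<in> N" by blast
  have "V.dim \<le> card (coset N ` W)"
    by (rule V.gen_ge_dim) (use W gen_set_iff[OF W(1,2)] in \<open>auto simp: V_simps\<close>)
  also have "\<dots> \<le> n" using card_image_le[OF W(2), of "coset N"] W(3) by linarith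
  finally show "V.dim \<le> n" .
qed

end

section \<open>Types at most one and at most two\<close>

definition type_P :: "'k set \<Rightarrow> nat" where
  "type_P P = vectorspace.dim (ring_on S Quot P) (quot_module (module_on D) (prod_mod P D))"

text \<open>\<open>v\<close> and \<open>w\<close> may coincide and \<open>W\<close> may be smaller
  than \<open>{v, w}\<close>; in this form all generating sets with at most two elements, or with at
  most one, are treated alike.\<close>

lemma lin_span_two:
  assumes "W \<subseteq> {v, w}" "y \<in> lin_span S W"
  obtains a b where "a \<in> S" "b \<in> S" "y = a * v + b * w"
proof -
  define M where "M = {a * v + b * w |a b. a \<in> S \<and> b \<in> S}"
  have MI: "a * v + b * w \<in> M" if "a \<in> S" "b \<in> S" for a b using that by (auto simp: M_def)
  have "submod S M" unfolding submod_def
  proof (intro conjI ballI)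
    show "0 \<in> M" using MI[OF R(2,2)] by simp
    fix x y assume "x \<in> M" "y \<in> M"
    then obtain a b c d where *: "a \<in> S" "b \<in> S" "x = a * v + b * w" "c \<in> S" "d \<in> S" "y = c * v + d * w"
      unfolding M_def by blast
    have "x + y = (a + c) * v + (b + d) * w" by (simp add: * algebra_simps)
    then show "x + y \<in> M" using MI[OF R(6)[OF *(1,4)] R(6)[OF *(2,5)]] by simp
  next
    fix r x assume r: "r \<in> S" "x \<in> M"
    then obtain a b where *: "a \<in> S" "b \<in> S" "x = a * v + b * w" unfolding M_def by blast
    have "r * x = (r * a) * v + (r * b) * w" by (simp add: * algebra_simps)
    then show "r * x \<in> M" using MI[OF R(4)[OF r(1) *(1)] R(4)[OF r(1) *(2)]] by simp
  qed
  moreover have "{v, w} \<subseteq> M" using MI[OF R(1,2)] MI[OF R(2,1)] by simp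
  ultimately have "lin_span S W \<subseteq> M" using lin_span_least assms(1) by blast
  then show ?thesis using that assms(2) unfolding M_def by blast
qed

lemma type_le_two:
  assumes P: "P \<in> primes" and t: "type_P P \<le> 2"
  obtains w1 w2 where "w1 \<in> D" "w2 \<in> D" "gen2 P w1 w2"
proof -
  obtain W where W: "W \<subseteq> D" "finite W" "card W \<le> 2" "\<forall>d\<in>D. \<exists>y\<in>lin_span S W. d - y \<in> prod_mod P D"
    using t dim_le_iff[OF P, of 2] unfolding type_P_def by blast
  have "\<exists>v w. v \<in> D \<and> w \<in> D \<and> W \<subseteq> {v, w}"
  proof -
    consider "W = {}" | v where "W = {v}" | v w where "W = {v, w}"
      using W(2,3) by (metis card_0_eq card_1_singletonE card_2_iff le_Suc_eq le_zero_eq numeral_2_eq_2 One_nat_def)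
    then show ?thesis using W(1) D(2) by cases auto
  qed
  then obtain v w where vw: "v \<in> D" "w \<in> D" "W \<subseteq> {v, w}" by blast
  have "gen2 P v w" unfolding gen2_def
  proof
    fix d assume "d \<in> D"
    then obtain y where y: "y \<in> lin_span S W" "d - y \<in> prod_mod P D" using W(4) by blast
    show "\<exists>a\<in>S. \<exists>b\<in>S. d - (a * v + b * w) \<in> prod_mod P D"
      using lin_span_two[OF vw(3) y(1)] y(2) by metis
  qed
  then show ?thesis using that vw by blast
qed

text \<open>One generator of \<open>D\<close> modulo \<open>P D\<close> lifts by Nakayama's lemma to
  a local generator of \<open>D\<close>; conversely a local generator spans modulo
  \<open>P D\<close>.\<close>

lemma type_le_one_iff:
  assumes P: "P \<in> primes"
  shows "type_P P \<le> 1 \<longleftrightarrow> loc_iso P D S"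
proof
  assume t: "type_P P \<le> 1"
  obtain W where W: "W \<subseteq> D" "finite W" "card W \<le> 1" "\<forall>d\<in>D. \<exists>y\<in>lin_span S W. d - y \<in> prod_mod P D"
    using t dim_le_iff[OF P, of 1] unfolding type_P_def by blast
  have "\<exists>w\<in>D. W \<subseteq> {w, w}"
  proof -
    consider "W = {}" | v where "W = {v}"
      using W(2,3) by (metis card_0_eq card_1_singletonE le_Suc_eq le_zero_eq One_nat_def)
    then show ?thesis using W(1) D(2) by cases auto
  qed
  then obtain w where w: "w \<in> D" "W \<subseteq> {w, w}" by blast
  have "gen1 P w" unfolding gen1_def
  proof
    fix d assume "d \<in> D"
    then obtain y where y: "y \<in> lin_span S W" "d - y \<in> prod_mod P D" using W(4) by blast
    obtain a b where ab: "a \<in> S" "b \<in> S" "y = a * w + b * w" using lin_span_two[OF w(2) y(1)] by blast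
    then have "d - (a + b) * w \<in> prod_mod P D" using y(2) by (simp add: distrib_right)
    then show "\<exists>a\<in>S. d - a * w \<in> prod_mod P D" using R(6)[OF ab(1,2)] by blast
  qed
  then show "loc_iso P D S" using gen1_loc_iso[OF P w(1)] by blast
next
  assume "loc_iso P D S"
  then obtain w where w: "w \<in> D" "gen1 P w" using loc_iso_gen1[OF P] by blast
  have "\<exists>y\<in>lin_span S {w}. d - y \<in> prod_mod P D" if "d \<in> D" for d
  proof -
    obtain a where a: "a \<in> S" "d - a * w \<in> prod_mod P D" using w(2) \<open>d \<in> D\<close> unfolding gen1_def by blast
    moreover have "a * w \<in> lin_span S {w}"
      using submodD(3)[OF submod_lin_span[OF subring] a(1) lin_span_base[OF subring, of "{w}" w]] by simp
    ultimately show ?thesis by blast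
  qed
  then have "\<exists>W. W \<subseteq> D \<and> finite W \<and> card W \<le> 1 \<and> (\<forall>d\<in>D. \<exists>y\<in>lin_span S W. d - y \<in> prod_mod P D)"
    using w(1) by (intro exI[of _ "{w}"]) auto
  then show "type_P P \<le> 1" using dim_le_iff[OF P, of 1] unfolding type_P_def by blast
qed

text \<open>A generating set of \<open>D\<close> also generates every \<open>D/PD\<close>. This
  makes the set of types finite, so that \<open>Max\<close> has its intended meaning.\<close>

lemma type_bounded: "\<exists>n. \<forall>P\<in>primes. type_P P \<le> n"
proof -
  obtain B where B: "finite B" "B \<subseteq> D" "D = lin_span S B" using FI_fg[OF D_frac] by blast
  have "type_P P \<le> card B" if P: "P \<in> primes" for P
  proof -
    have "\<forall>d\<in>D. \<exists>y\<in>lin_span S B. d - y \<in> prod_mod P D"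
      unfolding B(3)[symmetric] using FID(2)[OF PD(1)[OF P]] by (intro ballI bexI) auto
    then show ?thesis using dim_le_iff[OF P, of "card B"] B(1,2) unfolding type_P_def by blast
  qed
  then show ?thesis by blast
qed

section \<open>Isomorphisms of fractional ideals\<close>

text \<open>An \<open>S\<close>-linear map between fractional ideals is multiplication by
  \<open>f m / m\<close>: with \<open>d I \<subseteq> S\<close> one has
  \<open>d m f(i) = f((d i) m) = d i f(m)\<close>, and \<open>d\<close> and \<open>m\<close> can be
  cancelled as units of \<open>K\<close>.\<close>

lemma module_iso_iff:
  assumes I: "FI I" and J: "FI J"
  shows "module_iso (ring_on S) (module_on I) (module_on J) \<longleftrightarrow> iso I J"
proof
  assume "module_iso (ring_on S) (module_on I) (module_on J)"
  then obtain f where bij: "bij_betw f I J" and lin: "\<And>r x. r \<in> S \<Longrightarrow> x \<in> I \<Longrightarrow> f (r * x) = r * f x"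
    by (auto simp: module_iso_def LinearCombinations.module_hom_def module_on_def)
  obtain m where m: "m \<in> Zn" "m \<in> I" using FID(6)[OF I] by blast
  obtain n where n: "m * n = 1" using Zn_unit[OF m(1)] by blast
  obtain d where d: "d \<in> Zn" "\<forall>x\<in>I. d * x \<in> S" using FID(7)[OF I] by blast
  obtain e where e: "d * e = 1" using Zn_unit[OF d(1)] by blast
  define \<alpha> where "\<alpha> = f m * n"
  have f: "f i = \<alpha> * i" if i: "i \<in> I" for i
  proof -
    have "d * m * f i = f ((d * i) * m)" using lin[of "d * m" i] d(2) m(2) i by (simp add: mult_ac)
    also have "\<dots> = d * i * f m" using lin[of "d * i" m] d(2) m(2) i by simp
    finally have "(e * n) * (d * m * f i) = (e * n) * (d * i * f m)" by simp
    moreover have "(e * n) * (d * m * f i) = (d * e) * (m * n) * f i" by (simp only: mult_ac)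
    moreover have "(e * n) * (d * i * f m) = (d * e) * (f m * n * i)" by (simp only: mult_ac)
    ultimately show ?thesis by (simp add: e n \<alpha>_def)
  qed
  obtain m' where m': "m' \<in> Zn" "m' \<in> J" using FID(6)[OF J] by blast
  obtain n' where n': "m' * n' = 1" using Zn_unit[OF m'(1)] by blast
  \<comment> \<open>\<open>m' = \<alpha> * i'\<close> is a unit of \<open>K\<close>, so
    \<open>\<alpha>\<close> is one too, with inverse \<open>i' * n'\<close>.\<close>
  obtain i' where i': "i' \<in> I" "m' = f i'" using m'(2) bij by (auto simp: bij_betw_def)
  have u: "\<alpha> * (i' * n') = 1" using n' f[OF i'(1)] i'(2) by (simp add: mult.assoc)
  have "\<alpha> * i \<in> J" if "i \<in> I" for i
    unfolding f[OF that, symmetric] using bij_betwE[OF bij] that by blast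
  moreover have "(i' * n') * j \<in> I" if j: "j \<in> J" for j
  proof -
    obtain i where i: "i \<in> I" "j = f i" using j bij by (auto simp: bij_betw_def)
    have "(i' * n') * j = (\<alpha> * (i' * n')) * i" unfolding i(2) f[OF i(1)] by (simp only: mult_ac)
    then show ?thesis using i(1) u by simp
  qed
  ultimately show "iso I J" unfolding iso_def using u by blast
next
  assume "iso I J"
  then obtain x y where 1: "x * y = 1" "\<forall>i\<in>I. x * i \<in> J" "\<forall>j\<in>J. y * j \<in> I" unfolding iso_def by blast
  have yx: "y * (x * i) = i" "x * (y * i) = i" for i using 1(1) by (metis mult.assoc mult.commute mult_1)+
  have "bij_betw ((*) x) I J"
    by (rule bij_betw_byWitness[where f' = "(*) y"]) (use 1 yx in auto)
  moreover have "(*) x \<in> LinearCombinations.module_hom (ring_on S) (module_on I) (module_on J)"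
    using 1(2) by (auto simp: LinearCombinations.module_hom_def module_on_def distrib_left mult.left_commute)
  ultimately show "module_iso (ring_on S) (module_on I) (module_on J)"
    unfolding module_iso_def by (intro bexI[of _ "(*) x"]) (auto simp: module_on_def)
qed

end

section \<open>Orders of type at most two\<close>

context etale_order
begin

lemma primes_of_eq: "primes_of \<iota> \<phi> S = dual.primes"
proof -
  have "frac_ideal S Zn P \<and> prime_in S P \<longleftrightarrow> P \<in> dual.primes" for P
  proof
    assume "frac_ideal S Zn P \<and> prime_in S P"
    then show "P \<in> dual.primes" unfolding dual.primes_def frac_ideal_def by blast
  next
    assume P: "P \<in> dual.primes"
    show "frac_ideal S Zn P \<and> prime_in S P"
      using dual.idl_FI[OF dual.primes_idl[OF P]] dual.primesD(1)[OF P] by blast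
  qed
  then show ?thesis
    unfolding primes_of_def fractional_ideal_iff primeideal_ring_on_iff[OF S_subring] by blast
qed

lemma type_at_eq: "type_at \<iota> \<phi> S P = dual.type_P P"
  by (simp add: type_at_def dual.type_P_def)

lemma iso_classes_eq:
  assumes "\<And>I. I \<in> F \<Longrightarrow> frac_ideal S Zn I"
  shows "iso_classes S F = dual.iclasses F"
proof -
  have "{(I, J). I \<in> F \<and> J \<in> F \<and> module_iso (ring_on S) (module_on I) (module_on J)}
    = {(I, J). I \<in> F \<and> J \<in> F \<and> dual.iso I J}"
    using dual.module_iso_iff assms by blast
  then show ?thesis by (simp add: iso_classes_def dual.iclasses_def)
qed

lemma local_classification:
  assumes "P \<in> dual.primes" "dual.type_P P \<le> 2" "frac_ideal S Zn I" "colon I I = S"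
  shows "dual.loc_iso P I S \<or> dual.loc_iso P I Dt"
proof -
  obtain w1 w2 where "w1 \<in> Dt" "w2 \<in> Dt" "dual.gen2 P w1 w2"
    using dual.type_le_two[OF assms(1,2)] by blast
  then show ?thesis using dual.locally_S_or_D[OF assms(1,3,4)] by blast
qed

lemma ICM_eqpoll:
  assumes "\<And>P. P \<in> dual.primes \<Longrightarrow> dual.type_P P \<le> 2"
  shows "finite dual.T" "ICM \<iota> \<phi> S \<approx> {..<(2::nat) ^ card dual.T} \<times> Pic \<iota> \<phi> S"
proof -
  show fin: "finite dual.T" by (rule dual.finite_T_and_prescribed_ideal(1))
  have "ICM \<iota> \<phi> S = dual.iclasses {I. frac_ideal S Zn I \<and> colon I I = S}"
    unfolding ICM_def fractional_ideal_iff by (rule iso_classes_eq) simp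
  moreover have "Pic \<iota> \<phi> S = dual.iclasses {L. dual.invertible L}"
    unfolding Pic_def fractional_ideal_iff dual.invertible_def by (rule iso_classes_eq) simp
  moreover have "dual.iclasses {I. frac_ideal S Zn I \<and> colon I I = S} \<approx> Pow dual.T \<times> dual.iclasses {L. dual.invertible L}"
    by (rule dual.ideal_classes_eqpoll) (rule local_classification[OF _ assms])
  moreover have "Pow dual.T \<approx> {..<(2::nat) ^ card dual.T}"
    using fin by (simp add: eqpoll_iff_card card_Pow)
  ultimately show "ICM \<iota> \<phi> S \<approx> {..<(2::nat) ^ card dual.T} \<times> Pic \<iota> \<phi> S"
    using eqpoll_trans[OF _ times_eqpoll_cong[OF _ eqpoll_refl]] by metis
qed

end

theorem theorem3:
  fixes \<iota> :: "'z::idom \<Rightarrow> 'q::field"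
    and \<phi> :: "'q \<Rightarrow> 'k::comm_ring_1"
    and S :: "'k set"
  assumes "fraction_field \<iota>"
    and "dedekind_domain \<iota>"
    and "etale_algebra \<phi>"
    and "order_in \<iota> \<phi> S"
  shows "(\<forall>P I. P \<in> primes_of \<iota> \<phi> S \<and> fractional_ideal \<iota> \<phi> S I \<and> colon I I = S \<and>
                type_at \<iota> \<phi> S P = 2 \<longrightarrow>
                module_iso (loc_ring S P) (loc_module S P I) (loc_module S P S) \<or>
                module_iso (loc_ring S P) (loc_module S P I) (loc_module S P (trace_dual \<iota> \<phi> S)))
       \<and> (order_type \<iota> \<phi> S = 2 \<longrightarrow>
            finite {P \<in> primes_of \<iota> \<phi> S. type_at \<iota> \<phi> S P = 2} \<and>
            ICM \<iota> \<phi> S \<approx>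
              {..<(2::nat) ^ card {P \<in> primes_of \<iota> \<phi> S. type_at \<iota> \<phi> S P = 2}} \<times> Pic \<iota> \<phi> S)"
proof -
  interpret etale_order \<iota> \<phi> S by unfold_locales (fact assms)+
  show ?thesis
  proof (intro conjI allI impI; (elim conjE)?)
    fix P I assume "P \<in> primes_of \<iota> \<phi> S" "fractional_ideal \<iota> \<phi> S I" and m: "colon I I = S"
      and t: "type_at \<iota> \<phi> S P = 2"
    then have P: "P \<in> dual.primes" and I: "frac_ideal S Zn I"
      by (simp_all add: primes_of_eq fractional_ideal_iff)
    have "dual.loc_iso P I S \<or> dual.loc_iso P I Dt"
      by (rule local_classification[OF P _ I m]) (use t in \<open>simp add: type_at_eq\<close>)
    then show "module_iso (loc_ring S P) (loc_module S P I) (loc_module S P S) \<or>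
      module_iso (loc_ring S P) (loc_module S P I) (loc_module S P (trace_dual \<iota> \<phi> S))"
      using dual.loc_iso_imp_module_iso[OF P dual.FID(1)[OF I]] dual.FID(1)[OF dual.FI_S] dual.D(1) by blast
  next
    assume ot: "order_type \<iota> \<phi> S = 2"
    \<comment> \<open>Finiteness of the set of types has to come first: without it
      \<open>Max\<close> would not bound the individual types.\<close>
    obtain n where n: "\<forall>P\<in>dual.primes. dual.type_P P \<le> n" using dual.type_bounded by blast
    have fin: "finite (dual.type_P ` dual.primes)"
      by (rule finite_subset[of _ "{..n}"]) (use n in auto)
    have Mx: "Max (dual.type_P ` dual.primes) = 2"
      using ot by (simp add: order_type_def primes_of_eq type_at_eq[abs_def])
    have le: "dual.type_P P \<le> 2" if "P \<in> dual.primes" for P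
      using Max_ge[OF fin imageI[OF that]] Mx by simp
    \<comment> \<open>As no type exceeds 2, failing to be locally principal means having type
      exactly 2; this identifies the primes counted by the statement with \<open>T\<close>.\<close>
    have "dual.type_P P = 2 \<longleftrightarrow> \<not> dual.loc_iso P Dt S" if "P \<in> dual.primes" for P
      using dual.type_le_one_iff[OF that] le[OF that] by linarith
    then have T: "{P \<in> primes_of \<iota> \<phi> S. type_at \<iota> \<phi> S P = 2} = dual.T"
      by (auto simp: primes_of_eq type_at_eq dual.T_def)
    show "finite {P \<in> primes_of \<iota> \<phi> S. type_at \<iota> \<phi> S P = 2}"
      unfolding T by (rule ICM_eqpoll(1)[OF le])
    show "ICM \<iota> \<phi> S \<approx>
      {..<(2::nat) ^ card {P \<in> primes_of \<iota> \<phi> S. type_at \<iota> \<phi> S P = 2}} \<times> Pic \<iota> \<phi> S"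
      unfolding T by (rule ICM_eqpoll(2)[OF le])
  qed
qed

end
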